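(* Let $(B,L)$ and $(B',L')$ be complementary Hadamard pairs with scaling factor $R$. Let $\Lambda(L)$ be the set of integers that can be represented in base $R$ using digits from $L$, and let $\Lambda(L')$ be the set of integers that can be represented in base $R$ using digits from $L'$. Then: (i) The measure $\mu_{B\oplus B'}$ is the Lebesgue measure on the attractor $X_{B\oplus B'}$ and has spectrum $\mathbb{Z}$. Moreover $X_{B\oplus B'}$ is translation congruent to $[0,1]$, i.e., there exists a measurable partition $\{A_n\}_{n\in\mathbb{Z}}$ of $[0,1]$ such that $\{A_n+n\}_{n\in\mathbb{Z}}$ is a partition of $X_{B\oplus B'}$ (partitions being understood up to Lebesgue measure zero). (ii) The measure $\mu_{B\oplus B'}$ is the convolution of the measures $\mu_B$ and $\mu_{B'}$. (iii) The set $\Lambda(L)$ is a spectrum for $\mu_B$ and the set $\Lambda(L')$ is a spectrum for $\mu_{B'}$. (iv) The sets $\Lambda(L)$ and $\Lambda(L')$ have disjoint differences. (v) $\Lambda(L)\oplus\Lambda(L')=\mathbb{Z}$ if and only if for any digits $a_0,\dots,a_{r-1}$ of an extreme cycle for $(B\oplus B',L\oplus L')$, the sequence $p(a_0),\dots,p(a_{r-1})$ consists of the digits of an extreme cycle for $(B,L)$ and the sequence $p'(a_0),\dots,p'(a_{r-1})$ consists of the digits of an extreme cycle for $(B',L')$.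
   Context: Hadamard pair: for an integer $R\ge2$ and finite sets $B,L\subset\mathbb{Z}$ with $0\in B$, $0\in L$, $(B,L)$ is a Hadamard pair with scaling factor $R$ if $\#B=\#L=N$ and the matrix $\frac{1}{\sqrt N}\left(e^{2\pi i R^{-1}bl}\right)_{b\in B,l\in L}$ is unitary. Extreme cycles: put $m_B(x)=\frac1{\#B}\sum_{b\in B}e^{2\pi i bx}$. A finite collection $\{x_0,\dots,x_{r-1}\}$ of real numbers (not assumed pairwise distinct) is a cycle for $L$ if there exist $l_0,\dots,l_{r-1}\in L$ with $\frac{x_0+l_0}{R}=x_1,\dots,\frac{x_{r-2}+l_{r-2}}{R}=x_{r-1},\frac{x_{r-1}+l_{r-1}}{R}=x_0$; $l_0,\dots,l_{r-1}$ are called the digits of this cycle. The cycle is extreme for $(B,L)$ if $|m_B(x_k)|=1$ for all $k$. Direct sum: sets $A,A'\subset\mathbb{R}$ have disjoint differences if $(A-A)\cap(A'-A')=\{0\}$; in this case $A\oplus A'=\{a+a':a\in A,a'\in A'\}$ (the sign $\oplus$ asserts disjoint differences). Complementary Hadamard pairs: two Hadamard pairs $(B,L)$, $(B',L')$ with the same scaling factor $R$ (of possibly different sizes) are complementary if (1) $B\oplus B'$ and $L\oplus L'$ are complete sets of representatives modulo $R$; (2) the extreme cycles for $(B,L)$ and the extreme cycles for $(B',L')$ are contained in $\mathbb{Z}$; (3) the greatest common divisor of the elements of $B\oplus B'$ is $1$. (Since $B\oplus B'$ and $L\oplus L'$ are complete sets of representatives modulo $R$, $(B\oplus B',L\oplus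 L')$ is also a Hadamard pair with scaling factor $R$.) Maps: $p:L\oplus L'\to L$ and $p':L\oplus L'\to L'$ are defined by $p(l+l')=l$, $p'(l+l')=l'$ for $l\in L$, $l'\in L'$. Representation: an integer $x$ can be represented in base $R$ using digits in a set $D\subset\mathbb{Z}$ if there exist integers $x_0=x,x_1,x_2,\dots$ and $l_0,l_1,\dots\in D$ with $x_k=Rx_{k+1}+l_k$ for all $k\ge0$. Invariant measures: for a finite set $D\subset\mathbb{Z}$ with $0\in D$, let $\tau_d(x)=R^{-1}(x+d)$, $d\in D$. The attractor $X_D$ is the unique nonempty compact set with $X_D=\bigcup_{d\in D}\tau_d(X_D)$, i.e. $X_D=\{\sum_{k\ge1}R^{-k}d_k: d_k\in D\}$. $\mu_D$ is the unique Borel probability measure on $\mathbb{R}$ with $\mu_D(E)=\frac{1}{\#D}\sum_{d\in D}\mu_D(\tau_d^{-1}E)$ for all Borel sets $E$. Spectrum: a set $\Lambda\subset\mathbb{R}$ is a spectrum for a finite Borel measure $\mu$ on $\mathbb{R}$ if $\{e^{2\pi i\lambda x}:\lambda\in\Lambda\}$ is an orthogonal basis of $L^2(\mu)$. *)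

theory Defs
  imports "HOL-Probability.Probability" "HOL-Library.Set_Algebras" "HOL-Number_Theory.Cong"
begin

text \<open>The sign \<open>A \<oplus> A'\<close> is rendered as \<open>A + A'\<close> (the elementwise sum of \<open>Set_Algebras\<close>)
  together with the separately stated condition \<open>disjoint_differences A A'\<close>.\<close>

definition disjoint_differences :: "'a::ab_group_add set \<Rightarrow> 'a set \<Rightarrow> bool" where
  "disjoint_differences A A' \<longleftrightarrow>
     {x - y |x y. x \<in> A \<and> y \<in> A} \<inter> {x - y |x y. x \<in> A' \<and> y \<in> A'} = {0}"

definition unitary_on :: "'a set \<Rightarrow> 'b set \<Rightarrow> ('a \<Rightarrow> 'b \<Rightarrow> complex) \<Rightarrow> bool" where
  "unitary_on I J U \<longleftrightarrow>
     (\<forall>i\<in>I. \<forall>i'\<in>I. (\<Sum>j\<in>J. U i j * cnj (U i' j)) = (if i = i' then 1 else 0)) \<and>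
     (\<forall>j\<in>J. \<forall>j'\<in>J. (\<Sum>i\<in>I. cnj (U i j) * U i j') = (if j = j' then 1 else 0))"

definition hadamard_pair :: "int \<Rightarrow> int set \<Rightarrow> int set \<Rightarrow> bool" where
  "hadamard_pair R B L \<longleftrightarrow>
     R \<ge> 2 \<and> finite B \<and> finite L \<and> 0 \<in> B \<and> 0 \<in> L \<and> card B = card L \<and>
     unitary_on B L (\<lambda>b l. complex_of_real (1 / sqrt (real (card B)))
       * cis (2 * pi * (1 / of_int R) * of_int b * of_int l))"

definition mask :: "int set \<Rightarrow> real \<Rightarrow> complex" where
  "mask B x = (1 / of_nat (card B)) * (\<Sum>b\<in>B. cis (2 * pi * of_int b * x))"

text \<open>A cycle is a nonempty list \<open>xs\<close> of points, possibly with repetitions, together with the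
  list \<open>ls\<close> of its digits.\<close>

definition is_cycle :: "int \<Rightarrow> int set \<Rightarrow> real list \<Rightarrow> int list \<Rightarrow> bool" where
  "is_cycle R L xs ls \<longleftrightarrow>
     xs \<noteq> [] \<and> length ls = length xs \<and> set ls \<subseteq> L \<and>
     (\<forall>k<length xs. (xs ! k + of_int (ls ! k)) / of_int R = xs ! (Suc k mod length xs))"

definition is_extreme_cycle ::
    "int \<Rightarrow> int set \<Rightarrow> int set \<Rightarrow> real list \<Rightarrow> int list \<Rightarrow> bool" where
  "is_extreme_cycle R B L xs ls \<longleftrightarrow> is_cycle R L xs ls \<and> (\<forall>x\<in>set xs. cmod (mask B x) = 1)"

definition extreme_cycle_digits :: "int \<Rightarrow> int set \<Rightarrow> int set \<Rightarrow> int list \<Rightarrow> bool" where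
  "extreme_cycle_digits R B L ls \<longleftrightarrow> (\<exists>xs. is_extreme_cycle R B L xs ls)"

definition complete_residues :: "int \<Rightarrow> int set \<Rightarrow> bool" where
  "complete_residues R D \<longleftrightarrow> (\<forall>x. \<exists>!d. d \<in> D \<and> [x = d] (mod R))"

definition complementary_hadamard_pairs ::
    "int \<Rightarrow> int set \<Rightarrow> int set \<Rightarrow> int set \<Rightarrow> int set \<Rightarrow> bool" where
  "complementary_hadamard_pairs R B L B' L' \<longleftrightarrow>
     hadamard_pair R B L \<and> hadamard_pair R B' L' \<and>
     disjoint_differences B B' \<and> complete_residues R (B + B') \<and>
     disjoint_differences L L' \<and> complete_residues R (L + L') \<and>
     (\<forall>xs ls. is_extreme_cycle R B L xs ls \<longrightarrow> set xs \<subseteq> \<int>) \<and>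
     (\<forall>xs ls. is_extreme_cycle R B' L' xs ls \<longrightarrow> set xs \<subseteq> \<int>) \<and>
     Gcd (B + B') = 1"

text \<open>The maps \<open>p\<close> and \<open>p'\<close>; they are meaningful on \<open>L + L'\<close> when \<open>L\<close> and \<open>L'\<close> have
  disjoint differences.\<close>

definition proj1 :: "int set \<Rightarrow> int set \<Rightarrow> int \<Rightarrow> int" where
  "proj1 L L' a = (THE l. l \<in> L \<and> (\<exists>l'\<in>L'. a = l + l'))"

definition proj2 :: "int set \<Rightarrow> int set \<Rightarrow> int \<Rightarrow> int" where
  "proj2 L L' a = (THE l'. l' \<in> L' \<and> (\<exists>l\<in>L. a = l + l'))"

definition representable :: "int \<Rightarrow> int set \<Rightarrow> int set" where
  "representable R D = {x. \<exists>(y :: nat \<Rightarrow> int) (l :: nat \<Rightarrow> int).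
     y 0 = x \<and> (\<forall>k. l k \<in> D \<and> y k = R * y (Suc k) + l k)}"

definition tau :: "int \<Rightarrow> int \<Rightarrow> real \<Rightarrow> real" where
  "tau R d x = (x + of_int d) / of_int R"

text \<open>For \<open>R \<ge> 2\<close> and finite nonempty \<open>D\<close>, Hutchinson's theorem provides existence and
  uniqueness for the following two descriptions.  A measure in the sense of the library carries
  its sigma-algebra, so \<open>sets M = sets borel\<close> is needed for uniqueness.\<close>

definition attractor :: "int \<Rightarrow> int set \<Rightarrow> real set" where
  "attractor R D = (THE X. X \<noteq> {} \<and> compact X \<and> X = (\<Union>d\<in>D. tau R d ` X))"

definition invariant_measure :: "int \<Rightarrow> int set \<Rightarrow> real measure" where
  "invariant_measure R D = (THE M. prob_space M \<and> sets M = sets borel \<and>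
     (\<forall>E\<in>sets borel.
        measure M E = (1 / real (card D)) * (\<Sum>d\<in>D. measure M (tau R d -` E))))"

text \<open>Elements of \<open>L\<^sup>2(M)\<close> are represented by functions, without passing to classes modulo
  equality almost everywhere.\<close>

definition L2_fun :: "'a measure \<Rightarrow> ('a \<Rightarrow> complex) \<Rightarrow> bool" where
  "L2_fun M f \<longleftrightarrow> f \<in> borel_measurable M \<and> integrable M (\<lambda>x. (cmod (f x))\<^sup>2)"

definition L2_norm_of :: "'a measure \<Rightarrow> ('a \<Rightarrow> complex) \<Rightarrow> real" where
  "L2_norm_of M f = sqrt (LINT x|M. (cmod (f x))\<^sup>2)"

text \<open>A family of nonzero, pairwise orthogonal elements with dense linear span.\<close>

definition orthogonal_basis_L2 :: "'a measure \<Rightarrow> 'i set \<Rightarrow> ('i \<Rightarrow> 'a \<Rightarrow> complex) \<Rightarrow> bool" where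
  "orthogonal_basis_L2 M I e \<longleftrightarrow>
     (\<forall>i\<in>I. L2_fun M (e i) \<and> L2_norm_of M (e i) \<noteq> 0) \<and>
     (\<forall>i\<in>I. \<forall>j\<in>I. i \<noteq> j \<longrightarrow> (LINT x|M. e i x * cnj (e j x)) = 0) \<and>
     (\<forall>f \<epsilon>. L2_fun M f \<and> \<epsilon> > 0 \<longrightarrow>
        (\<exists>F c. finite F \<and> F \<subseteq> I \<and> L2_norm_of M (\<lambda>x. f x - (\<Sum>i\<in>F. c i * e i x)) < \<epsilon>))"

definition is_spectrum :: "real measure \<Rightarrow> real set \<Rightarrow> bool" where
  "is_spectrum M \<Lambda> \<longleftrightarrow>
     finite_measure M \<and> sets M = sets borel \<and>
     orthogonal_basis_L2 M \<Lambda> (\<lambda>t x. cis (2 * pi * t * x))"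

text \<open>Measurable partitions up to Lebesgue null sets.\<close>

definition ae_partition :: "('i \<Rightarrow> real set) \<Rightarrow> real set \<Rightarrow> bool" where
  "ae_partition A S \<longleftrightarrow>
     (\<forall>n. A n \<in> sets lebesgue) \<and>
     (\<forall>m n. m \<noteq> n \<longrightarrow> A m \<inter> A n \<in> null_sets lebesgue) \<and>
     sym_diff (\<Union>n. A n) S \<in> null_sets lebesgue"

definition translation_congruent :: "real set \<Rightarrow> real set \<Rightarrow> bool" where
  "translation_congruent X Y \<longleftrightarrow>
     (\<exists>A :: int \<Rightarrow> real set. ae_partition A Y \<and>
        ae_partition (\<lambda>n. (\<lambda>x. x + of_int n) ` A n) X)"

end

theory Submission
  imports Defs "HOL-Complex_Analysis.Conformal_Mappings"
begin

text \<open>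
  The core is that for a Hadamard pair whose extreme cycles are integral, the representable integers
  form a spectrum of the self-similar measure.  With \<open>\<phi>\<close> the Fourier transform of the measure, this
  amounts to \<open>h x = 1\<close> for \<open>h x = (\<Sum>l\<in>\<Lambda>. \<bar>\<phi> (x + l)\<bar>\<^sup>2)\<close>.  The function \<open>h\<close> is
  superharmonic for the random walk \<open>x \<mapsto> (x + l) / R\<close> with weights \<open>\<bar>mask B ((x + l) / R)\<bar>\<^sup>2\<close>, so
  its minimisers on an invariant interval form a set stable under the walk.  If the minimum were
  below 1, this set would not contain 0, hence be finite, hence contain an extreme cycle;
  but \<open>h \<ge> 1\<close> at the points of an integral cycle.

  For the direct sum the extreme cycles are integral because the digits have greatest common
  divisor 1, and every integer is representable, so the integers form a spectrum.  Lebesgue measure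
  on the attractor \<open>X\<close> is self-similar, so the invariant measure is its normalisation; completeness of
  the 1-periodic exponentials prevents integer translates of \<open>X\<close> from overlapping, while they
  always cover the line.  Thus \<open>X\<close> tiles and has measure 1.

  Statements (iv) and (v) rest on the uniqueness of digits modulo \<open>R\<close>, and on the fact that the
  expansion of an integer is eventually periodic and ends in an integral cycle.
\<close>

subsection \<open>Approximation in \<open>L\<^sup>2\<close>\<close>

text \<open>Completeness is tested only on the exponentials with arbitrary real frequency
  \<open>u\<close>, which are total in L2 of a boundedly supported measure. For orthogonal
  frequencies in \<Lambda> the squared distance to their span is \<open>1 - h (- u)\<close>, so
  everything rests on \<open>h \<ge> 1\<close>.

  Being a supremum of continuous finite sums, \<open>h\<close> is lower semicontinuous at no cost.
  That is why the argument follows the minimum: on a compact interval it is attained, and the set of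
  minimisers is closed. The weights of the walk sum to 1 by row orthogonality of the Hadamard
  matrix.

  Signs matter: \<open>(x + l) / R = x'\<close> reads \<open>- x = R * (- x') + l\<close>. The
  points of an integral cycle are therefore the negatives of representable integers, and at such a
  point one term of \<open>h\<close> is the value 1 of the transform at 0. This is the place where
  integrality of the cycles is indispensable.

  For the tiling, overlaps of the pieces of the attractor are not known in advance. Subadditivity
  together with the exact count of \<open>R\<close> digits already makes normalised Lebesgue measure
  self-similar, so that its spectrum becomes available before the overlaps are excluded.\<close>

lemma cmod_add_power2_le: "(cmod (a + b))\<^sup>2 \<le> 2 * (cmod a)\<^sup>2 + 2 * (cmod b)\<^sup>2"
proof -
  have "(cmod (a + b))\<^sup>2 \<le> (cmod a + cmod b)\<^sup>2"
    by (intro power_mono norm_triangle_ineq) auto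
  also have "\<dots> \<le> 2 * (cmod a)\<^sup>2 + 2 * (cmod b)\<^sup>2"
    using sum_squares_bound[of "cmod a" "cmod b"] by (simp add: power2_sum)
  finally show ?thesis .
qed

lemma L2_fun_add:
  assumes "L2_fun M f" "L2_fun M g"
  shows "L2_fun M (\<lambda>x. f x + g x)"
proof -
  have [measurable]: "f \<in> borel_measurable M" "g \<in> borel_measurable M"
    using assms by (auto simp: L2_fun_def)
  have "(cmod (f x + g x))\<^sup>2 \<le> 2 * (cmod (f x))\<^sup>2 + 2 * (cmod (g x))\<^sup>2" for x
    by (rule cmod_add_power2_le)
  moreover have "integrable M (\<lambda>x. 2 * (cmod (f x))\<^sup>2 + 2 * (cmod (g x))\<^sup>2)"
    using assms by (auto simp: L2_fun_def)
  ultimately have "integrable M (\<lambda>x. (cmod (f x + g x))\<^sup>2)"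
    by (intro Bochner_Integration.integrable_bound[OF \<open>integrable M (\<lambda>x. 2 * (cmod (f x))\<^sup>2 + _ x)\<close>])
      simp_all
  then show ?thesis
    unfolding L2_fun_def by simp
qed

lemma L2_fun_cmult: "L2_fun M f \<Longrightarrow> L2_fun M (\<lambda>x. c * f x)"
  by (auto simp: L2_fun_def norm_mult power_mult_distrib)

lemma L2_fun_diff: "L2_fun M f \<Longrightarrow> L2_fun M g \<Longrightarrow> L2_fun M (\<lambda>x. f x - g x)"
  using L2_fun_add[of M f "\<lambda>x. - 1 * g x"] L2_fun_cmult[of M g "- 1"] by simp

lemma L2_fun_sum:
  "(\<And>i. i \<in> F \<Longrightarrow> L2_fun M (f i)) \<Longrightarrow> L2_fun M (\<lambda>x. \<Sum>i\<in>F. f i x)"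
proof (induction F rule: infinite_finite_induct)
  case (insert i F)
  then show ?case using L2_fun_add[of M "f i" "\<lambda>x. \<Sum>i\<in>F. f i x"] by simp
qed (auto simp: L2_fun_def)

lemma (in finite_measure) L2_fun_bounded:
  assumes "f \<in> borel_measurable M" "AE x in M. cmod (f x) \<le> C"
  shows "L2_fun M f"
  unfolding L2_fun_def
proof (intro conjI assms integrable_const_bound[where B = "C\<^sup>2"])
  show "AE x in M. norm ((cmod (f x))\<^sup>2) \<le> C\<^sup>2"
    using assms(2) by eventually_elim (auto intro: power_mono)
qed (use assms in measurable)

text \<open>A substitute for Minkowski's inequality. The pointwise bound costs a factor 2, which is
  harmless for density questions and explains the tolerances \<open>\<delta> / 4\<close>
  below.\<close>

lemma L2_dist_add_le:
  assumes "L2_fun M f" "L2_fun M g"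
  shows "(LINT x|M. (cmod (f x + g x))\<^sup>2)
    \<le> 2 * (LINT x|M. (cmod (f x))\<^sup>2) + 2 * (LINT x|M. (cmod (g x))\<^sup>2)"
proof -
  have "(LINT x|M. (cmod (f x + g x))\<^sup>2)
      \<le> (LINT x|M. 2 * (cmod (f x))\<^sup>2 + 2 * (cmod (g x))\<^sup>2)"
    using assms L2_fun_add[OF assms]
    by (intro integral_mono cmod_add_power2_le) (auto simp: L2_fun_def)
  also have "\<dots> = 2 * (LINT x|M. (cmod (f x))\<^sup>2) + 2 * (LINT x|M. (cmod (g x))\<^sup>2)"
    using assms by (subst Bochner_Integration.integral_add) (auto simp: L2_fun_def)
  finally show ?thesis .
qed

text \<open>Membership in the closed linear span of the family \<open>e\<close>. Squared distances
  avoid the root in \<open>L2_norm_of\<close>, and square integrability of \<open>f\<close> is built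
  in so that closure properties carry it along.\<close>

definition approximable ::
    "'a measure \<Rightarrow> 'i set \<Rightarrow> ('i \<Rightarrow> 'a \<Rightarrow> complex) \<Rightarrow> ('a \<Rightarrow> complex) \<Rightarrow> bool" where
  "approximable M I e f \<longleftrightarrow> L2_fun M f \<and> (\<forall>\<delta>>0. \<exists>F c. finite F \<and> F \<subseteq> I \<and>
     (LINT x|M. (cmod (f x - (\<Sum>i\<in>F. c i * e i x)))\<^sup>2) < \<delta>)"

lemma approximable_cong:
  "(\<And>x. f x = g x) \<Longrightarrow> approximable M I e f \<Longrightarrow> approximable M I e g"
  by (metis ext)

lemma approximable_limit:
  assumes e: "\<And>i. i \<in> I \<Longrightarrow> L2_fun M (e i)" and f: "L2_fun M f"
    and g: "\<And>\<delta>. \<delta> > 0 \<Longrightarrow>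
      \<exists>g. approximable M I e g \<and> (LINT x|M. (cmod (f x - g x))\<^sup>2) < \<delta>"
  shows "approximable M I e f"
  unfolding approximable_def
proof (intro conjI f allI impI)
  fix \<delta> :: real assume \<delta>: "\<delta> > 0"
  obtain g where g: "approximable M I e g" "(LINT x|M. (cmod (f x - g x))\<^sup>2) < \<delta> / 4"
    using g[of "\<delta>/4"] \<delta> by auto
  then obtain F c where F: "finite F" "F \<subseteq> I"
    "(LINT x|M. (cmod (g x - (\<Sum>i\<in>F. c i * e i x)))\<^sup>2) < \<delta> / 4"
    using \<delta> unfolding approximable_def by (meson divide_pos_pos zero_less_numeral)
  have s: "L2_fun M (\<lambda>x. \<Sum>i\<in>F. c i * e i x)"
    using F e by (intro L2_fun_sum L2_fun_cmult) auto
  have "(LINT x|M. (cmod ((f x - g x) + (g x - (\<Sum>i\<in>F. c i * e i x))))\<^sup>2)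
     \<le> 2 * (LINT x|M. (cmod (f x - g x))\<^sup>2)
       + 2 * (LINT x|M. (cmod (g x - (\<Sum>i\<in>F. c i * e i x)))\<^sup>2)"
    using g f s by (intro L2_dist_add_le L2_fun_diff) (auto simp: approximable_def)
  also have "\<dots> < \<delta>"
    using g(2) F(3) by simp
  finally show "\<exists>F c. finite F \<and> F \<subseteq> I \<and>
     (LINT x|M. (cmod (f x - (\<Sum>i\<in>F. c i * e i x)))\<^sup>2) < \<delta>"
    using F by (intro exI[of _ F] exI[of _ c]) auto
qed

lemma approximable_cmult:
  assumes "approximable M I e f"
  shows "approximable M I e (\<lambda>x. a * f x)"
  unfolding approximable_def
proof (intro conjI allI impI)
  show "L2_fun M (\<lambda>x. a * f x)"
    using assms L2_fun_cmult by (auto simp: approximable_def)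
  fix \<delta> :: real assume \<delta>: "\<delta> > 0"
  \<comment> \<open>The summand 1 keeps the quotient meaningful for \<open>a = 0\<close> and makes
    the resulting bound strict.\<close>
  define \<eta> where "\<eta> = \<delta> / ((cmod a)\<^sup>2 + 1)"
  have \<eta>: "\<eta> > 0" "(cmod a)\<^sup>2 * \<eta> < \<delta>"
  proof -
    have "(cmod a)\<^sup>2 + 1 > 0" by (intro add_nonneg_pos) auto
    then show "\<eta> > 0" "(cmod a)\<^sup>2 * \<eta> < \<delta>"
      using \<delta> by (auto simp: \<eta>_def pos_divide_less_eq algebra_simps)
  qed
  then obtain F c where F: "finite F" "F \<subseteq> I"
    "(LINT x|M. (cmod (f x - (\<Sum>i\<in>F. c i * e i x)))\<^sup>2) < \<eta>"
    using assms unfolding approximable_def by meson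
  have "cmod (a * f x - (\<Sum>i\<in>F. (a * c i) * e i x)) = cmod a * cmod (f x - (\<Sum>i\<in>F. c i * e i x))"
    for x by (simp add: sum_distrib_left right_diff_distrib mult.assoc flip: norm_mult)
  then have "(LINT x|M. (cmod (a * f x - (\<Sum>i\<in>F. (a * c i) * e i x)))\<^sup>2)
    = (cmod a)\<^sup>2 * (LINT x|M. (cmod (f x - (\<Sum>i\<in>F. c i * e i x)))\<^sup>2)"
    by (simp add: power_mult_distrib)
  also have "\<dots> \<le> (cmod a)\<^sup>2 * \<eta>"
    using F by (intro mult_left_mono) auto
  finally show "\<exists>F c. finite F \<and> F \<subseteq> I \<and>
     (LINT x|M. (cmod (a * f x - (\<Sum>i\<in>F. c i * e i x)))\<^sup>2) < \<delta>"
    using F \<eta> by (intro exI[of _ F] exI[of _ "\<lambda>i. a * c i"]) auto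
qed

lemma approximable_add:
  assumes e: "\<And>i. i \<in> I \<Longrightarrow> L2_fun M (e i)"
    and f: "approximable M I e f" and g: "approximable M I e g"
  shows "approximable M I e (\<lambda>x. f x + g x)"
  unfolding approximable_def
proof (intro conjI allI impI)
  show "L2_fun M (\<lambda>x. f x + g x)"
    using f g L2_fun_add by (auto simp: approximable_def)
  fix \<delta> :: real assume \<delta>: "\<delta> > 0"
  obtain F c where F: "finite F" "F \<subseteq> I"
    "(LINT x|M. (cmod (f x - (\<Sum>i\<in>F. c i * e i x)))\<^sup>2) < \<delta> / 4"
    using \<delta> f unfolding approximable_def by (meson divide_pos_pos zero_less_numeral)
  obtain G d where G: "finite G" "G \<subseteq> I"
    "(LINT x|M. (cmod (g x - (\<Sum>i\<in>G. d i * e i x)))\<^sup>2) < \<delta> / 4"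
    using \<delta> g unfolding approximable_def by (meson divide_pos_pos zero_less_numeral)
  \<comment> \<open>The index sets may overlap, so coefficients are added on the union.\<close>
  define k where "k i = (if i \<in> F then c i else 0) + (if i \<in> G then d i else 0)" for i
  have "(\<Sum>i\<in>F \<union> G. k i * e i x) = (\<Sum>i\<in>F. c i * e i x) + (\<Sum>i\<in>G. d i * e i x)" for x
  proof -
    have "(\<Sum>i\<in>F \<union> G. k i * e i x) = (\<Sum>i\<in>F \<union> G. if i \<in> F then c i * e i x else 0)
        + (\<Sum>i\<in>F \<union> G. if i \<in> G then d i * e i x else 0)"
      unfolding sum.distrib[symmetric] k_def by (intro sum.cong) (auto simp: algebra_simps)
    then show ?thesis
      using F(1) G(1) by (simp flip: sum.inter_restrict add: Int_absorb1 Int_absorb2)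
  qed
  then have "(LINT x|M. (cmod (f x + g x - (\<Sum>i\<in>F \<union> G. k i * e i x)))\<^sup>2)
     = (LINT x|M. (cmod ((f x - (\<Sum>i\<in>F. c i * e i x)) + (g x - (\<Sum>i\<in>G. d i * e i x))))\<^sup>2)"
    by (simp add: algebra_simps)
  also have "\<dots> \<le> 2 * (LINT x|M. (cmod (f x - (\<Sum>i\<in>F. c i * e i x)))\<^sup>2)
       + 2 * (LINT x|M. (cmod (g x - (\<Sum>i\<in>G. d i * e i x)))\<^sup>2)"
    using f g F G e
    by (intro L2_dist_add_le L2_fun_diff L2_fun_sum L2_fun_cmult) (auto simp: approximable_def)
  also have "\<dots> < \<delta>"
    using F G by simp
  finally show "\<exists>F c. finite F \<and> F \<subseteq> I \<and>
     (LINT x|M. (cmod (f x + g x - (\<Sum>i\<in>F. c i * e i x)))\<^sup>2) < \<delta>"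
    using F G by (intro exI[of _ "F \<union> G"] exI[of _ k]) auto
qed

lemma approximable_sum:
  fixes f :: "'b \<Rightarrow> 'a \<Rightarrow> complex"
  assumes e: "\<And>i. i \<in> I \<Longrightarrow> L2_fun M (e i)" and "finite A"
    and "\<And>a. a \<in> A \<Longrightarrow> approximable M I e (f a)"
  shows "approximable M I e (\<lambda>x. \<Sum>a\<in>A. f a x)"
  using assms(2,3)
proof (induction A rule: finite_induct)
  case empty
  then show ?case
    unfolding approximable_def by (intro conjI allI impI exI[of _ "{}"]) (auto simp: L2_fun_def)
next
  case (insert a A)
  then have "approximable M I e (\<lambda>x. f a x + (\<Sum>a\<in>A. f a x))"
    by (intro approximable_add e) auto
  with insert.hyps show ?case by simp
qed

text \<open>Dominated convergence turns a pointwise limit into a limit of squared distances. It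
  carries the passage from continuous functions to indicators, to countable unions and to general
  functions.\<close>

lemma approximable_dominated_limit:
  assumes M: "\<And>i. i \<in> I \<Longrightarrow> L2_fun M (e i)"
    and f: "L2_fun M f" and w: "integrable M w"
    and s: "\<And>n. approximable M I e (s n)"
    and lim: "AE x in M. (\<lambda>n. s n x) \<longlonglongrightarrow> f x"
    and bound: "\<And>n. AE x in M. (cmod (f x - s n x))\<^sup>2 \<le> w x"
  shows "approximable M I e f"
proof (rule approximable_limit[OF M f])
  fix \<delta> :: real assume \<delta>: "\<delta> > 0"
  have m[measurable]: "f \<in> borel_measurable M" "\<And>n. s n \<in> borel_measurable M"
    using f s by (auto simp: approximable_def L2_fun_def)
  have "(\<lambda>n. LINT x|M. (cmod (f x - s n x))\<^sup>2) \<longlonglongrightarrow> (LINT x|M. 0)"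
  proof (rule integral_dominated_convergence[OF _ _ w])
    show "AE x in M. (\<lambda>n. (cmod (f x - s n x))\<^sup>2) \<longlonglongrightarrow> 0"
      using lim
    proof eventually_elim
      case (elim x)
      have "(\<lambda>n. (cmod (f x - s n x))\<^sup>2) \<longlonglongrightarrow> (cmod (f x - f x))\<^sup>2"
        by (intro tendsto_intros elim)
      then show ?case by simp
    qed
  qed (use bound in auto)
  then have "\<forall>\<^sub>F n in sequentially. (LINT x|M. (cmod (f x - s n x))\<^sup>2) < \<delta>"
    using \<delta> by (intro order_tendstoD) auto
  then show "\<exists>g. approximable M I e g \<and> (LINT x|M. (cmod (f x - g x))\<^sup>2) < \<delta>"
    using s by (meson eventually_happens' sequentially_bot)
qed auto

section \<open>Trigonometric polynomials with real frequencies and totality of exponentials\<close>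

inductive_set trig_polys :: "(real \<Rightarrow> complex) set" where
  expo: "(\<lambda>x. c * cis (2 * pi * t * x)) \<in> trig_polys"
| add: "f \<in> trig_polys \<Longrightarrow> g \<in> trig_polys \<Longrightarrow> (\<lambda>x. f x + g x) \<in> trig_polys"

lemma trig_polys_mult_expo:
  "f \<in> trig_polys \<Longrightarrow> (\<lambda>x. c * cis (2 * pi * t * x) * f x) \<in> trig_polys"
proof (induction rule: trig_polys.induct)
  case (expo d s)
  have "(\<lambda>x. c * cis (2 * pi * t * x) * (d * cis (2 * pi * s * x)))
      = (\<lambda>x. (c * d) * cis (2 * pi * (t + s) * x))"
  proof
    fix x
    have "cis (2 * pi * (t + s) * x) = cis (2 * pi * t * x) * cis (2 * pi * s * x)"
      unfolding cis_mult by (rule arg_cong[where f = cis]) (simp add: algebra_simps)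
    then show "c * cis (2 * pi * t * x) * (d * cis (2 * pi * s * x))
      = (c * d) * cis (2 * pi * (t + s) * x)" by simp
  qed
  then show ?case using trig_polys.expo[of "c * d" "t + s"] by simp
next
  case (add f g)
  then show ?case using trig_polys.add by (simp add: ring_distribs)
qed

lemma trig_polys_mult:
  "f \<in> trig_polys \<Longrightarrow> g \<in> trig_polys \<Longrightarrow> (\<lambda>x. f x * g x) \<in> trig_polys"
proof (induction rule: trig_polys.induct)
  case (expo c t)
  then show ?case using trig_polys_mult_expo by simp
next
  case (add f h)
  then show ?case using trig_polys.add by (simp add: ring_distribs)
qed

lemma continuous_on_trig_polys: "f \<in> trig_polys \<Longrightarrow> continuous_on S f"
  by (induction rule: trig_polys.induct) (auto intro!: continuous_intros)

lemma trig_polys_const: "(\<lambda>_. c) \<in> trig_polys"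
  using trig_polys.expo[of c 0] by simp

text \<open>Stone-Weierstrass applied to the real-valued trigonometric polynomials. Arbitrary real
  frequencies are allowed, so any two points of the line can be separated and no period restricts
  the compact set.\<close>

lemma trig_polys_dense:
  fixes g :: "real \<Rightarrow> real"
  assumes S: "compact S" and g: "continuous_on S g" and \<delta>: "\<delta> > 0"
  obtains f where "f \<in> trig_polys" "\<And>x. x \<in> S \<Longrightarrow> cmod (g x - f x) < \<delta>"
proof -
  define P where "P = {f :: real \<Rightarrow> real. (\<lambda>x. complex_of_real (f x)) \<in> trig_polys}"
  interpret function_ring_on P S
  proof
    fix f assume "f \<in> P"
    then have "continuous_on S (\<lambda>x. Re (complex_of_real (f x)))"
      unfolding P_def by (intro continuous_intros continuous_on_trig_polys) auto
    then show "continuous_on S f" by simp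
  next
    fix f g assume "f \<in> P" "g \<in> P"
    then show "(\<lambda>x. f x + g x) \<in> P" "(\<lambda>x. f x * g x) \<in> P"
      unfolding P_def using trig_polys.add trig_polys_mult by auto
  next
    fix x y :: real assume "x \<noteq> y"
    \<comment> \<open>A quarter period between the points: the phase of the sine is 0 at
      \<open>y\<close> and \<pi>/2 at \<open>x\<close>.\<close>
    define w where "w = 1 / (4 * (x - y))"
    define f where "f z = sin (2 * pi * w * (z - y))" for z
    have sin: "complex_of_real (sin u) = (cis u - cis (- u)) / (2 * \<i>)" for u
      by (simp add: complex_eq_iff Re_divide Im_divide power2_eq_square)
    have "complex_of_real (f z) = (cis (- (2 * pi * w * y)) / (2 * \<i>)) * cis (2 * pi * w * z)
        + (- cis (2 * pi * w * y) / (2 * \<i>)) * cis (2 * pi * (- w) * z)" for z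
    proof -
      have e: "cis (2 * pi * w * (z - y)) = cis (- (2 * pi * w * y)) * cis (2 * pi * w * z)"
        "cis (- (2 * pi * w * (z - y))) = cis (2 * pi * w * y) * cis (2 * pi * (- w) * z)"
        unfolding cis_mult by (rule arg_cong[where f = cis], simp add: algebra_simps)+
      show ?thesis
        unfolding f_def sin e by (simp only: times_divide_eq_left mult_minus_left
          diff_conv_add_uminus add_divide_distrib)
    qed
    then have "f \<in> P"
      unfolding P_def mem_Collect_eq by (simp only: trig_polys.add[OF trig_polys.expo trig_polys.expo])
    moreover have "f x = 1" "f y = 0"
    proof -
      have "w * (x - y) = 1 / 4"
        using \<open>x \<noteq> y\<close> unfolding w_def by (subst times_divide_eq_left) auto
      then have "2 * pi * w * (x - y) = pi / 2"
        unfolding mult.assoc by simp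
      then show "f x = 1" unfolding f_def by (simp only: sin_pi_half)
      show "f y = 0" by (simp add: f_def)
    qed
    ultimately show "\<exists>f\<in>P. f x \<noteq> f y" by (intro bexI[of _ f]) auto
  qed (simp_all add: S P_def trig_polys_const)
  obtain f where "f \<in> P" "\<forall>x\<in>S. \<bar>g x - f x\<bar> < \<delta>"
    using Stone_Weierstrass_basic[OF g \<delta>] by auto
  then have "(\<lambda>x. complex_of_real (f x)) \<in> trig_polys"
      "\<And>x. x \<in> S \<Longrightarrow> cmod (g x - f x) < \<delta>"
    by (auto simp: P_def simp flip: of_real_diff)
  then show ?thesis by (rule that)
qed

text \<open>The bound by \<open>r\<close> turns uniform approximation on \<open>{-r..r}\<close> into approximation in \<open>L\<^sup>2(M)\<close>;
  half-lines then generate the Borel sets by Dynkin's theorem.\<close>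

lemma approximable_of_expo:
  fixes M :: "real measure"
  assumes M: "finite_measure M" "sets M = sets borel" and r: "AE x in M. \<bar>x\<bar> \<le> r"
    and e: "\<And>i. i \<in> I \<Longrightarrow> L2_fun M (e i)"
    and expo: "\<And>t. approximable M I e (\<lambda>x. cis (2 * pi * t * x))"
    and f: "L2_fun M f"
  shows "approximable M I e f"
proof -
  interpret finite_measure M by fact
  note [measurable_cong] = M(2)
  have [simp]: "space M = UNIV" using sets_eq_imp_space_eq[OF M(2)] by simp
  have trig: "approximable M I e f" if "f \<in> trig_polys" for f
    using that
  proof induction
    case (expo c t)
    then show ?case using approximable_cmult[OF assms(5)] by simp
  next
    case (add f g)
    then show ?case by (intro approximable_add e) auto
  qed
  have cont: "approximable M I e (\<lambda>x. complex_of_real (g x))"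
    if g: "continuous_on UNIV g" "\<And>x. \<bar>g x\<bar> \<le> 1" for g :: "real \<Rightarrow> real"
  proof (rule approximable_limit[OF e])
    have [measurable]: "g \<in> borel_measurable borel"
      using g by (intro borel_measurable_continuous_onI)
    show gL: "L2_fun M (\<lambda>x. complex_of_real (g x))"
      by (rule L2_fun_bounded[where C = 1]) (use g in auto)
    fix \<delta> :: real assume \<delta>: "\<delta> > 0"
    \<comment> \<open>The added 1 covers the zero measure and makes the final estimate
      strict.\<close>
    define m where "m = measure M UNIV + 1"
    have m: "m > 0" "measure M UNIV < m"
      by (auto simp: m_def add_nonneg_pos)
    define \<eta> where "\<eta> = sqrt (\<delta> / m)"
    have \<eta>: "\<eta> > 0" "\<eta>\<^sup>2 = \<delta> / m" using \<delta> m by (auto simp: \<eta>_def)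
    obtain f where f: "f \<in> trig_polys" "\<And>x. x \<in> {-r..r} \<Longrightarrow> cmod (g x - f x) < \<eta>"
      using trig_polys_dense[of "{-r..r}" g \<eta>] g \<eta> continuous_on_subset by blast
    have "(LINT x|M. (cmod (complex_of_real (g x) - f x))\<^sup>2) \<le> (LINT x|M. \<eta>\<^sup>2)"
    proof (rule integral_mono_AE)
      show "integrable M (\<lambda>x. (cmod (complex_of_real (g x) - f x))\<^sup>2)"
        using L2_fun_diff[OF gL, of f] trig[OF f(1)] by (auto simp: approximable_def L2_fun_def)
      show "AE x in M. (cmod (complex_of_real (g x) - f x))\<^sup>2 \<le> \<eta>\<^sup>2"
        using r
      proof eventually_elim
        case (elim x)
        then show ?case using f(2)[of x] by (intro power_mono) (auto simp: abs_le_iff)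
      qed
    qed auto
    also have "\<dots> = measure M UNIV * (\<delta> / m)" by (simp add: \<eta>)
    also have "\<dots> < \<delta>" using m \<delta> by (simp add: field_simps)
    finally show "\<exists>h. approximable M I e h \<and> (LINT x|M. (cmod (complex_of_real (g x) - h x))\<^sup>2) < \<delta>"
      using trig[OF f(1)] by auto
  qed auto
  have half: "approximable M I e (indicator {..a})" for a :: real
  proof (rule approximable_dominated_limit[OF e])
    \<comment> \<open>For positive \<open>n\<close>, a continuous ramp that is 1 up to
      \<open>a\<close> and 0 from \<open>a + 1/n\<close> on.\<close>
    define g where "g n x = max 0 (min 1 (1 - real n * (x - a)))" for n x
    show "approximable M I e (\<lambda>x. complex_of_real (g n x))" for n
      unfolding g_def by (intro cont continuous_intros) auto
    show "L2_fun M (indicator {..a})"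
      by (rule L2_fun_bounded[where C = 1]) (auto simp: indicator_def)
    show "integrable M (\<lambda>_. 1 :: real)" by simp
    have "(\<lambda>n. g n x) \<longlonglongrightarrow> indicator {..a} x" for x
    proof (cases "x \<le> a")
      case True
      then have "g n x = 1" for n by (auto simp: g_def min_def max_def mult_nonneg_nonpos)
      then show ?thesis using True by simp
    next
      case False
      obtain N where N: "real N * (x - a) > 1"
        using reals_Archimedean3[of "x - a"] False by auto
      have "g n x = 0" if "n \<ge> N" for n
      proof -
        have "real N * (x - a) \<le> real n * (x - a)"
          using that False by (intro mult_right_mono) auto
        then show ?thesis using N by (auto simp: g_def)
      qed
      then have "\<forall>\<^sub>F n in sequentially. g n x = 0"
        by (auto simp: eventually_sequentially)
      then show ?thesis using False by (simp add: tendsto_eventually)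
    qed
    then have "(\<lambda>n. complex_of_real (g n x)) \<longlonglongrightarrow> complex_of_real (indicator {..a} x)" for x
      by (rule tendsto_of_real)
    then show "AE x in M. (\<lambda>n. complex_of_real (g n x)) \<longlonglongrightarrow> indicator {..a} x"
      unfolding of_real_indicator by (intro AE_I2)
    have g01: "0 \<le> g n x" "g n x \<le> 1" for n x by (auto simp: g_def)
    have "\<bar>indicator {..a} x - g n x\<bar> \<le> 1" for n x
      using g01[of n x] by (simp add: indicator_def abs_le_iff)
    then have "cmod (complex_of_real (indicator {..a} x - g n x)) \<le> 1" for n x
      unfolding norm_of_real .
    then have "cmod (indicator {..a} x - complex_of_real (g n x)) \<le> 1" for n x
      by (simp add: of_real_indicator)
    then show "AE x in M. (cmod (indicator {..a} x - complex_of_real (g n x)))\<^sup>2 \<le> 1" for n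
      by (simp add: power_le_one)
  qed auto
  have one: "approximable M I e (\<lambda>_. 1)"
    using trig[OF trig_polys_const[of 1]] by simp
  have ind: "approximable M I e (indicator A)" if "A \<in> sets borel" for A
  proof -
    have A: "A \<in> sigma_sets UNIV (range (\<lambda>a::real. {..a}))"
      using that by (subst (asm) borel_eq_atMost) simp
    have "Int_stable (range (\<lambda>a::real. {..a}))"
      by (auto simp: Int_stable_def)
    moreover have "range (\<lambda>a::real. {..a}) \<subseteq> Pow UNIV" by simp
    ultimately show ?thesis
      using A
    proof (induction rule: sigma_sets_induct_disjoint)
      case (basic A)
      then show ?case using half by auto
    next
      case empty
      then show ?case using approximable_cmult[OF one, of 0] by (simp add: indicator_def cong: if_cong)
    next
      case (compl A)
      have "approximable M I e (\<lambda>x. 1 + (-1) * indicator A x)"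
        by (intro approximable_add approximable_cmult one e compl)
      then show ?case by (rule approximable_cong[rotated]) (auto simp: indicator_def)
    next
      case (union A)
      have Ab: "A n \<in> sets borel" for n
        using union(2) by (subst borel_eq_atMost) auto
      show ?case
      proof (rule approximable_dominated_limit[OF e])
        show "approximable M I e (\<lambda>x. \<Sum>i<n. indicator (A i) x)" for n
          by (intro approximable_sum e union) auto
        show "L2_fun M (indicator (\<Union> (range A)))"
          using Ab by (intro L2_fun_bounded[where C = 1] borel_measurable_indicator)
            (auto simp: indicator_def M(2))
        show "integrable M (\<lambda>_. 1 :: real)" by simp
        have s: "(\<Sum>i<n. indicator (A i) x) = (indicator (\<Union>i<n. A i) x :: complex)" for n x
          using union(1) by (subst indicator_UN_disjoint) (auto simp: disjoint_family_on_def)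
        show "AE x in M. (\<lambda>n. \<Sum>i<n. indicator (A i) x) \<longlonglongrightarrow> (indicator (\<Union> (range A)) x :: complex)"
          unfolding s by (intro AE_I2 LIMSEQ_indicator_UN)
        show "AE x in M. (cmod (indicator (\<Union> (range A)) x - (\<Sum>i<n. indicator (A i) x)))\<^sup>2 \<le> 1" for n
          unfolding s by (auto simp: indicator_def)
      qed auto
    qed
  qed
  obtain s where s: "\<And>n. simple_function M (s n)" "\<And>x. (\<lambda>n. s n x) \<longlonglongrightarrow> f x"
    "\<And>n x. dist (s n x) 0 \<le> 2 * dist (f x) 0"
    using borel_measurable_implies_sequence_metric[of f M 0] f by (auto simp: L2_fun_def)
  show ?thesis
  proof (rule approximable_dominated_limit[OF e f])
    show "AE x in M. (\<lambda>n. s n x) \<longlonglongrightarrow> f x"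
      using s(2) by (intro AE_I2)
    \<comment> \<open>The simple functions satisfy \<open>cmod (s n x) \<le> 2 * cmod (f x)\<close>,
      so the error is at most three times \<open>cmod (f x)\<close>, and 9 is the square of that
      factor.\<close>
    show "integrable M (\<lambda>x. 9 * (cmod (f x))\<^sup>2)"
      using f by (auto simp: L2_fun_def)
    show "approximable M I e (s n)" for n
    proof -
      have "approximable M I e (\<lambda>x. \<Sum>y\<in>range (s n). y * indicator (s n -` {y}) x)"
      proof (intro approximable_sum e approximable_cmult ind)
        show "finite (range (s n))" using simple_functionD(1)[OF s(1)] by simp
        show "s n -` {y} \<in> sets borel" for y
          using simple_functionD(2)[OF s(1), of n "{y}"] M(2) by simp
      qed auto
      moreover have "(\<Sum>y\<in>range (s n). y * indicator (s n -` {y}) x) = s n x" for x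
      proof -
        have "(\<Sum>y\<in>range (s n). y * indicator (s n -` {y}) x) = (\<Sum>y\<in>range (s n). if y = s n x then y else 0)"
          by (intro sum.cong refl) (auto simp: indicator_def)
        then show ?thesis
          using simple_functionD(1)[OF s(1)[of n]] by (simp add: sum.delta)
      qed
      ultimately show ?thesis by simp
    qed
    show "AE x in M. (cmod (f x - s n x))\<^sup>2 \<le> 9 * (cmod (f x))\<^sup>2" for n
    proof (rule AE_I2)
      fix x
      have "cmod (f x - s n x) \<le> cmod (f x) + cmod (s n x)" by (rule norm_triangle_ineq4)
      also have "\<dots> \<le> 3 * cmod (f x)" using s(3)[of n x] by simp
      finally have "(cmod (f x - s n x))\<^sup>2 \<le> (3 * cmod (f x))\<^sup>2"
        by (intro power_mono) auto
      then show "(cmod (f x - s n x))\<^sup>2 \<le> 9 * (cmod (f x))\<^sup>2"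
        by (simp add: power_mult_distrib)
    qed
  qed (use s in auto)
qed

subsection \<open>Orthogonal families of exponentials\<close>

text \<open>The characteristic function rescaled by 2\<pi>, so that its argument is a frequency:
  inner products of exponentials are its values at frequency differences.\<close>

definition fourier :: "real measure \<Rightarrow> real \<Rightarrow> complex" where
  "fourier M t = (LINT x|M. cis (2 * pi * t * x))"

lemma fourier_eq_char: "fourier M t = char M (2 * pi * t)"
  by (simp add: fourier_def char_def cis_conv_exp)

lemma borel_measurable_cis [measurable]: "cis \<in> borel_measurable borel"
  by (intro borel_measurable_continuous_onI continuous_intros)

lemma (in real_distribution) integrable_cis [simp]: "integrable M (\<lambda>x. c * cis (a * x))"
  by (intro integrable_const_bound[where B = "cmod c"]) (auto simp: norm_mult)

lemma (in real_distribution) expo_inner: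
  "(LINT x|M. cis (2 * pi * s * x) * cnj (cis (2 * pi * t * x))) = fourier M (s - t)"
  by (simp add: fourier_def cis_cnj cis_mult algebra_simps)

lemma fourier_minus: "fourier M (- t) = cnj (fourier M t)"
  by (simp add: fourier_def cis_cnj flip: Bochner_Integration.integral_cnj)

text \<open>Pythagoras: the sum over \<open>F\<close> is the orthogonal projection of the
  exponential with frequency \<open>u\<close>. Nonnegativity of the left side is Bessel's
  inequality, and its smallness is completeness.\<close>

lemma (in real_distribution) expo_orthogonal_dist:
  assumes F: "finite F" and o: "\<And>s t. s \<in> F \<Longrightarrow> t \<in> F \<Longrightarrow> s \<noteq> t \<Longrightarrow> fourier M (s - t) = 0"
  shows "(LINT x|M. (cmod (cis (2 * pi * u * x)
      - (\<Sum>t\<in>F. fourier M (u - t) * cis (2 * pi * t * x))))\<^sup>2)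
    = 1 - (\<Sum>t\<in>F. (cmod (fourier M (u - t)))\<^sup>2)"
proof -
  define E where "E t x = cis (2 * pi * t * x)" for t x :: real
  define c where "c t = fourier M (u - t)" for t
  have in1: "(LINT x|M. E s x * cnj (E t x)) = fourier M (s - t)" for s t
    using expo_inner by (simp add: E_def)
  have int: "integrable M (\<lambda>x. a * (E s x * cnj (E t x)))" for s t a
  proof -
    have "a * (E s x * cnj (E t x)) = a * cis ((2 * pi * s - 2 * pi * t) * x)" for x
      by (simp add: E_def cis_cnj cis_mult algebra_simps)
    then show ?thesis by (simp only: integrable_cis)
  qed
  have "complex_of_real (LINT x|M. (cmod (E u x - (\<Sum>t\<in>F. c t * E t x)))\<^sup>2)
     = (LINT x|M. (E u x - (\<Sum>t\<in>F. c t * E t x)) * cnj (E u x - (\<Sum>t\<in>F. c t * E t x)))"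
    by (simp only: complex_norm_square flip: integral_complex_of_real)
  also have "\<dots> = (LINT x|M. 1 * (E u x * cnj (E u x)) - (\<Sum>t\<in>F. cnj (c t) * (E u x * cnj (E t x)))
       - (\<Sum>t\<in>F. c t * (E t x * cnj (E u x)))
       + (\<Sum>t\<in>F. \<Sum>s\<in>F. c s * cnj (c t) * (E s x * cnj (E t x))))"
    by (simp add: algebra_simps sum_distrib_left sum_distrib_right)
  also have "\<dots> = (LINT x|M. 1 * (E u x * cnj (E u x))) - (\<Sum>t\<in>F. cnj (c t) * fourier M (u - t))
       - (\<Sum>t\<in>F. c t * fourier M (t - u))
       + (\<Sum>t\<in>F. \<Sum>s\<in>F. c s * cnj (c t) * fourier M (s - t))"
    by (simp only: Bochner_Integration.integral_add Bochner_Integration.integral_diff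
        Bochner_Integration.integral_sum Bochner_Integration.integrable_add
        Bochner_Integration.integrable_diff Bochner_Integration.integrable_sum
        int integral_mult_right_zero in1)
  also have "(LINT x|M. 1 * (E u x * cnj (E u x))) = 1"
    using prob_space by (simp add: E_def cis_cnj cis_mult)
  also have "(\<Sum>t\<in>F. cnj (c t) * fourier M (u - t)) = (\<Sum>t\<in>F. c t * cnj (c t))"
    by (simp add: c_def mult.commute)
  also have "(\<Sum>t\<in>F. c t * fourier M (t - u)) = (\<Sum>t\<in>F. c t * cnj (c t))"
    using fourier_minus[of M "u - t" for t] by (simp add: c_def)
  also have "(\<Sum>t\<in>F. \<Sum>s\<in>F. c s * cnj (c t) * fourier M (s - t))
     = (\<Sum>t\<in>F. \<Sum>s\<in>F. if s = t then c s * cnj (c t) else 0)"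
    using o prob_space by (intro sum.cong refl) (auto simp: fourier_def)
  also have "\<dots> = (\<Sum>t\<in>F. c t * cnj (c t))"
    using F by simp
  finally have "complex_of_real (LINT x|M. (cmod (E u x - (\<Sum>t\<in>F. c t * E t x)))\<^sup>2)
     = complex_of_real (1 - (\<Sum>t\<in>F. (cmod (c t))\<^sup>2))"
    by (simp add: complex_norm_square del: of_real_power)
  then show ?thesis unfolding of_real_eq_iff E_def c_def .
qed

lemma (in real_distribution) fourier_bessel:
  assumes "finite F" "\<And>s t. s \<in> F \<Longrightarrow> t \<in> F \<Longrightarrow> s \<noteq> t \<Longrightarrow> fourier M (s - t) = 0"
  shows "(\<Sum>t\<in>F. (cmod (fourier M (u - t)))\<^sup>2) \<le> 1"
proof -
  have "0 \<le> 1 - (\<Sum>t\<in>F. (cmod (fourier M (u - t)))\<^sup>2)"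
    using expo_orthogonal_dist[OF assms, of u] by (metis (no_types, lifting)
      Bochner_Integration.integral_nonneg zero_le_power2)
  then show ?thesis by simp
qed

text \<open>By totality of all exponentials, Parseval's equality up to \<open>\<delta>\<close> for
  each real frequency \<open>u\<close> is enough. The bound \<open>r\<close> on the support is what
  makes them total by uniform approximation.\<close>

lemma (in real_distribution) is_spectrumI:
  assumes r: "AE x in M. \<bar>x\<bar> \<le> r"
    and o: "\<And>s t. s \<in> \<Lambda> \<Longrightarrow> t \<in> \<Lambda> \<Longrightarrow> s \<noteq> t \<Longrightarrow> fourier M (s - t) = 0"
    and c: "\<And>u \<delta>. \<delta> > 0 \<Longrightarrow>
      \<exists>F. finite F \<and> F \<subseteq> \<Lambda> \<and> (\<Sum>t\<in>F. (cmod (fourier M (u - t)))\<^sup>2) > 1 - \<delta>"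
  shows "is_spectrum M \<Lambda>"
  unfolding is_spectrum_def orthogonal_basis_L2_def
proof (intro conjI ballI impI allI)
  show "finite_measure M" by (rule finite_measure_axioms)
  show L2: "L2_fun M (\<lambda>x. cis (2 * pi * t * x))" for t
    by (rule L2_fun_bounded[where C = 1]) auto
  show "L2_norm_of M (\<lambda>x. cis (2 * pi * t * x)) \<noteq> 0" for t
    using prob_space by (simp add: L2_norm_of_def)
  show "(LINT x|M. cis (2 * pi * s * x) * cnj (cis (2 * pi * t * x))) = 0"
    if "s \<in> \<Lambda>" "t \<in> \<Lambda>" "s \<noteq> t" for s t
    using o[OF that] expo_inner by simp
  fix f \<epsilon> assume f: "L2_fun M f \<and> (0::real) < \<epsilon>"
  have "approximable M \<Lambda> (\<lambda>t x. cis (2 * pi * t * x)) f"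
  proof (rule approximable_of_expo[OF _ _ r L2])
    fix u :: real
    show "approximable M \<Lambda> (\<lambda>t x. cis (2 * pi * t * x)) (\<lambda>x. cis (2 * pi * u * x))"
      unfolding approximable_def
    proof (intro conjI L2 allI impI)
      fix \<delta> :: real assume "\<delta> > 0"
      then obtain F where F: "finite F" "F \<subseteq> \<Lambda>" "(\<Sum>t\<in>F. (cmod (fourier M (u - t)))\<^sup>2) > 1 - \<delta>"
        using c by blast
      have "(LINT x|M. (cmod (cis (2 * pi * u * x)
        - (\<Sum>t\<in>F. fourier M (u - t) * cis (2 * pi * t * x))))\<^sup>2) < \<delta>"
        using F by (subst expo_orthogonal_dist) (auto intro!: o)
      then show "\<exists>F c. finite F \<and> F \<subseteq> \<Lambda> \<and> (LINT x|M. (cmod (cis (2 * pi * u * x)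
        - (\<Sum>t\<in>F. c t * cis (2 * pi * t * x))))\<^sup>2) < \<delta>"
        using F by (intro exI[of _ F] exI[of _ "\<lambda>t. fourier M (u - t)"]) auto
    qed
  qed (use f finite_measure_axioms in auto)
  then obtain F c where "finite F" "F \<subseteq> \<Lambda>"
    "(LINT x|M. (cmod (f x - (\<Sum>t\<in>F. c t * cis (2 * pi * t * x))))\<^sup>2) < \<epsilon>\<^sup>2"
    using f unfolding approximable_def by (meson zero_less_power)
  then show "\<exists>F c. finite F \<and> F \<subseteq> \<Lambda> \<and>
      L2_norm_of M (\<lambda>x. f x - (\<Sum>t\<in>F. c t * cis (2 * pi * t * x))) < \<epsilon>"
    unfolding L2_norm_of_def using f
    by (intro exI[of _ F] exI[of _ c]) (auto intro!: real_less_lsqrt)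
qed simp

subsection \<open>Self-similar measures\<close>

text \<open>The predicate under the description operator of \<open>invariant_measure\<close>, named
  so that existence and uniqueness can be stated for it.\<close>

definition self_similar :: "int \<Rightarrow> int set \<Rightarrow> real measure \<Rightarrow> bool" where
  "self_similar R D M \<longleftrightarrow> prob_space M \<and> sets M = sets borel \<and>
     (\<forall>E\<in>sets borel. measure M E = (1 / real (card D)) * (\<Sum>d\<in>D. measure M (tau R d -` E)))"

lemma self_similar_real_distribution: "self_similar R D M \<Longrightarrow> real_distribution M"
  by (simp add: self_similar_def real_distribution_def real_distribution_axioms_def)

lemma tau_measurable [measurable]: "tau R d \<in> borel_measurable borel"
  unfolding tau_def by measurable

lemma cmod_mask_le_1: "cmod (mask D x) \<le> 1"
proof (cases "card D = 0")
  case False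
  have "cmod (\<Sum>b\<in>D. cis (2 * pi * of_int b * x)) \<le> (\<Sum>b\<in>D. 1)"
    by (rule sum_norm_le) simp
  then show ?thesis
    using False by (simp add: mask_def norm_mult norm_divide)
qed (simp add: mask_def)

lemma mask_0: "finite D \<Longrightarrow> D \<noteq> {} \<Longrightarrow> mask D 0 = 1"
  by (simp add: mask_def)

lemma continuous_on_mask: "continuous_on S (mask D)"
  unfolding mask_def by (intro continuous_intros)

text \<open>Self-similarity says that \<open>M\<close> is the law of \<open>(x + d) / R\<close> with
  \<open>x\<close> of law \<open>M\<close> and an independent uniform digit \<open>d\<close>. The
  transform of a sum of independent variables is a product, and the digit contributes the
  mask.\<close>

lemma self_similar_fourier:
  assumes M: "self_similar R D M" and D: "finite D" "D \<noteq> {}"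
  shows "fourier M t = mask D (t / of_int R) * fourier M (t / of_int R)"
proof -
  interpret M: real_distribution M using M by (rule self_similar_real_distribution)
  define P where "P = measure_pmf (pmf_of_set D)"
  interpret P: prob_space P unfolding P_def by (rule prob_space_measure_pmf)
  interpret PM: pair_prob_space P M ..
  define f where "f = (\<lambda>(d, x). tau R d x)"
  have [measurable_cong]: "sets P = sets (count_space UNIV)" by (simp add: P_def)
  have f[measurable]: "f \<in> borel_measurable (P \<Otimes>\<^sub>M M)"
    unfolding f_def tau_def by measurable
  have "M = distr (P \<Otimes>\<^sub>M M) borel f"
  proof (rule measure_eqI)
    fix E assume "E \<in> sets M"
    then have E[measurable]: "E \<in> sets borel" by simp
    have "emeasure (distr (P \<Otimes>\<^sub>M M) borel f) E = emeasure (P \<Otimes>\<^sub>M M) (f -` E \<inter> space (P \<Otimes>\<^sub>M M))"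
      by (intro emeasure_distr) measurable
    also have "\<dots> = (\<integral>\<^sup>+d. emeasure M (Pair d -` (f -` E \<inter> space (P \<Otimes>\<^sub>M M))) \<partial>P)"
      by (intro M.emeasure_pair_measure_alt) measurable
    also have "\<dots> = (\<integral>\<^sup>+d. ennreal (measure M (tau R d -` E)) \<partial>P)"
      by (intro nn_integral_cong) (auto simp: f_def space_pair_measure P_def M.emeasure_eq_measure
          intro!: arg_cong[where f = "measure M"])
    also have "\<dots> = (\<Sum>d\<in>D. ennreal (measure M (tau R d -` E))) / ennreal (real (card D))"
      using D by (simp add: P_def nn_integral_pmf_of_set ennreal_of_nat_eq_real_of_nat)
    also have "\<dots> = ennreal ((\<Sum>d\<in>D. measure M (tau R d -` E)) / real (card D))"
      using D by (simp add: divide_ennreal sum_nonneg card_gt_0_iff)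
    also have "\<dots> = emeasure M E"
      using M E by (simp add: self_similar_def M.emeasure_eq_measure)
    finally show "emeasure M E = emeasure (distr (P \<Otimes>\<^sub>M M) borel f) E" ..
  qed simp
  then have "fourier M t = fourier (distr (P \<Otimes>\<^sub>M M) borel f) t" by simp
  also have "\<dots> = integral\<^sup>L (P \<Otimes>\<^sub>M M) (\<lambda>z. cis (2 * pi * t * f z))"
    unfolding fourier_def by (intro integral_distr) measurable
  also have "\<dots> = (\<integral>d. (\<integral>x. cis (2 * pi * t * f (d, x)) \<partial>M) \<partial>P)"
    by (intro PM.integral_fst'[symmetric] PM.P.integrable_const_bound[where B = 1]) auto
  also have "\<dots> = (\<Sum>d\<in>D. (1 / real (card D)) *\<^sub>R (LINT x|M. cis (2 * pi * t * f (d, x))))"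
    using D unfolding P_def by (subst integral_measure_pmf[where A = D]) auto
  also have "\<dots> = (\<Sum>d\<in>D. (1 / of_nat (card D)) * (cis (2 * pi * of_int d * (t / of_int R))
      * fourier M (t / of_int R)))"
  proof (intro sum.cong refl)
    fix d
    have e: "cis (2 * pi * t * f (d, x)) = cis (2 * pi * of_int d * (t / of_int R))
        * cis (2 * pi * (t / of_int R) * x)" for x
      unfolding cis_mult by (rule arg_cong[where f = cis])
        (simp add: f_def tau_def add_divide_distrib algebra_simps)
    show "(1 / real (card D)) *\<^sub>R (LINT x|M. cis (2 * pi * t * f (d, x)))
      = (1 / of_nat (card D)) * (cis (2 * pi * of_int d * (t / of_int R)) * fourier M (t / of_int R))"
      unfolding e by (simp add: fourier_def scaleR_conv_of_real)
  qed
  also have "\<dots> = mask D (t / of_int R) * fourier M (t / of_int R)"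
    by (simp add: mask_def sum_distrib_left sum_distrib_right mult.assoc)
  finally show ?thesis .
qed

text \<open>The mask has modulus at most 1, so the difference of two solutions at \<open>t\<close>
  is bounded by the difference at \<open>t / R^n\<close>. This tends to 0, since both transforms are
  continuous with value 1 at 0.\<close>

lemma fourier_functional_equation_unique:
  assumes R: "R \<ge> 2" and M: "real_distribution M" "real_distribution M'"
    and eq: "\<And>t. fourier M t = mask D (t / of_int R) * fourier M (t / of_int R)"
      "\<And>t. fourier M' t = mask D (t / of_int R) * fourier M' (t / of_int R)"
  shows "M = M'"
proof (rule Levy_uniqueness[OF M ext])
  interpret M: real_distribution M by fact
  interpret M': real_distribution M' by fact
  define g where "g t = fourier M t - fourier M' t" for t
  have g: "cmod (g t) \<le> cmod (g (t / of_int R ^ n))" for t n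
  proof (induction n)
    case (Suc n)
    have "cmod (g u) \<le> cmod (g (u / of_int R))" for u
    proof -
      have "g u = mask D (u / of_int R) * g (u / of_int R)"
        unfolding g_def by (subst eq(1), subst eq(2)) (simp add: algebra_simps)
      then show ?thesis
        using mult_right_mono[OF cmod_mask_le_1[of D "u / of_int R"], of "cmod (g (u / of_int R))"]
        by (simp add: norm_mult)
    qed
    from this[of "t / of_int R ^ n"] Suc show ?case
      by (simp add: field_simps)
  qed simp
  have "g t = 0" for t
  proof -
    have "(\<lambda>n. t * (1 / of_int R) ^ n) \<longlonglongrightarrow> t * 0"
      using R by (intro tendsto_intros LIMSEQ_power_zero) simp
    then have lim: "(\<lambda>n. 2 * pi * (t / of_int R ^ n)) \<longlonglongrightarrow> 2 * pi * 0"
      by (intro tendsto_intros) (simp add: power_divide)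
    have "(\<lambda>n. char M (2 * pi * (t / of_int R ^ n)) - char M' (2 * pi * (t / of_int R ^ n)))
        \<longlonglongrightarrow> char M (2 * pi * 0) - char M' (2 * pi * 0)"
      by (intro tendsto_diff isCont_tendsto_compose[OF M.isCont_char lim]
          isCont_tendsto_compose[OF M'.isCont_char lim])
    then have "(\<lambda>n. cmod (g (t / of_int R ^ n))) \<longlonglongrightarrow> 0"
      by (intro tendsto_norm_zero) (simp add: g_def fourier_eq_char M.char_zero M'.char_zero)
    then have "cmod (g t) \<le> 0"
      by (rule tendsto_lowerbound) (use g in auto)
    then show ?thesis by simp
  qed
  from this[of "t / (2 * pi)" for t] show "char M t = char M' t" for t
    by (simp add: g_def fourier_eq_char)
qed

lemma self_similar_unique:
  assumes "R \<ge> 2" "finite D" "D \<noteq> {}" "self_similar R D M" "self_similar R D M'"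
  shows "M = M'"
  using fourier_functional_equation_unique[OF assms(1)] assms
    self_similar_real_distribution self_similar_fourier by metis

text \<open>The law of \<open>\<Sum>k. R\<^bsup>-k-1\<^esup> d\<^sub>k\<close> with independent uniform digits; digits outside \<open>D\<close>, which
  occur with probability zero, are replaced by 0 so that the series always converges.\<close>

lemma self_similar_exists:
  assumes R: "R \<ge> 2" and D: "finite D" "D \<noteq> {}"
  shows "\<exists>M. self_similar R D M \<and> (\<exists>C. AE x in M. \<bar>x\<bar> \<le> C)"
proof -
  define P where "P = measure_pmf (pmf_of_set D)"
  interpret P: prob_space P unfolding P_def by (rule prob_space_measure_pmf)
  have [measurable_cong]: "sets P = sets (count_space UNIV)" by (simp add: P_def)
  define S where "S = stream_space P"
  interpret S: prob_space S unfolding S_def by (rule P.prob_space_stream_space)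
  define c where "c d = (if d \<in> D then real_of_int d else 0)" for d
  define b where "b = (\<Sum>d\<in>D. \<bar>real_of_int d\<bar>)"
  define q where "q = 1 / real_of_int R"
  have q: "0 < q" "q < 1" using R by (auto simp: q_def)
  have c: "\<bar>c d\<bar> \<le> b" for d
    using D member_le_sum[of d D "\<lambda>d. \<bar>real_of_int d\<bar>"] by (auto simp: c_def b_def sum_nonneg)
  define F where "F w = (\<Sum>k. c (w !! k) * q ^ Suc k)" for w
  have trm: "norm (c (w !! k) * q ^ Suc k) \<le> b * q ^ Suc k" for w k
    using c[of "w !! k"] q by (simp add: abs_mult mult_right_mono)
  have gs: "summable (\<lambda>k. b * q ^ Suc k)"
    using q by (intro summable_mult summable_Suc_iff[THEN iffD2] summable_geometric) auto
  have sm: "summable (\<lambda>k. c (w !! k) * q ^ Suc k)" for w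
    by (rule summable_comparison_test'[OF gs]) (use trm in auto)
  \<comment> \<open>For \<open>d\<close> in \<open>D\<close>, prepending the digit \<open>d\<close>
    to a stream acts on the sum as \<open>tau R d\<close>. Splitting off the first, independent
    digit therefore gives the self-similarity.\<close>
  have F_Stream: "F (d ## w) = (c d + F w) * q" for d w
  proof -
    have "F (d ## w) = (\<Sum>k. c ((d ## w) !! Suc k) * q ^ Suc (Suc k)) + c d * q"
      unfolding F_def using suminf_split_head[OF sm[of "d ## w"]] by simp
    also have "(\<Sum>k. c ((d ## w) !! Suc k) * q ^ Suc (Suc k)) = (\<Sum>k. q * (c (w !! k) * q ^ Suc k))"
      by (simp add: mult_ac)
    also have "\<dots> = q * F w"
      unfolding F_def by (intro suminf_mult sm)
    finally show ?thesis by (simp add: algebra_simps)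
  qed
  have cm[measurable]: "c \<in> borel_measurable P"
    by (simp add: P_def)
  have F[measurable]: "F \<in> borel_measurable S"
    unfolding F_def S_def by measurable
  have Fb: "\<bar>F w\<bar> \<le> (\<Sum>k. b * q ^ Suc k)" for w
    unfolding F_def using summable_norm_comparison_test suminf_le[OF _ _ gs] trm sm
      summable_rabs_comparison_test[of "\<lambda>k. c (w !! k) * q ^ Suc k" "\<lambda>k. b * q ^ Suc k"] gs
    by (intro order_trans[OF summable_rabs]) auto
  define M where "M = distr S borel F"
  interpret M: prob_space M unfolding M_def by (intro S.prob_space_distr) measurable
  have "self_similar R D M"
    unfolding self_similar_def
  proof (intro conjI ballI)
    show "prob_space M" by (rule M.prob_space_axioms)
    show "sets M = sets borel" by (simp add: M_def)
    fix E :: "real set" assume E[measurable]: "E \<in> sets borel"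
    have mM: "emeasure M A = (\<integral>\<^sup>+w. indicator A (F w) \<partial>S)" if [measurable]: "A \<in> sets borel" for A
    proof -
      have "emeasure M A = (\<integral>\<^sup>+x. indicator A x \<partial>M)"
        using that by (simp add: M_def)
      also have "\<dots> = (\<integral>\<^sup>+w. indicator A (F w) \<partial>S)"
        unfolding M_def by (intro nn_integral_distr) measurable
      finally show ?thesis .
    qed
    have tE[measurable]: "tau R d -` E \<in> sets borel" for d
      using measurable_sets[OF tau_measurable E, of R d] by simp
    have "emeasure M E = (\<integral>\<^sup>+w. indicator E (F w) \<partial>S)"
      by (rule mM) measurable
    also have "\<dots> = (\<integral>\<^sup>+d. \<integral>\<^sup>+w. indicator E (F (d ## w)) \<partial>S \<partial>P)"
      unfolding S_def by (intro P.nn_integral_stream_space) (unfold S_def[symmetric], measurable)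
    also have "\<dots> = (\<Sum>d\<in>D. \<integral>\<^sup>+w. indicator E (F (d ## w)) \<partial>S) / ennreal (real (card D))"
      using D by (simp add: P_def nn_integral_pmf_of_set ennreal_of_nat_eq_real_of_nat)
    also have "(\<Sum>d\<in>D. \<integral>\<^sup>+w. indicator E (F (d ## w)) \<partial>S) = (\<Sum>d\<in>D. emeasure M (tau R d -` E))"
    proof (intro sum.cong refl)
      fix d assume "d \<in> D"
      then have "F (d ## w) = tau R d (F w)" for w
        by (simp add: F_Stream c_def tau_def q_def add.commute)
      then show "(\<integral>\<^sup>+w. indicator E (F (d ## w)) \<partial>S) = emeasure M (tau R d -` E)"
        by (subst mM[OF tE]) (auto simp: indicator_def intro!: nn_integral_cong)
    qed
    also have "\<dots> / ennreal (real (card D))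
        = ennreal ((\<Sum>d\<in>D. measure M (tau R d -` E)) / real (card D))"
      using D by (simp add: M.emeasure_eq_measure divide_ennreal sum_nonneg card_gt_0_iff)
    finally show "measure M E = 1 / real (card D) * (\<Sum>d\<in>D. measure M (tau R d -` E))"
      by (simp add: M.emeasure_eq_measure sum_nonneg)
  qed
  moreover have "AE x in M. \<bar>x\<bar> \<le> (\<Sum>k. b * q ^ Suc k)"
    unfolding M_def by (subst AE_distr_iff) (use Fb in auto)
  ultimately show ?thesis by blast
qed

lemma
  assumes "R \<ge> 2" "finite D" "D \<noteq> {}"
  shows self_similar_invariant_measure: "self_similar R D (invariant_measure R D)"
    and invariant_measure_bounded: "\<exists>C. AE x in invariant_measure R D. \<bar>x\<bar> \<le> C"
    and invariant_measure_eqI: "self_similar R D M \<Longrightarrow> invariant_measure R D = M"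
proof -
  obtain M0 where M0: "self_similar R D M0" "\<exists>C. AE x in M0. \<bar>x\<bar> \<le> C"
    using self_similar_exists[OF assms] by auto
  have e: "invariant_measure R D = M0"
    unfolding invariant_measure_def self_similar_def[symmetric]
    using M0 self_similar_unique[OF assms] by (intro the_equality) auto
  then show "self_similar R D (invariant_measure R D)"
    "\<exists>C. AE x in invariant_measure R D. \<bar>x\<bar> \<le> C" using M0 by auto
  show "self_similar R D M \<Longrightarrow> invariant_measure R D = M"
    using e M0 self_similar_unique[OF assms] by auto
qed

section \<open>Convolutions and direct sums of digit sets\<close>

lemma fourier_convolution:
  assumes "real_distribution M" "real_distribution M'"
  shows "real_distribution (convolution M M')"
    and "fourier (convolution M M') t = fourier M t * fourier M' t"
proof -
  interpret M: real_distribution M by fact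
  interpret M': real_distribution M' by fact
  interpret PM: pair_prob_space M M' ..
  have m[measurable]: "(\<lambda>(x, y). x + y) \<in> borel_measurable (M \<Otimes>\<^sub>M M')"
    by measurable
  show "real_distribution (convolution M M')"
    unfolding convolution_def by (intro PM.P.real_distribution_distr) measurable
  have "fourier (convolution M M') t = integral\<^sup>L (M \<Otimes>\<^sub>M M') (\<lambda>z. cis (2 * pi * t * (case z of (x, y) \<Rightarrow> x + y)))"
    unfolding convolution_def fourier_def by (intro integral_distr) measurable
  also have "\<dots> = (\<integral>x. (\<integral>y. cis (2 * pi * t * (x + y)) \<partial>M') \<partial>M)"
    by (subst PM.integral_fst'[symmetric]) (auto intro!: PM.P.integrable_const_bound[where B = 1])
  also have "\<dots> = (\<integral>x. (\<integral>y. cis (2 * pi * t * x) * cis (2 * pi * t * y) \<partial>M') \<partial>M)"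
    by (simp add: cis_mult algebra_simps)
  also have "\<dots> = fourier M t * fourier M' t"
    by (simp add: fourier_def)
  finally show "fourier (convolution M M') t = fourier M t * fourier M' t" .
qed

lemma disjoint_differences_inj:
  assumes "disjoint_differences A A'"
    and "a \<in> A" "a' \<in> A'" "b \<in> A" "b' \<in> A'" "a + a' = b + b'"
  shows "a = b" "a' = b'"
proof -
  have "a - b = b' - a'" using assms(6) by (simp add: algebra_simps)
  then have "a - b \<in> {x - y |x y. x \<in> A \<and> y \<in> A} \<inter> {x - y |x y. x \<in> A' \<and> y \<in> A'}"
    using assms(2-5) by (intro IntI CollectI) (metis, metis)
  then have "a - b = 0" using assms(1) unfolding disjoint_differences_def by blast
  then show "a = b" "a' = b'" using assms(6) by auto
qed

lemma
  assumes "finite B" "finite B'" "disjoint_differences B B'"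
  shows sum_over_direct_sum: "(\<Sum>d\<in>B + B'. g d) = (\<Sum>b\<in>B. \<Sum>b'\<in>B'. g (b + b'))"
    and card_direct_sum: "card (B + B') = card B * card B'"
proof -
  have inj: "inj_on (\<lambda>(b, b'). b + b') (B \<times> B')"
    using disjoint_differences_inj[OF assms(3)] by (auto simp: inj_on_def)
  have im: "B + B' = (\<lambda>(b, b'). b + b') ` (B \<times> B')"
    by (auto simp: set_plus_def)
  show "(\<Sum>d\<in>B + B'. g d) = (\<Sum>b\<in>B. \<Sum>b'\<in>B'. g (b + b'))"
    unfolding im sum.reindex[OF inj] by (simp add: sum.cartesian_product case_prod_unfold)
  show "card (B + B') = card B * card B'"
    unfolding im card_image[OF inj] by (rule card_cartesian_product)
qed

lemma mask_direct_sum: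
  assumes "finite B" "finite B'" "disjoint_differences B B'"
  shows "mask (B + B') x = mask B x * mask B' x"
proof -
  have "(\<Sum>d\<in>B + B'. cis (2 * pi * of_int d * x))
      = (\<Sum>b\<in>B. \<Sum>b'\<in>B'. cis (2 * pi * of_int b * x) * cis (2 * pi * of_int b' * x))"
    unfolding sum_over_direct_sum[OF assms] by (simp add: cis_mult algebra_simps)
  then show ?thesis
    by (simp add: mask_def card_direct_sum[OF assms] sum_product)
qed

text \<open>The mask is multiplicative on direct sums, so the product of the two transforms solves
  the functional equation that determines the left side.\<close>

lemma invariant_measure_direct_sum:
  assumes R: "R \<ge> 2" and B: "finite B" "B \<noteq> {}" "finite B'" "B' \<noteq> {}" "disjoint_differences B B'"
  shows "invariant_measure R (B + B') = convolution (invariant_measure R B) (invariant_measure R B')"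
proof (rule fourier_functional_equation_unique[OF R, where D = "B + B'"])
  have BB: "finite (B + B')" "B + B' \<noteq> {}"
    using B by (auto simp: finite_set_plus set_plus_def)
  note ss = self_similar_invariant_measure[OF R]
  show "real_distribution (invariant_measure R (B + B'))"
    using ss[OF BB] by (rule self_similar_real_distribution)
  note rd = ss[OF B(1,2), THEN self_similar_real_distribution]
    ss[OF B(3,4), THEN self_similar_real_distribution]
  show "real_distribution (convolution (invariant_measure R B) (invariant_measure R B'))"
    by (rule fourier_convolution[OF rd])
  fix t
  show "fourier (invariant_measure R (B + B')) t = mask (B + B') (t / of_int R)
      * fourier (invariant_measure R (B + B')) (t / of_int R)"
    by (rule self_similar_fourier[OF ss[OF BB] BB])
  show "fourier (convolution (invariant_measure R B) (invariant_measure R B')) t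
      = mask (B + B') (t / of_int R)
      * fourier (convolution (invariant_measure R B) (invariant_measure R B')) (t / of_int R)"
    unfolding fourier_convolution(2)[OF rd] mask_direct_sum[OF B(1,3,5)]
    using self_similar_fourier[OF ss[OF B(1,2)] B(1,2), of t]
      self_similar_fourier[OF ss[OF B(3,4)] B(3,4), of t] by simp
qed

subsection \<open>Attractors\<close>

lemma tau_image_eq: "R \<noteq> 0 \<Longrightarrow> tau R d ` S = {x. of_int R * x - of_int d \<in> S}"
proof (intro set_eqI iffI)
  fix x assume R: "R \<noteq> 0" and "x \<in> {x. of_int R * x - of_int d \<in> S}"
  then show "x \<in> tau R d ` S"
    by (intro image_eqI[of _ _ "of_int R * x - of_int d"]) (auto simp: tau_def)
qed (auto simp: tau_def)

text \<open>Following the preimages of a point of \<open>X\<close> for \<open>n\<close> steps and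
  moving a fixed point of \<open>Y\<close> forward along the same digits gives a point of
  \<open>Y\<close> at distance at most \<open>C / R^n\<close>. Used in both directions, this yields
  uniqueness of the attractor.\<close>

lemma compact_subset_of_invariant:
  assumes R: "R \<ge> 2" and X: "compact X" "X \<subseteq> (\<Union>d\<in>D. tau R d ` X)"
    and Y: "compact Y" "Y \<noteq> {}" "(\<Union>d\<in>D. tau R d ` Y) \<subseteq> Y"
  shows "X \<subseteq> Y"
proof
  fix x assume x: "x \<in> X"
  obtain a where a: "a \<in> Y" using Y by auto
  obtain C where C: "\<And>x. x \<in> X \<Longrightarrow> \<bar>x - a\<bar> \<le> C"
  proof -
    have "bounded ((\<lambda>x. x - a) ` X)"
      using X(1) by (intro compact_imp_bounded compact_continuous_image continuous_intros)
    then show ?thesis using that unfolding bounded_iff by auto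
  qed
  have "\<forall>x\<in>X. \<exists>y\<in>Y. \<bar>x - y\<bar> \<le> C / of_int R ^ n" for n
  proof (induction n)
    case 0
    then show ?case using C a by auto
  next
    case (Suc n)
    show ?case
    proof
      fix x assume "x \<in> X"
      then obtain d x' where x': "d \<in> D" "x' \<in> X" "x = tau R d x'" using X(2) by auto
      then obtain y' where y': "y' \<in> Y" "\<bar>x' - y'\<bar> \<le> C / of_int R ^ n" using Suc by auto
      have "x - tau R d y' = (x' - y') / of_int R"
        using x' by (simp add: tau_def diff_divide_distrib add_divide_distrib)
      then have "\<bar>x - tau R d y'\<bar> = \<bar>x' - y'\<bar> / of_int R"
        using R by simp
      also have "\<dots> \<le> (C / of_int R ^ n) / of_int R"
        using y' R by (intro divide_right_mono) auto
      finally have "\<bar>x - tau R d y'\<bar> \<le> C / of_int R ^ Suc n"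
        by (simp add: mult.commute)
      moreover have "tau R d y' \<in> Y" using x' y' Y(3) by auto
      ultimately show "\<exists>y\<in>Y. \<bar>x - y\<bar> \<le> C / of_int R ^ Suc n" by blast
    qed
  qed
  then have "\<forall>n. \<exists>y. y \<in> Y \<and> \<bar>x - y\<bar> \<le> C / of_int R ^ n" using x by blast
  then obtain y where y: "\<And>n. y n \<in> Y" "\<And>n. \<bar>x - y n\<bar> \<le> C / of_int R ^ n"
    using choice[of "\<lambda>n y. y \<in> Y \<and> \<bar>x - y\<bar> \<le> C / of_int R ^ n"] by blast
  have "(\<lambda>n. C * (1 / of_int R) ^ n) \<longlonglongrightarrow> C * 0"
    using R by (intro tendsto_intros LIMSEQ_power_zero) simp
  then have "(\<lambda>n. C / of_int R ^ n) \<longlonglongrightarrow> 0" by (simp add: power_divide)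
  then have "(\<lambda>n. x - y n) \<longlonglongrightarrow> 0"
    by (rule Lim_null_comparison[rotated]) (use y in auto)
  then have "(\<lambda>n. x - (x - y n)) \<longlonglongrightarrow> x - 0" by (intro tendsto_intros)
  then have "y \<longlonglongrightarrow> x" by simp
  then show "x \<in> Y"
    using y compact_imp_closed[OF Y(1)] closed_sequentially by blast
qed

lemma attractor_exists:
  assumes R: "R \<ge> 2" and D: "finite D" "D \<noteq> {}"
  shows "\<exists>X. X \<noteq> {} \<and> compact X \<and> X = (\<Union>d\<in>D. tau R d ` X)"
proof -
  \<comment> \<open>A bound on all digits. The interval \<open>{-b..b}\<close> is mapped into itself
    because \<open>\<bar>x + d\<bar> \<le> 2 * b \<le> R * b\<close>, so its iterates decrease to
    the attractor.\<close>
  define b where "b = (\<Sum>d\<in>D. \<bar>real_of_int d\<bar>)"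
  define T where "T S = (\<Union>d\<in>D. tau R d ` S)" for S
  define K where "K n = (T ^^ n) {-b..b}" for n
  have K_Suc: "K (Suc n) = T (K n)" for n by (simp add: K_def)
  have mono: "S \<subseteq> S' \<Longrightarrow> T S \<subseteq> T S'" for S S' by (auto simp: T_def)
  have K1: "K (Suc 0) \<subseteq> K 0"
  proof
    fix y assume "y \<in> K (Suc 0)"
    then obtain d x where "d \<in> D" "x \<in> {-b..b}" "y = tau R d x"
      by (auto simp: K_def T_def)
    then have d: "d \<in> D" "\<bar>x\<bar> \<le> b" "y = tau R d x" by auto
    have "\<bar>real_of_int d\<bar> \<le> b"
      using D d member_le_sum[of d D "\<lambda>d. \<bar>real_of_int d\<bar>"] by (auto simp: b_def)
    then have "\<bar>x + of_int d\<bar> \<le> 2 * b" using d by linarith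
    also have "\<dots> \<le> of_int R * b"
      using R d by (intro mult_right_mono) auto
    finally have "\<bar>y\<bar> \<le> b"
      using R d by (simp add: tau_def pos_divide_le_eq mult.commute)
    then show "y \<in> K 0" by (auto simp: K_def abs_le_iff)
  qed
  have dec: "K (Suc n) \<subseteq> K n" for n
  proof (induction n)
    case (Suc n)
    from mono[OF this] show ?case unfolding K_Suc[symmetric] .
  qed (rule K1)
  then have anti: "m \<le> n \<Longrightarrow> K n \<subseteq> K m" for m n
    by (rule lift_Suc_antimono_le)
  have comp: "compact (K n)" for n
  proof (induction n)
    case (Suc n)
    then show ?case
      unfolding K_Suc T_def tau_def using D
      by (intro compact_UN ballI compact_continuous_image continuous_intros) (use R in auto)
  qed (simp add: K_def)
  have ne: "K n \<noteq> {}" for n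
  proof (induction n)
    case 0
    have "0 \<in> {-b..b}" by (auto simp: b_def sum_nonneg)
    then show ?case unfolding K_def by auto
  next
    case (Suc n)
    then show ?case using D by (auto simp: K_Suc T_def)
  qed
  define X where "X = (\<Inter>n. K n)"
  have "X = T X"
  proof
    show "T X \<subseteq> X"
    proof -
      have "T X \<subseteq> K (Suc n)" for n unfolding K_Suc by (intro mono) (auto simp: X_def)
      from order_trans[OF this dec] show ?thesis
        unfolding X_def by (rule INT_greatest)
    qed
    show "X \<subseteq> T X"
    proof
      fix x assume "x \<in> X"
      then have "\<forall>n\<in>UNIV. \<exists>d\<in>D. of_int R * x - of_int d \<in> K n"
      proof (intro ballI)
        fix n
        have "x \<in> T (K n)" using \<open>x \<in> X\<close> unfolding K_Suc[symmetric] X_def by blast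
        then show "\<exists>d\<in>D. of_int R * x - of_int d \<in> K n"
          using R by (simp add: T_def tau_image_eq)
      qed
      \<comment> \<open>The digit may depend on \<open>n\<close>. One of the finitely many digits
        occurs for infinitely many \<open>n\<close>, and since the sets \<open>K n\<close> decrease
        it serves for all of them.\<close>
      from pigeonhole_infinite_rel[OF infinite_UNIV_nat D(1) this]
      obtain d where d: "d \<in> D" "infinite {n \<in> UNIV. of_int R * x - of_int d \<in> K n}"
        by (rule bexE)
      have "of_int R * x - of_int d \<in> K m" for m
      proof -
        obtain n where "n \<ge> m" "of_int R * x - of_int d \<in> K n"
          using d(2) unfolding infinite_nat_iff_unbounded_le by blast
        then show ?thesis using anti[of m n] by auto
      qed
      then have "of_int R * x - of_int d \<in> X" by (simp add: X_def)
      then show "x \<in> T X" using d(1) R unfolding T_def by (intro UN_I[of d]) (simp_all add: tau_image_eq)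
    qed
  qed
  moreover have "X \<noteq> {}" unfolding X_def by (rule compact_nest[OF comp ne anti])
  moreover have "compact X" unfolding X_def by (intro compact_Inter) (use comp in auto)
  ultimately show ?thesis unfolding T_def by blast
qed

lemma attractor_props:
  assumes "R \<ge> 2" "finite D" "D \<noteq> {}"
  shows "attractor R D \<noteq> {}" "compact (attractor R D)"
    "attractor R D = (\<Union>d\<in>D. tau R d ` attractor R D)"
proof -
  have "\<exists>!X. X \<noteq> {} \<and> compact X \<and> X = (\<Union>d\<in>D. tau R d ` X)"
    using attractor_exists[OF assms] compact_subset_of_invariant[OF assms(1)]
    by (metis subset_antisym order_refl)
  from theI'[OF this] show "attractor R D \<noteq> {}" "compact (attractor R D)"
    "attractor R D = (\<Union>d\<in>D. tau R d ` attractor R D)"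
    unfolding attractor_def by blast+
qed

lemma tau_image_borel:
  assumes "R \<noteq> 0" "A \<in> sets borel"
  shows "tau R d ` A \<in> sets borel"
proof -
  have "(\<lambda>x. real_of_int R * x - of_int d) -` A \<inter> space borel \<in> sets borel"
    using assms by (intro measurable_sets[of _ borel borel]) auto
  then show ?thesis using assms by (simp add: tau_image_eq vimage_def)
qed

lemma measure_tau_image:
  assumes R: "R > 0" and A: "A \<in> sets borel"
  shows "measure lborel (tau R d ` A) = measure lborel A / of_int R"
proof -
  have "tau R d = (\<lambda>x. (1 / of_int R) *\<^sub>R x + of_int d / of_int R)"
    by (simp add: tau_def fun_eq_iff add_divide_distrib)
  then have "measure lebesgue (tau R d ` A) = measure lebesgue A / of_int R"
    using measure_lebesgue_affine[of "1 / of_int R" "of_int d / of_int R :: real" A] R by simp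
  then show ?thesis
    using A tau_image_borel[of R A d] R by (simp add: measure_completion)
qed

text \<open>Subadditivity bounds the mass of \<open>E\<close> by the sum over the pieces. For
  \<open>E\<close> and its complement together both sides equal the mass of \<open>X\<close>,
  because there are exactly \<open>R\<close> digits; hence both inequalities are equalities,
  whatever the overlaps of the pieces.\<close>

lemma self_similar_uniform_measure:
  assumes R: "R > 0" and D: "finite D" "int (card D) = R"
    and X: "compact X" "X = (\<Union>d\<in>D. tau R d ` X)" "measure lborel X > 0"
  shows "self_similar R D (uniform_measure lborel X)"
proof -
  have Xb[measurable]: "X \<in> sets borel" and Xf: "X \<in> fmeasurable lborel"
    using X(1) by (auto intro: borel_compact fmeasurable_compact)
  have eX: "emeasure lborel X = ennreal (measure lborel X)"
    using Xf by (rule emeasure_eq_measure2)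
  then have eX': "emeasure lborel X \<noteq> 0" "emeasure lborel X \<noteq> \<infinity>" using X(3) by auto
  have fm: "X \<inter> A \<in> fmeasurable lborel" if "A \<in> sets borel" for A
    using that Xf by (intro fmeasurable_Int_fmeasurable) auto
  have tb[measurable]: "tau R d -` E \<in> sets borel" if "E \<in> sets borel" for d E
    using measurable_sets[OF tau_measurable that, of R d] by simp
  define s where "s E = (\<Sum>d\<in>D. measure lborel (X \<inter> tau R d -` E)) / of_int R" for E
  have le: "measure lborel (X \<inter> E) \<le> s E" if E[measurable]: "E \<in> sets borel" for E
  proof -
    have "X \<inter> E = (\<Union>d\<in>D. tau R d ` (X \<inter> tau R d -` E))"
      by (subst X(2)) auto
    then have "measure lborel (X \<inter> E) \<le> (\<Sum>d\<in>D. measure lborel (tau R d ` (X \<inter> tau R d -` E)))"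
      using D R by (auto intro!: measure_UNION_le tau_image_borel)
    also have "\<dots> = s E"
      using R by (simp add: measure_tau_image s_def sum_divide_distrib)
    finally show ?thesis .
  qed
  have split: "measure lborel (X \<inter> A) + measure lborel (X \<inter> - A) = measure lborel X"
    if [measurable]: "A \<in> sets borel" for A
  proof -
    have "measure lborel ((X \<inter> A) \<union> (X \<inter> - A)) = measure lborel (X \<inter> A) + measure lborel (X \<inter> - A)"
      using fm[of A] fm[of "- A"] by (intro measure_Union) (auto dest: fmeasurableD2)
    then show ?thesis by (simp flip: Int_Un_distrib)
  qed
  have eq: "measure lborel (X \<inter> E) = s E" if E[measurable]: "E \<in> sets borel" for E
  proof -
    have "s E + s (- E) = (\<Sum>d\<in>D. measure lborel (X \<inter> tau R d -` E)
        + measure lborel (X \<inter> - (tau R d -` E))) / of_int R"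
      by (simp add: s_def sum.distrib add_divide_distrib vimage_Compl)
    also have "\<dots> = (\<Sum>d\<in>D. measure lborel X) / of_int R"
      by (simp add: split)
    also have "\<dots> = (of_int (int (card D)) * measure lborel X) / of_int R" by simp
    also have "\<dots> = measure lborel (X \<inter> E) + measure lborel (X \<inter> - E)"
      unfolding D(2) using R split[OF E] by simp
    finally show ?thesis
      using le[of E] le[of "- E"] by simp
  qed
  show ?thesis
    unfolding self_similar_def
  proof (intro conjI ballI)
    show "prob_space (uniform_measure lborel X)"
      by (rule prob_space_uniform_measure[OF eX'])
    fix E :: "real set" assume E[measurable]: "E \<in> sets borel"
    have "real (card D) = of_int R" using D(2) by (metis of_int_of_nat_eq)
    then show "measure (uniform_measure lborel X) E
      = (1 / real (card D)) * (\<Sum>d\<in>D. measure (uniform_measure lborel X) (tau R d -` E))"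
      using eX' by (simp add: eq[OF E] s_def flip: sum_divide_distrib)
  qed simp
qed

text \<open>The union \<open>K\<close> of the integer translates of the attractor is closed and
  stable under integer shifts and under division by \<open>R\<close>. It therefore contains all
  \<open>(z + k) / R^n\<close> for one of its points \<open>z\<close>, and these are dense.\<close>

lemma attractor_plus_Ints:
  assumes R: "R \<ge> 2" and D: "finite D" "complete_residues R D"
  shows "\<exists>n::int. x - of_int n \<in> attractor R D"
proof -
  have "D \<noteq> {}" using D(2) unfolding complete_residues_def by blast
  note X = attractor_props[OF R D(1) this]
  define K where "K = {x. \<exists>n::int. x - of_int n \<in> attractor R D}"
  have "K = (\<Union>x\<in>attractor R D. \<Union>y\<in>\<int>. {x + y})"
  proof (intro set_eqI iffI)
    fix x assume "x \<in> K"
    then obtain n :: int where "x - of_int n \<in> attractor R D" by (auto simp: K_def)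
    then show "x \<in> (\<Union>x\<in>attractor R D. \<Union>y\<in>\<int>. {x + y})"
      by (intro UN_I[of "x - of_int n"] UN_I[of "of_int n"]) auto
  next
    fix x assume "x \<in> (\<Union>x\<in>attractor R D. \<Union>y\<in>\<int>. {x + y})"
    then obtain y n where "y \<in> attractor R D" "x = y + of_int n" by (auto elim: Ints_cases)
    then show "x \<in> K" unfolding K_def by (intro CollectI exI[of _ n]) simp
  qed
  then have "closed K"
    using compact_closed_sums[OF X(2) closed_Ints] by simp
  have K_add: "x + of_int k \<in> K" if xK: "x \<in> K" for x k
  proof -
    obtain n :: int where "x - of_int n \<in> attractor R D" using xK by (auto simp: K_def)
    then have "x + of_int k - of_int (n + k) \<in> attractor R D" by simp
    then show ?thesis unfolding K_def by blast
  qed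
  have K_div: "x / of_int R \<in> K" if xK: "x \<in> K" for x
  proof -
    obtain n :: int where n: "x - of_int n \<in> attractor R D" using xK by (auto simp: K_def)
    \<comment> \<open>With the digit congruent to \<open>n\<close>, the point
      \<open>(x - n + d) / R\<close> of the attractor differs from \<open>x / R\<close> by an
      integer.\<close>
    obtain d where d: "d \<in> D" "[n = d] (mod R)"
      using D(2) unfolding complete_residues_def by blast
    then obtain m where m: "n = d + R * m"
      by (metis cong_iff_lin cong_sym)
    have "tau R d (x - of_int n) \<in> attractor R D"
      using X(3) d n by blast
    moreover have "tau R d (x - of_int n) = x / of_int R - of_int m"
      using R by (simp add: tau_def m field_simps)
    ultimately show ?thesis unfolding K_def by auto
  qed
  have K_pow: "x / of_int R ^ n \<in> K" if "x \<in> K" for x n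
  proof (induction n)
    case (Suc n)
    from K_div[OF this] show ?case by (simp add: mult.commute)
  qed (use that in simp)
  obtain z where z: "z \<in> attractor R D" using X(1) by auto
  then have zK: "z \<in> K" unfolding K_def by (intro CollectI exI[of _ 0]) simp
  have "x \<in> closure K"
    unfolding closure_approachable
  proof (intro allI impI)
    fix e :: real assume e: "e > 0"
    obtain n where n: "(1 / of_int R) ^ n < e"
      using real_arch_pow_inv[OF e, of "1 / of_int R"] R by auto
    define k where "k = \<lfloor>x * of_int R ^ n - z\<rfloor>"
    have k: "\<bar>x * of_int R ^ n - (z + of_int k)\<bar> \<le> 1"
      unfolding k_def by linarith
    have "x - (z + of_int k) / of_int R ^ n = (x * of_int R ^ n - (z + of_int k)) / of_int R ^ n"
      using R by (simp add: field_simps)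
    then have "\<bar>x - (z + of_int k) / of_int R ^ n\<bar> \<le> 1 / of_int R ^ n"
      using k R by (simp add: divide_right_mono)
    then have "dist ((z + of_int k) / of_int R ^ n) x < e"
      using n by (simp add: dist_real_def abs_minus_commute power_divide)
    then show "\<exists>y\<in>K. dist y x < e"
      using K_pow[OF K_add[OF zK]] by blast
  qed
  then show ?thesis using \<open>closed K\<close> by (simp add: K_def)
qed

text \<open>Countably many translates cover the line, so they cannot all be null.\<close>

lemma attractor_measure_pos:
  assumes R: "R \<ge> 2" and D: "finite D" "complete_residues R D"
  shows "measure lborel (attractor R D) > 0"
proof (rule ccontr)
  assume n: "\<not> measure lborel (attractor R D) > 0"
  have "D \<noteq> {}" using D(2) unfolding complete_residues_def by blast
  note X = attractor_props[OF R D(1) this]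
  have "attractor R D \<in> fmeasurable lborel" using X by (intro fmeasurable_compact)
  then have "attractor R D \<in> null_sets lborel"
    using n emeasure_eq_measure2[of "attractor R D" lborel] X
    by (auto simp: null_sets_def borel_compact not_less measure_le_0_iff)
  then have "(\<Union>n::int. {x. x - of_int n \<in> attractor R D}) \<in> null_sets lborel"
    by (intro null_sets_UN null_sets_translation)
  moreover have "(\<Union>n::int. {x. x - of_int n \<in> attractor R D}) = UNIV"
    using attractor_plus_Ints[OF assms] by auto
  ultimately show False by (simp add: null_sets_def)
qed

subsection \<open>Hadamard pairs and extreme cycles\<close>

lemma fourier_0: "real_distribution M \<Longrightarrow> fourier M 0 = 1"
  by (simp add: fourier_eq_char real_distribution.char_zero)

lemma mask_plus_int: "mask B (x + of_int n) = mask B x"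
proof -
  have "cis (2 * pi * of_int b * (x + of_int n)) = cis (2 * pi * of_int b * x)" for b
  proof -
    have "cis (2 * pi * of_int b * (x + of_int n))
        = cis (2 * pi * of_int b * x) * cis (2 * pi * of_int (b * n))"
      unfolding cis_mult by (rule arg_cong[where f = cis]) (simp add: algebra_simps)
    then show ?thesis by (simp only: cis_multiple_2pi Ints_of_int mult_1_right)
  qed
  then show ?thesis by (simp add: mask_def)
qed

lemma mask_Ints: "finite B \<Longrightarrow> B \<noteq> {} \<Longrightarrow> x \<in> \<int> \<Longrightarrow> mask B x = 1"
  using mask_plus_int[of B 0] mask_0 by (auto elim!: Ints_cases)

text \<open>The mask extends to an entire function with a nonzero value at 0. Such a function is a
  nonzero constant or has finitely many zeros in each disc.\<close>

lemma finite_mask_zeros: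
  assumes B: "finite B" "B \<noteq> {}"
  shows "finite {x \<in> {-r..r}. mask B x = 0}"
proof -
  define F where "F z = (\<Sum>b\<in>B. exp (2 * pi * \<i> * of_int b * z))" for z :: complex
  have mF: "mask B x = F (of_real x) / of_nat (card B)" for x
    by (simp add: mask_def F_def cis_conv_exp mult_ac)
  have F0: "F 0 \<noteq> 0" using B by (simp add: F_def)
  have "finite {z \<in> cball 0 r. F z = 0}"
  proof (cases "F constant_on UNIV")
    case True
    then have "F z \<noteq> 0" for z using F0 unfolding constant_on_def by (metis UNIV_I)
    then show ?thesis by simp
  next
    case False
    have "F holomorphic_on UNIV"
      unfolding F_def by (intro holomorphic_intros)
    then show ?thesis
      by (rule holomorphic_compact_finite_zeros) (use False in auto)
  qed
  then have "finite (of_real -` {z \<in> cball 0 r. F z = 0} :: real set)"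
    by (rule finite_vimageI) (simp add: inj_of_real)
  then show ?thesis
    by (rule finite_subset[rotated]) (use B in \<open>auto simp: mF abs_le_iff\<close>)
qed

lemma
  assumes "hadamard_pair R B L"
  shows hadamard_pair_R: "R \<ge> 2"
    and hadamard_pair_finite: "finite B" "finite L"
    and hadamard_pair_0: "0 \<in> B" "0 \<in> L"
    and hadamard_pair_nonempty: "B \<noteq> {}" "L \<noteq> {}"
    and hadamard_pair_card: "card L = card B" "card B > 0"
  using assms by (auto simp: hadamard_pair_def card_gt_0_iff)

lemma cis_2pi_diff: "cis (2 * pi * r * x * l) * cnj (cis (2 * pi * r * y * l))
    = cis (2 * pi * (r * (x - y)) * l)"
  by (simp add: cis_cnj cis_mult algebra_simps)

lemma hadamard_pair_rows:
  assumes h: "hadamard_pair R B L" and b: "b \<in> B" "b' \<in> B"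
  shows "(\<Sum>l\<in>L. cis (2 * pi * ((1 / of_int R) * of_int (b - b')) * of_int l))
    = (if b = b' then of_nat (card B) else 0)"
proof -
  define U where "U b l = complex_of_real (1 / sqrt (real (card B)))
       * cis (2 * pi * (1 / of_int R) * of_int b * of_int l)" for b l
  have "(\<Sum>l\<in>L. U b l * cnj (U b' l)) = (if b = b' then 1 else 0)"
    using h b unfolding hadamard_pair_def unitary_on_def U_def by blast
  moreover have "U b l * cnj (U b' l)
      = cis (2 * pi * ((1 / of_int R) * of_int (b - b')) * of_int l) / of_nat (card B)" for l
  proof -
    have "complex_of_real (1 / sqrt (real (card B))) * complex_of_real (1 / sqrt (real (card B)))
        = 1 / of_nat (card B)"
      unfolding of_real_mult[symmetric] by (simp add: real_sqrt_mult_self)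
    then show ?thesis
      unfolding U_def using cis_2pi_diff[of "1 / of_int R" "of_int b" "of_int l" "of_int b'"]
      by (simp add: mult_ac)
  qed
  ultimately have "(\<Sum>l\<in>L. cis (2 * pi * ((1 / of_int R) * of_int (b - b')) * of_int l)) / of_nat (card B)
      = (if b = b' then 1 else 0)"
    by (simp add: sum_divide_distrib)
  then show ?thesis
    using hadamard_pair_card[OF h] by (auto split: if_splits simp: field_simps)
qed

text \<open>Column orthogonality read as zeros of the mask. These zeros make frequencies with
  different last digits orthogonal.\<close>

lemma hadamard_pair_columns:
  assumes h: "hadamard_pair R B L" and l: "l \<in> L" "l' \<in> L" "l \<noteq> l'"
  shows "mask B (of_int (l - l') / of_int R) = 0"
proof -
  define U where "U b l = complex_of_real (1 / sqrt (real (card B)))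
       * cis (2 * pi * (1 / of_int R) * of_int b * of_int l)" for b l
  have "(\<Sum>b\<in>B. cnj (U b l') * U b l) = 0"
    using h l unfolding hadamard_pair_def unitary_on_def U_def by (metis (no_types, lifting))
  moreover have "cnj (U b l') * U b l
      = cis (2 * pi * of_int b * (of_int (l - l') / of_int R)) / of_nat (card B)" for b
  proof -
    have "complex_of_real (1 / sqrt (real (card B))) * complex_of_real (1 / sqrt (real (card B)))
        = 1 / of_nat (card B)"
      unfolding of_real_mult[symmetric] by (simp add: real_sqrt_mult_self)
    moreover have "cnj (cis (2 * pi * (1 / of_int R) * of_int b * of_int l'))
        * cis (2 * pi * (1 / of_int R) * of_int b * of_int l)
        = cis (2 * pi * of_int b * (of_int (l - l') / of_int R))"
      unfolding cis_cnj cis_mult by (rule arg_cong[where f = cis])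
        (simp add: algebra_simps diff_divide_distrib)
    moreover have "cnj (U b l') * U b l
        = (complex_of_real (1 / sqrt (real (card B))) * complex_of_real (1 / sqrt (real (card B))))
        * (cnj (cis (2 * pi * (1 / of_int R) * of_int b * of_int l'))
        * cis (2 * pi * (1 / of_int R) * of_int b * of_int l))"
      unfolding U_def complex_cnj_mult complex_cnj_complex_of_real by (simp only: mult_ac)
    ultimately show ?thesis by (simp only: times_divide_eq_left mult_1_left)
  qed
  ultimately show ?thesis
    by (simp add: mask_def sum_divide_distrib)
qed

text \<open>If two distinct digits were congruent, column orthogonality would give a zero of the
  mask at an integer, where its value is 1.\<close>

lemma hadamard_pair_distinct_mod:
  assumes h: "hadamard_pair R B L" and l: "l \<in> L" "l' \<in> L" "R dvd l - l'"
  shows "l = l'"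
proof (rule ccontr)
  assume "l \<noteq> l'"
  then have "mask B (of_int (l - l') / of_int R) = 0"
    using hadamard_pair_columns[OF h l(1,2)] by simp
  moreover have "real_of_int (l - l') / of_int R \<in> \<int>"
  proof -
    obtain k where k: "l - l' = R * k" using l(3) by (rule dvdE)
    show ?thesis unfolding k using hadamard_pair_R[OF h] by simp
  qed
  ultimately show False
    using mask_Ints hadamard_pair_finite[OF h] hadamard_pair_nonempty[OF h] by fastforce
qed

text \<open>After expanding the square, row orthogonality removes all terms with
  \<open>b \<noteq> b'\<close>. Thus the weights form a probability distribution on the digits at
  each point.\<close>

lemma hadamard_pair_sum_mask:
  assumes h: "hadamard_pair R B L"
  shows "(\<Sum>l\<in>L. (cmod (mask B ((x + of_int l) / of_int R)))\<^sup>2) = 1"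
proof -
  define N where "N = card B"
  have N: "N > 0" using hadamard_pair_card[OF h] by (simp add: N_def)
  define q where "q b b' = cis (2 * pi * ((x / of_int R) * of_int (b - b')))" for b b' :: int
  have "complex_of_real (\<Sum>l\<in>L. (cmod (mask B ((x + of_int l) / of_int R)))\<^sup>2)
     = (\<Sum>l\<in>L. mask B ((x + of_int l) / of_int R) * cnj (mask B ((x + of_int l) / of_int R)))"
    by (simp add: complex_norm_square del: of_real_power)
  also have "\<dots> = (\<Sum>l\<in>L. (\<Sum>b\<in>B. \<Sum>b'\<in>B. q b b' *
       cis (2 * pi * ((1 / of_int R) * of_int (b - b')) * of_int l)) / (of_nat N * of_nat N))"
  proof (intro sum.cong refl)
    fix l
    have "cis (2 * pi * of_int b * ((x + of_int l) / of_int R))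
        * cnj (cis (2 * pi * of_int b' * ((x + of_int l) / of_int R)))
        = q b b' * cis (2 * pi * ((1 / of_int R) * of_int (b - b')) * of_int l)" for b b'
      unfolding cis_cnj cis_mult q_def by (rule arg_cong[where f = cis])
        (simp add: algebra_simps add_divide_distrib diff_divide_distrib)
    then show "mask B ((x + of_int l) / of_int R) * cnj (mask B ((x + of_int l) / of_int R))
       = (\<Sum>b\<in>B. \<Sum>b'\<in>B. q b b' *
       cis (2 * pi * ((1 / of_int R) * of_int (b - b')) * of_int l)) / (of_nat N * of_nat N)"
      by (simp add: mask_def N_def sum_product)
  qed
  also have "\<dots> = (\<Sum>b\<in>B. \<Sum>b'\<in>B. q b b' *
       (\<Sum>l\<in>L. cis (2 * pi * ((1 / of_int R) * of_int (b - b')) * of_int l))) / (of_nat N * of_nat N)"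
    unfolding sum_divide_distrib[symmetric] sum_distrib_left
    by (subst sum.swap, subst (2) sum.swap) simp
  also have "(\<Sum>b\<in>B. \<Sum>b'\<in>B. q b b' *
       (\<Sum>l\<in>L. cis (2 * pi * ((1 / of_int R) * of_int (b - b')) * of_int l)))
     = (\<Sum>b\<in>B. \<Sum>b'\<in>B. if b = b' then of_nat N else 0)"
  proof (intro sum.cong refl)
    fix b b' assume "b \<in> B" "b' \<in> B"
    then show "q b b' * (\<Sum>l\<in>L. cis (2 * pi * ((1 / of_int R) * of_int (b - b')) * of_int l))
      = (if b = b' then of_nat N else 0)"
      unfolding hadamard_pair_rows[OF h \<open>b \<in> B\<close> \<open>b' \<in> B\<close>] by (simp add: q_def N_def)
  qed
  also have "\<dots> = of_nat N * of_nat N"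
    using hadamard_pair_finite[OF h] by (simp add: N_def)
  finally have "complex_of_real (\<Sum>l\<in>L. (cmod (mask B ((x + of_int l) / of_int R)))\<^sup>2) = complex_of_real 1"
    using N by simp
  then show ?thesis unfolding of_real_eq_iff .
qed

section \<open>Representations in base R and orthogonality of representable frequencies\<close>

lemma representable_step: "l \<in> D \<Longrightarrow> x \<in> representable R D \<Longrightarrow> R * x + l \<in> representable R D"
proof -
  assume l: "l \<in> D" and "x \<in> representable R D"
  then obtain y d where y: "y 0 = x" "\<And>k. d k \<in> D \<and> y k = R * y (Suc k) + d k"
    unfolding representable_def by blast
  show ?thesis
    unfolding representable_def
  proof (rule CollectI, rule exI[of _ "case_nat (R * x + l) y"], rule exI[of _ "case_nat l d"],
      intro conjI allI)
    fix k
    show "case_nat l d k \<in> D"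
      by (cases k) (simp_all add: l y(2)[THEN conjunct1])
    show "case_nat (R * x + l) y k = R * case_nat (R * x + l) y (Suc k) + case_nat l d k"
    proof (cases k)
      case (Suc j)
      then show ?thesis using y(2)[of j] by simp
    qed (simp add: y(1))
  qed simp
qed

lemma representable_cases:
  assumes "x \<in> representable R D"
  obtains l x' where "l \<in> D" "x' \<in> representable R D" "x = R * x' + l"
proof -
  obtain y d where y: "y 0 = x" "\<And>k. d k \<in> D \<and> y k = R * y (Suc k) + d k"
    using assms unfolding representable_def by blast
  have "y (Suc 0) \<in> representable R D"
    unfolding representable_def using y(2)
    by (intro CollectI exI[of _ "\<lambda>k. y (Suc k)"] exI[of _ "\<lambda>k. d (Suc k)"]) blast
  then show ?thesis using that y by metis
qed

lemma zero_representable: "0 \<in> D \<Longrightarrow> 0 \<in> representable R D"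
  unfolding representable_def by (intro CollectI exI[of _ "\<lambda>_. 0"]) auto

text \<open>If the last digits agree, one step of the functional equation replaces the difference by
  one of smaller modulus, because it shrinks by the factor \<open>R\<close>. If they differ, the
  mask vanishes, being 1-periodic and zero at \<open>(l - m) / R\<close>.\<close>

lemma representable_orthogonal:
  assumes h: "hadamard_pair R B L"
    and f: "\<And>t. f t = mask B (t / of_int R) * f (t / of_int R)"
    and x: "x \<in> representable R L" "y \<in> representable R L" "x \<noteq> y"
  shows "f (of_int (x - y)) = 0"
  using x
proof (induction "nat \<bar>x - y\<bar>" arbitrary: x y rule: less_induct)
  case less
  have R: "R \<ge> 2" by (rule hadamard_pair_R[OF h])
  obtain l x' where x: "l \<in> L" "x' \<in> representable R L" "x = R * x' + l"
    using less.prems(1) by (rule representable_cases)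
  obtain m y' where y: "m \<in> L" "y' \<in> representable R L" "y = R * y' + m"
    using less.prems(2) by (rule representable_cases)
  have e: "real_of_int (x - y) / of_int R = of_int (l - m) / of_int R + of_int (x' - y')"
    using R by (simp add: x y field_simps)
  show ?case
  proof (cases "l = m")
    case True
    have xy: "x - y = R * (x' - y')" using True x y by (simp add: algebra_simps)
    then have ne: "x' \<noteq> y'" using less.prems by auto
    then have "\<bar>x - y\<bar> > \<bar>x' - y'\<bar>" using R by (simp add: xy abs_mult)
    then have "f (of_int (x' - y')) = 0"
      using ne x y by (intro less.hyps) auto
    then show ?thesis
      by (subst f) (simp only: e True diff_self of_int_0 div_0 add_0_left mult_zero_right)
  next
    case False
    then show ?thesis
      by (subst f) (simp only: e mask_plus_int hadamard_pair_columns[OF h x(1) y(1)]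
        mult_zero_left not_False_eq_True)
  qed
qed

section \<open>Sets stable under moves of positive weight\<close>

lemma mask_nonzero_near_0:
  assumes "finite B" "B \<noteq> {}"
  obtains \<delta> where "\<delta> > 0" "\<And>x. \<bar>x\<bar> < \<delta> \<Longrightarrow> mask B x \<noteq> 0"
proof -
  have "isCont (mask B) 0"
    using continuous_on_mask[of UNIV B] by (simp add: continuous_on_eq_continuous_at)
  then have "\<exists>e>0. \<forall>y. dist 0 y < e \<longrightarrow> mask B y \<noteq> 0"
    by (rule continuous_at_avoid) (simp add: mask_0 assms)
  then show ?thesis using that by (auto simp: dist_real_def)
qed

text \<open>A set that is stable under all moves \<open>x \<mapsto> (x + l) / R\<close> of positive weight is finite unless it
  contains 0: the digit 0 contracts each point towards 0, and this is blocked
  only if some \<open>x / R\<^sup>k\<close> is one of the finitely many zeros of \<open>mask B\<close>.\<close>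

lemma invariant_set_finite:
  assumes h: "hadamard_pair R B L"
    and M: "closed M" "M \<subseteq> {-r..r}" "0 \<notin> M"
    and inv: "\<And>x l. x \<in> M \<Longrightarrow> l \<in> L \<Longrightarrow> mask B ((x + of_int l) / of_int R) \<noteq> 0
      \<Longrightarrow> (x + of_int l) / of_int R \<in> M"
  shows "finite M"
proof -
  note R = hadamard_pair_R[OF h] and fin = hadamard_pair_finite[OF h]
    and ne = hadamard_pair_nonempty[OF h]
  define Z where "Z = {x \<in> {-r..r}. mask B x = 0}"
  have Z: "finite Z" unfolding Z_def by (rule finite_mask_zeros[OF fin(1) ne(1)])
  obtain \<delta> where \<delta>: "\<delta> > 0" "\<And>x. \<bar>x\<bar> < \<delta> \<Longrightarrow> mask B x \<noteq> 0"
    using mask_nonzero_near_0[OF fin(1) ne(1)] by blast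
  \<comment> \<open>After \<open>k0\<close> divisions by \<open>R\<close> every point of
    \<open>M\<close> is within \<open>\<delta>\<close> of 0, where the mask has no zeros. So a zero
    on the orbit can only occur earlier.\<close>
  obtain k0 where k0: "r / \<delta> < of_int R ^ k0"
    using real_arch_pow[of "of_int R" "r / \<delta>"] R by auto
  have "M \<subseteq> (\<Union>k\<le>k0. (\<lambda>z. of_int R ^ k * z) ` Z)"
  proof
    fix x assume x: "x \<in> M"
    define g where "g k = x / of_int R ^ k" for k
    have g_Suc: "g (Suc k) = (g k + of_int 0) / of_int R" for k
      by (simp add: g_def field_simps)
    have "\<exists>k. mask B (g (Suc k)) = 0"
    proof (rule ccontr)
      assume nz: "\<nexists>k. mask B (g (Suc k)) = 0"
      have gM: "g k \<in> M" for k
      proof (induction k)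
        case (Suc k)
        have "mask B ((g k + of_int 0) / of_int R) \<noteq> 0"
          using nz unfolding g_Suc[symmetric] by blast
        from inv[OF Suc hadamard_pair_0(2)[OF h] this] show ?case unfolding g_Suc .
      qed (use x in \<open>simp add: g_def\<close>)
      have "(\<lambda>n. x * (1 / of_int R) ^ n) \<longlonglongrightarrow> x * 0"
        using R by (intro tendsto_intros LIMSEQ_power_zero) simp
      then have "g \<longlonglongrightarrow> 0" by (simp add: power_divide g_def[abs_def])
      then have "0 \<in> M" using closed_sequentially[OF M(1), of g 0] gM by blast
      then show False using M(3) by simp
    qed
    then obtain k where k: "mask B (g (Suc k)) = 0" by blast
    have gr: "\<bar>g n\<bar> \<le> r / of_int R ^ n" for n
      using x M(2) R by (auto simp: g_def abs_le_iff intro!: divide_right_mono)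
    have "\<delta> \<le> \<bar>g (Suc k)\<bar>" using \<delta>(2) k by force
    with gr have "\<delta> \<le> r / of_int R ^ Suc k" by (rule order_trans[rotated])
    then have "of_int R ^ Suc k \<le> r / \<delta>"
      using R \<delta> by (simp add: field_simps)
    with k0 have "of_int R ^ Suc k < (of_int R ^ k0 :: real)" by linarith
    then have "Suc k \<le> k0"
      using R by (intro less_imp_le power_less_imp_less_exp[of "of_int R :: real"]) auto
    moreover have "g (Suc k) \<in> Z"
    proof -
      have "r \<ge> 0" using x M(2) by auto
      then have "r / of_int R ^ Suc k \<le> r"
        using divide_left_mono[of 1 "of_int R ^ Suc k" r] one_le_power[of "real_of_int R" "Suc k"] R
        by (simp del: power_Suc)
      then show ?thesis using gr[of "Suc k"] k by (auto simp: Z_def abs_le_iff)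
    qed
    moreover have "x = of_int R ^ Suc k * g (Suc k)"
      using R by (simp add: g_def)
    ultimately show "x \<in> (\<Union>k\<le>k0. (\<lambda>z. of_int R ^ k * z) ` Z)" by blast
  qed
  then show ?thesis using Z by (meson finite_UN_I finite_atMost finite_imageI finite_subset)
qed

text \<open>Modulo 1 every point has the unique predecessor \<open>R x\<close>.  So in a finite set stable under the moves
  of positive weight, counting leaves exactly one move at each point, of weight 1.\<close>

lemma invariant_set_unique_digit:
  assumes h: "hadamard_pair R B L" and M: "finite M"
    and inv: "\<And>x l. x \<in> M \<Longrightarrow> l \<in> L \<Longrightarrow> mask B ((x + of_int l) / of_int R) \<noteq> 0
      \<Longrightarrow> (x + of_int l) / of_int R \<in> M"
    and x: "x \<in> M"
  shows "\<exists>l\<in>L. (x + of_int l) / of_int R \<in> M \<and> cmod (mask B ((x + of_int l) / of_int R)) = 1"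
proof -
  note R = hadamard_pair_R[OF h] and fin = hadamard_pair_finite[OF h]
  define W where "W x l = (cmod (mask B ((x + of_int l) / of_int R)))\<^sup>2" for x l
  have W1: "(\<Sum>l\<in>L. W x l) = 1" for x unfolding W_def by (rule hadamard_pair_sum_mask[OF h])
  have "\<exists>l\<in>L. W x l \<noteq> 0" for x
    using W1[of x] by (metis sum.neutral zero_neq_one)
  then obtain s where s: "\<And>x. s x \<in> L" "\<And>x. W x (s x) \<noteq> 0" by metis
  have uniq: "l = s x" if l: "l \<in> L" "W x l \<noteq> 0" for l
  proof -
    \<comment> \<open>A representative for each class modulo 1, arranged so that the class of
      \<open>x\<close> is represented by \<open>x\<close> itself.\<close>
    define rep where "rep \<xi> = (if \<xi> = frac x then x else (SOME y. y \<in> M \<and> frac y = \<xi>))" for \<xi>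
    have rep: "rep \<xi> \<in> M" "frac (rep \<xi>) = \<xi>" if "\<xi> \<in> frac ` M" for \<xi>
    proof -
      have "\<exists>y. y \<in> M \<and> frac y = \<xi>" using that by auto
      then have "(SOME y. y \<in> M \<and> frac y = \<xi>) \<in> M \<and> frac (SOME y. y \<in> M \<and> frac y = \<xi>) = \<xi>"
        by (rule someI_ex)
      then show "rep \<xi> \<in> M" "frac (rep \<xi>) = \<xi>" using x by (auto simp: rep_def)
    qed
    define u where "u \<xi> = frac ((rep \<xi> + of_int (s (rep \<xi>))) / of_int R)" for \<xi>
    have frac_eq: "v - w = of_int (\<lfloor>v\<rfloor> - \<lfloor>w\<rfloor>)" if "frac v = frac w" for v w :: real
      using that by (simp add: frac_def)
    \<comment> \<open>Multiplication by \<open>R\<close> recovers the class of the predecessor, and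
      then the digit is determined because digits are distinct modulo \<open>R\<close>.\<close>
    have key: "a = b \<and> k = m" if K: "a \<in> frac ` M" "b \<in> frac ` M" "k \<in> L" "m \<in> L"
      "frac ((rep a + of_int k) / of_int R) = frac ((rep b + of_int m) / of_int R)" for a b k m
    proof -
      obtain n :: int where "(rep a + of_int k) / of_int R - (rep b + of_int m) / of_int R = of_int n"
        using frac_eq[OF K(5)] by blast
      then have "((rep a + of_int k) - (rep b + of_int m)) / of_int R = of_int n"
        by (simp only: diff_divide_distrib)
      then have "(rep a + of_int k) - (rep b + of_int m) = of_int n * of_int R"
        using R by (subst (asm) nonzero_divide_eq_eq) auto
      then have n: "rep a - rep b = of_int (R * n + m - k)"
        by (simp add: mult.commute)
      then have "frac (rep a) = frac (rep b)"
        by (metis add.commute diff_add_cancel frac_add_of_int_right)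
      then have ab: "a = b" using rep K by simp
      then have "real_of_int (R * n + m - k) = 0" using n by simp
      then have "R * n + m - k = 0" by linarith
      then have "k - m = R * n" by linarith
      then have "R dvd k - m" by simp
      then show ?thesis using ab hadamard_pair_distinct_mod[OF h K(3,4)] by simp
    qed
    \<comment> \<open>Being injective on a finite set, \<open>u\<close> reaches every class. The
      class reached from \<open>x\<close> by the digit \<open>l\<close> is thus also reached by a
      chosen move, and \<open>key\<close> identifies the two moves.\<close>
    have "u ` (frac ` M) = frac ` M"
    proof (rule endo_inj_surj)
      show "finite (frac ` M)" using M by simp
      show "u ` frac ` M \<subseteq> frac ` M"
      proof (intro image_subsetI)
        fix \<xi> assume \<xi>: "\<xi> \<in> frac ` M"
        have "mask B ((rep \<xi> + of_int (s (rep \<xi>))) / of_int R) \<noteq> 0"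
          using s(2)[of "rep \<xi>"] unfolding W_def by simp
        from inv[OF rep(1)[OF \<xi>] s(1) this] show "u \<xi> \<in> frac ` M"
          unfolding u_def by (rule imageI)
      qed
      show "inj_on u (frac ` M)"
        unfolding inj_on_def u_def using key[OF _ _ s(1) s(1)] by blast
    qed
    moreover have "frac ((x + of_int l) / of_int R) \<in> frac ` M"
      using inv[OF x l(1)] l(2) unfolding W_def by (intro imageI) simp
    ultimately obtain \<xi> where \<xi>: "\<xi> \<in> frac ` M" "frac ((x + of_int l) / of_int R) = u \<xi>"
      by (metis imageE)
    have rx: "rep (frac x) = x" by (simp add: rep_def)
    have "frac x = \<xi> \<and> l = s (rep \<xi>)"
      using \<xi> x unfolding u_def by (intro key l(1) s(1)) (simp_all only: rx imageI)
    then show ?thesis using rx by simp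
  qed
  have "(\<Sum>l\<in>L. W x l) = (\<Sum>l\<in>{s x}. W x l)"
    using uniq s fin by (intro sum.mono_neutral_right) auto
  then have "W x (s x) = 1" using W1 by simp
  then have "cmod (mask B ((x + of_int (s x)) / of_int R)) = 1"
    unfolding W_def by (simp add: power2_eq_1_iff) (metis norm_ge_zero not_one_le_zero neg_0_le_iff_le)
  moreover from this have "(x + of_int (s x)) / of_int R \<in> M"
    using inv[OF x s(1)[of x]] by force
  ultimately show ?thesis using s by blast
qed

lemma iterate_periodic:
  assumes "finite M" "x \<in> M" "s ` M \<subseteq> M"
  obtains y n where "y \<in> M" "n > 0" "(s ^^ n) y = y" "\<And>k. (s ^^ k) y \<in> M"
proof -
  have M: "(s ^^ k) y \<in> M" if "y \<in> M" for k y
    using that assms(3) by (induction k) auto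
  have "\<not> inj (\<lambda>k. (s ^^ k) x)"
    using finite_imageD[of "\<lambda>k. (s ^^ k) x" UNIV] M[OF assms(2)]
      finite_subset[OF _ assms(1), of "range (\<lambda>k. (s ^^ k) x)"] infinite_UNIV_nat by blast
  then obtain i j where "(s ^^ i) x = (s ^^ j) x" "i < j"
    unfolding inj_def by (metis linorder_neqE_nat)
  moreover have "(s ^^ (j - i)) ((s ^^ i) x) = (s ^^ (j - i + i)) x"
    by (simp only: funpow_add comp_apply)
  ultimately have "(s ^^ (j - i)) ((s ^^ i) x) = (s ^^ i) x" by simp
  then show ?thesis using that[of "(s ^^ i) x" "j - i"] M assms(2) \<open>i < j\<close> by auto
qed

text \<open>The move of weight 1 maps the finite set into itself, so some orbit is periodic.\<close>

lemma invariant_set_extreme_cycle: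
  assumes h: "hadamard_pair R B L" and M: "finite M" "M \<noteq> {}"
    and inv: "\<And>x l. x \<in> M \<Longrightarrow> l \<in> L \<Longrightarrow> mask B ((x + of_int l) / of_int R) \<noteq> 0
      \<Longrightarrow> (x + of_int l) / of_int R \<in> M"
  shows "\<exists>xs ls. is_extreme_cycle R B L xs ls \<and> set xs \<subseteq> M"
proof -
  have "\<forall>x\<in>M. \<exists>l. l \<in> L \<and> (x + of_int l) / of_int R \<in> M
      \<and> cmod (mask B ((x + of_int l) / of_int R)) = 1"
    using invariant_set_unique_digit[OF h M(1) inv] by blast
  then obtain l where l: "\<And>x. x \<in> M \<Longrightarrow> l x \<in> L"
    "\<And>x. x \<in> M \<Longrightarrow> (x + of_int (l x)) / of_int R \<in> M"
    "\<And>x. x \<in> M \<Longrightarrow> cmod (mask B ((x + of_int (l x)) / of_int R)) = 1"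
    by metis
  define s where "s x = (x + of_int (l x)) / of_int R" for x :: real
  have "s ` M \<subseteq> M" using l(2) by (auto simp: s_def)
  moreover obtain x where "x \<in> M" using M by auto
  ultimately obtain y n where y: "y \<in> M" "n > 0" "(s ^^ n) y = y" "\<And>k. (s ^^ k) y \<in> M"
    using iterate_periodic[OF M(1), of x s] by blast
  define xs where "xs = map (\<lambda>k. (s ^^ k) y) [0..<n]"
  define ls where "ls = map (\<lambda>k. l ((s ^^ k) y)) [0..<n]"
  have nth: "xs ! (Suc k mod length xs) = s ((s ^^ k) y)" if "k < n" for k
    using that y by (cases "Suc k = n") (auto simp: xs_def)
  have "is_cycle R L xs ls"
    unfolding is_cycle_def
  proof (intro conjI allI impI)
    show "xs \<noteq> []" "length ls = length xs" using y by (auto simp: xs_def ls_def)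
    show "set ls \<subseteq> L" using l(1) y(4) by (auto simp: ls_def)
    fix k assume "k < length xs"
    then have k: "k < n" by (simp add: xs_def)
    show "(xs ! k + of_int (ls ! k)) / of_int R = xs ! (Suc k mod length xs)"
      unfolding nth[OF k] using k by (simp add: xs_def ls_def s_def)
  qed
  moreover have "cmod (mask B z) = 1" if zx: "z \<in> set xs" for z
  proof -
    obtain k where k: "k < n" "z = (s ^^ k) y" using zx by (auto simp: xs_def)
    \<comment> \<open>Modulus 1 is known at images of moves, so each point is written as the image
      of its predecessor; that of the first point is the last one.\<close>
    obtain j where "z = s ((s ^^ j) y)"
    proof (cases k)
      case 0
      then have "z = s ((s ^^ (n - 1)) y)" using k y by (cases n) auto
      then show ?thesis by (rule that)
    qed (use that k in auto)
    then show ?thesis using l(3)[OF y(4)] by (simp add: s_def)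
  qed
  ultimately have "is_extreme_cycle R B L xs ls" by (simp add: is_extreme_cycle_def)
  moreover have "set xs \<subseteq> M" using y by (auto simp: xs_def)
  ultimately show ?thesis by blast
qed

text \<open>Negation turns the cycle relation into a division step in base \<open>R\<close>. The
  floor merely casts integral reals to integers, and reducing \<open>k\<close> modulo the length
  unrolls the cycle into an infinite expansion.\<close>

lemma integer_cycle_step:
  assumes c: "is_cycle R L xs ls" and int: "set xs \<subseteq> \<int>" and R: "R \<noteq> 0"
  shows "- \<lfloor>xs ! (k mod length xs)\<rfloor>
      = R * - \<lfloor>xs ! (Suc k mod length xs)\<rfloor> + ls ! (k mod length xs)"
    and "ls ! (k mod length xs) \<in> L"
proof -
  define n where "n = length xs"
  have n: "n > 0" "length ls = n" using c by (auto simp: n_def is_cycle_def)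
  define z where "z j = \<lfloor>xs ! (j mod n)\<rfloor>" for j
  have z: "xs ! (j mod n) = of_int (z j)" for j
    using int n by (auto simp: z_def n_def subset_iff)
  have "(xs ! (k mod n) + of_int (ls ! (k mod n))) / of_int R = xs ! (Suc (k mod n) mod n)"
    using c n unfolding is_cycle_def n_def by simp
  also have "Suc (k mod n) mod n = Suc k mod n" by (simp add: mod_Suc_eq)
  finally have "(real_of_int (z k) + of_int (ls ! (k mod n))) / of_int R = of_int (z (Suc k))"
    unfolding z .
  then have "real_of_int (z k) + of_int (ls ! (k mod n)) = of_int R * of_int (z (Suc k))"
    using R by (simp add: field_simps)
  then have "z k + ls ! (k mod n) = R * z (Suc k)" by (metis of_int_add of_int_eq_iff of_int_mult)
  then show "- \<lfloor>xs ! (k mod length xs)\<rfloor>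
      = R * - \<lfloor>xs ! (Suc k mod length xs)\<rfloor> + ls ! (k mod length xs)"
    by (simp add: z_def n_def)
  show "ls ! (k mod length xs) \<in> L"
    using c n unfolding is_cycle_def n_def by (auto simp: subset_iff)
qed

lemma integer_cycle_representable:
  assumes c: "is_cycle R L xs ls" and int: "set xs \<subseteq> \<int>" and R: "R \<noteq> 0"
    and k: "k < length xs" and x: "xs ! k = of_int x"
  shows "- x \<in> representable R L"
  unfolding representable_def
proof (rule CollectI, rule exI[of _ "\<lambda>j. - \<lfloor>xs ! ((k + j) mod length xs)\<rfloor>"],
    rule exI[of _ "\<lambda>j. ls ! ((k + j) mod length xs)"], intro conjI allI)
  show "- \<lfloor>xs ! ((k + 0) mod length xs)\<rfloor> = - x" using k x by simp
  show "ls ! ((k + j) mod length xs) \<in> L" for j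
    by (rule integer_cycle_step(2)[OF c int R])
  show "- \<lfloor>xs ! ((k + j) mod length xs)\<rfloor>
      = R * - \<lfloor>xs ! ((k + Suc j) mod length xs)\<rfloor> + ls ! ((k + j) mod length xs)" for j
    using integer_cycle_step(1)[OF c int R, of "k + j"] by simp
qed

subsection \<open>Spectra of self-similar measures\<close>

lemma isCont_fourier: "real_distribution M \<Longrightarrow> isCont (fourier M) t"
  unfolding fourier_eq_char[abs_def]
  by (intro isCont_o2[of t "\<lambda>t. 2 * pi * t" "char M"] real_distribution.isCont_char continuous_intros)

theorem representable_is_spectrum:
  assumes h: "hadamard_pair R B L"
    and cycles: "\<And>xs ls. is_extreme_cycle R B L xs ls \<Longrightarrow> set xs \<subseteq> \<int>"
  shows "is_spectrum (invariant_measure R B) (real_of_int ` representable R L)"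
proof -
  note R = hadamard_pair_R[OF h] and fin = hadamard_pair_finite[OF h]
    and ne = hadamard_pair_nonempty[OF h] and L0 = hadamard_pair_0(2)[OF h]
  define \<mu> where "\<mu> = invariant_measure R B"
  have ss: "self_similar R B \<mu>"
    unfolding \<mu>_def by (rule self_similar_invariant_measure[OF R fin(1) ne(1)])
  interpret real_distribution \<mu> by (rule self_similar_real_distribution[OF ss])
  define f where "f = fourier \<mu>"
  define \<Lambda> where "\<Lambda> = representable R L"
  have f_eq: "f t = mask B (t / of_int R) * f (t / of_int R)" for t
    unfolding f_def by (rule self_similar_fourier[OF ss fin(1) ne(1)])
  have f0: "f 0 = 1"
    unfolding f_def by (rule fourier_0) (rule real_distribution_axioms)
  have orth: "f (of_int (x - y)) = 0" if "x \<in> \<Lambda>" "y \<in> \<Lambda>" "x \<noteq> y" for x y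
    using representable_orthogonal[OF h f_eq] that unfolding \<Lambda>_def by blast
  have bessel: "(\<Sum>l\<in>F. (cmod (f (x + of_int l)))\<^sup>2) \<le> 1" if F: "finite F" "F \<subseteq> \<Lambda>" for F x
  proof -
    have "cmod (f (x + of_int l)) = cmod (f (- x - of_int l))" for l
      using fourier_minus[of \<mu> "x + of_int l"] by (simp add: f_def)
    then have "(\<Sum>l\<in>F. (cmod (f (x + of_int l)))\<^sup>2) = (\<Sum>t\<in>real_of_int ` F. (cmod (f (- x - t)))\<^sup>2)"
      by (subst sum.reindex) (auto simp: inj_on_def)
    also have "\<dots> \<le> 1"
      unfolding f_def using F orth[unfolded f_def]
      by (intro fourier_bessel) (auto simp: subset_iff simp flip: of_int_diff)
    finally show ?thesis .
  qed
  define h where "h x = infsum (\<lambda>l. (cmod (f (x + of_int l)))\<^sup>2) \<Lambda>" for x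
  have summ: "(\<lambda>l. (cmod (f (x + of_int l)))\<^sup>2) summable_on \<Lambda>" for x
    by (rule nonneg_bdd_above_summable_on) (use bessel in \<open>auto intro!: bdd_aboveI[of _ 1]\<close>)
  have h_ge: "(\<Sum>l\<in>F. (cmod (f (x + of_int l)))\<^sup>2) \<le> h x" if "finite F" "F \<subseteq> \<Lambda>" for F x
    unfolding h_def by (rule finite_sum_le_infsum[OF summ that]) auto
  have h_le: "h x \<le> a" if "\<And>F. finite F \<Longrightarrow> F \<subseteq> \<Lambda> \<Longrightarrow> (\<Sum>l\<in>F. (cmod (f (x + of_int l)))\<^sup>2) \<le> a"
    for x a unfolding h_def by (rule infsum_le_finite_sums[OF summ that])
  \<comment> \<open>The single term with index \<open>l\<close> is the squared modulus of the
    transform at 0.\<close>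
  have h_one: "1 \<le> h (of_int (- l))" if "l \<in> \<Lambda>" for l
    using h_ge[of "{l}" "of_int (- l)"] that by (simp add: f0)
  \<comment> \<open>Frequencies are grouped by last digit: by the functional equation the terms in
    \<open>S l\<close> add up to the weight times the value of \<open>h\<close> at the moved point.
    The sets \<open>S l\<close> are disjoint subsets of \<Lambda>.\<close>
  have ruelle: "(\<Sum>l\<in>L. (cmod (mask B ((x + of_int l) / of_int R)))\<^sup>2 * h ((x + of_int l) / of_int R)) \<le> h x" for x
  proof -
    define g where "g l = (cmod (f (x + of_int l)))\<^sup>2" for l :: int
    define S where "S l = (\<lambda>k. R * k + l) ` \<Lambda>" for l
    have S: "S l \<subseteq> \<Lambda>" if "l \<in> L" for l
      using representable_step[OF that] by (auto simp: S_def \<Lambda>_def)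
    have gs: "g summable_on \<Lambda>" using summ[of x] by (simp add: g_def[abs_def])
    have "(cmod (mask B ((x + of_int l) / of_int R)))\<^sup>2 * h ((x + of_int l) / of_int R) = infsum g (S l)" for l
    proof -
      have "g (R * k + l) = (cmod (mask B ((x + of_int l) / of_int R)))\<^sup>2
          * (cmod (f ((x + of_int l) / of_int R + of_int k)))\<^sup>2" for k
      proof -
        have "(x + of_int (R * k + l)) / of_int R = (x + of_int l) / of_int R + of_int k"
          using R by (simp add: field_simps)
        then have "f (x + of_int (R * k + l))
            = mask B ((x + of_int l) / of_int R) * f ((x + of_int l) / of_int R + of_int k)"
          by (subst f_eq) (simp only: mask_plus_int)
        then show ?thesis by (simp only: g_def norm_mult power_mult_distrib)
      qed
      then have "infsum (g \<circ> (\<lambda>k. R * k + l)) \<Lambda>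
        = (cmod (mask B ((x + of_int l) / of_int R)))\<^sup>2 * h ((x + of_int l) / of_int R)"
        by (simp add: o_def h_def infsum_cmult_right')
      moreover have "inj_on (\<lambda>k. R * k + l) \<Lambda>" using R by (auto simp: inj_on_def)
      ultimately show ?thesis by (simp add: S_def infsum_reindex)
    qed
    then have "(\<Sum>l\<in>L. (cmod (mask B ((x + of_int l) / of_int R)))\<^sup>2 * h ((x + of_int l) / of_int R))
        = (\<Sum>l\<in>L. infsum g (S l))" by simp
    also have "\<dots> = infsum g (\<Union>l\<in>L. S l)"
    proof (rule sum_infsum[OF fin(2)])
      show "g summable_on S l" if "l \<in> L" for l
        by (rule summable_on_subset_banach[OF gs S[OF that]])
      fix l m assume lm: "l \<in> L" "m \<in> L" "l \<noteq> m"
      show "S l \<inter> S m = {}"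
      proof (rule ccontr)
        assume "S l \<inter> S m \<noteq> {}"
        then obtain j k where "R * j + l = R * k + m" by (auto simp: S_def)
        then have "l - m = R * (k - j)" by (simp add: algebra_simps)
        then have "R dvd l - m" by simp
        then show False using hadamard_pair_distinct_mod[OF assms(1) lm(1,2)] lm(3) by simp
      qed
    qed
    also have "\<dots> \<le> infsum g \<Lambda>"
      using S gs by (intro infsum_mono_neutral summable_on_subset_banach[OF gs]) (auto simp: g_def)
    also have "\<dots> = h x" by (simp add: h_def g_def[abs_def])
    finally show ?thesis .
  qed
  have h1: "1 \<le> h x0" for x0
  proof (rule ccontr)
    assume x0: "\<not> 1 \<le> h x0"
    define b where "b = (\<Sum>l\<in>L. \<bar>real_of_int l\<bar>)"
    \<comment> \<open>Large enough to contain \<open>x0\<close> and to bound all digits, so that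
      \<open>\<bar>x + l\<bar> \<le> 2 * r \<le> R * r\<close> keeps the walk inside the
      interval.\<close>
    define r where "r = max \<bar>x0\<bar> b"
    define K where "K = {-r..r}"
    have K_inv: "(x + of_int l) / of_int R \<in> K" if "x \<in> K" "l \<in> L" for x l
    proof -
      have "\<bar>real_of_int l\<bar> \<le> b"
        using fin that member_le_sum[of l L "\<lambda>l. \<bar>real_of_int l\<bar>"] by (auto simp: b_def)
      then have "\<bar>x + of_int l\<bar> \<le> 2 * r" using that by (auto simp: r_def K_def)
      also have "\<dots> \<le> of_int R * r"
        using R that by (intro mult_right_mono) (auto simp: K_def)
      finally have "\<bar>(x + of_int l) / of_int R\<bar> \<le> r"
        using R by (simp add: pos_divide_le_eq mult.commute)
      then show ?thesis
        unfolding K_def atLeastAtMost_iff abs_le_iff by linarith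
    qed
    have x0K: "x0 \<in> K" by (auto simp: K_def r_def)
    define c where "c = Inf (h ` K)"
    have h_nonneg: "0 \<le> h x" for x using h_ge[of "{}" x] by simp
    have bdd: "bdd_below (h ` K)" by (rule bdd_belowI[of _ 0]) (use h_nonneg in auto)
    have c_le: "c \<le> h x" if "x \<in> K" for x
      unfolding c_def using bdd that by (intro cInf_lower) auto
    have c1: "c < 1" using c_le[OF x0K] x0 by simp
    \<comment> \<open>Lower semicontinuity: a sublevel set of a supremum is the intersection of the
      sublevel sets of the continuous finite sums.\<close>
    have clos: "closed {x. h x \<le> a}" for a
    proof -
      have "{x. h x \<le> a} = (\<Inter>F\<in>{F. finite F \<and> F \<subseteq> \<Lambda>}. {x. (\<Sum>l\<in>F. (cmod (f (x + of_int l)))\<^sup>2) \<le> a})"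
        using h_ge h_le by (auto intro: order_trans)
      moreover have "closed {x. (\<Sum>l\<in>F. (cmod (f (x + of_int l)))\<^sup>2) \<le> a}" for F
      proof (intro closed_Collect_le continuous_intros)
        have "continuous_on UNIV f"
          unfolding f_def using isCont_fourier[OF real_distribution_axioms]
          by (simp add: continuous_on_eq_continuous_at)
        then show "continuous_on UNIV (\<lambda>x. f (x + of_int l))" for l :: int
          by (rule continuous_on_compose2) (auto intro: continuous_intros)
      qed
      ultimately show ?thesis by auto
    qed
    define M where "M = K \<inter> {x. h x \<le> c}"
    have "closed M" unfolding M_def K_def by (intro closed_Int clos closed_real_atLeastAtMost)
    have "M \<noteq> {}"
    proof -
      \<comment> \<open>The infimum is attained because these nonempty compact sublevel sets are
        nested.\<close>
      define G where "G n = K \<inter> {x. h x \<le> c + 1 / real (Suc n)}" for n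
      have "\<Inter> (range G) \<noteq> {}"
      proof (rule compact_nest)
        show "compact (G n)" for n
          unfolding G_def K_def by (intro compact_Int_closed clos) simp
        show "G n \<noteq> {}" for n
        proof -
          have "\<exists>y\<in>h ` K. y < c + 1 / real (Suc n)"
            using cInf_lessD[of "h ` K" "c + 1 / real (Suc n)"] x0K unfolding c_def by auto
          then show ?thesis by (force simp: G_def)
        qed
        show "G n \<subseteq> G m" if "m \<le> n" for m n
        proof -
          have "1 / real (Suc n) \<le> 1 / real (Suc m)" using that by (intro divide_left_mono) auto
          then show ?thesis by (auto simp: G_def)
        qed
      qed
      then obtain x where x: "\<And>n. x \<in> G n" by auto
      have "(\<lambda>n. c + 1 / real (Suc n)) \<longlonglongrightarrow> c + 0"
        by (intro tendsto_intros LIMSEQ_inverse_real_of_nat[unfolded inverse_eq_divide])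
      then have "h x \<le> c + 0"
        by (rule tendsto_lowerbound) (use x in \<open>auto simp: G_def\<close>)
      then show ?thesis using x[of 0] by (auto simp: M_def G_def)
    qed
    have M_inv: "(x + of_int l) / of_int R \<in> M"
      if x: "x \<in> M" and l: "l \<in> L" and nz: "mask B ((x + of_int l) / of_int R) \<noteq> 0" for x l
    proof -
      define W where "W l = (cmod (mask B ((x + of_int l) / of_int R)))\<^sup>2" for l
      define H where "H l = h ((x + of_int l) / of_int R)" for l
      have H: "c \<le> H l" if "l \<in> L" for l
        unfolding H_def using K_inv x that by (intro c_le) (auto simp: M_def)
      have W1: "(\<Sum>l\<in>L. W l) = 1"
        unfolding W_def by (rule hadamard_pair_sum_mask[OF assms(1)])
      \<comment> \<open>Minimum principle: the mean of the nonnegative excesses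
        \<open>H l - c\<close> is at most 0, so each excess with positive weight vanishes.\<close>
      have "(\<Sum>l\<in>L. W l * (H l - c)) = (\<Sum>l\<in>L. W l * H l) - c * (\<Sum>l\<in>L. W l)"
        by (simp add: right_diff_distrib sum_subtractf sum_distrib_left mult.commute)
      also have "\<dots> \<le> 0"
        using ruelle[of x] x W1 by (simp add: W_def H_def M_def)
      finally have "(\<Sum>l\<in>L. W l * (H l - c)) \<le> 0" .
      moreover have nn: "0 \<le> W l * (H l - c)" if "l \<in> L" for l
        using H[OF that] by (simp add: W_def)
      ultimately have "(\<Sum>l\<in>L. W l * (H l - c)) = 0"
        using sum_nonneg[of L "\<lambda>l. W l * (H l - c)"] by force
      then have "W l * (H l - c) = 0"
        using sum_nonneg_eq_0_iff[of L "\<lambda>l. W l * (H l - c)"] nn fin(2) l by simp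
      then have "H l = c" using nz by (simp add: W_def)
      then show ?thesis using K_inv x l by (auto simp: M_def H_def)
    qed
    have "0 \<notin> M" using h_one[of 0] zero_representable[OF L0] c1 by (auto simp: M_def \<Lambda>_def)
    then have "finite M"
      using invariant_set_finite[OF assms(1) \<open>closed M\<close> _ _ M_inv, of r] by (auto simp: M_def K_def)
    then obtain xs ls where xs: "is_extreme_cycle R B L xs ls" "set xs \<subseteq> M"
      using invariant_set_extreme_cycle[OF assms(1) _ \<open>M \<noteq> {}\<close> M_inv] by blast
    have cyc: "is_cycle R L xs ls" using xs by (simp add: is_extreme_cycle_def)
    then have n: "0 < length xs" by (simp add: is_cycle_def)
    then have "xs ! 0 \<in> \<int>" using cycles[OF xs(1)] nth_mem by blast
    then obtain x where x: "xs ! 0 = of_int x" by (rule Ints_cases)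
    have "- x \<in> \<Lambda>"
      unfolding \<Lambda>_def using cyc cycles[OF xs(1)] R n x by (intro integer_cycle_representable) auto
    from h_one[OF this] have "1 \<le> h (xs ! 0)" by (simp add: x)
    moreover have "xs ! 0 \<in> M" using xs(2) n nth_mem by blast
    ultimately show False using c1 by (auto simp: M_def)
  qed
  obtain C where C: "AE x in \<mu>. \<bar>x\<bar> \<le> C"
    unfolding \<mu>_def using invariant_measure_bounded[OF R fin(1) ne(1)] by blast
  have "is_spectrum \<mu> (real_of_int ` \<Lambda>)"
  proof (rule is_spectrumI[OF C])
    show "fourier \<mu> (s - t) = 0" if "s \<in> real_of_int ` \<Lambda>" "t \<in> real_of_int ` \<Lambda>" "s \<noteq> t" for s t
      using that orth by (auto simp: f_def simp flip: of_int_diff)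
    fix u \<delta> :: real assume \<delta>: "\<delta> > 0"
    have "\<exists>F. finite F \<and> F \<subseteq> \<Lambda> \<and> (\<Sum>l\<in>F. (cmod (f (- u + of_int l)))\<^sup>2) > 1 - \<delta>"
    proof (rule ccontr)
      assume "\<not> ?thesis"
      then have "h (- u) \<le> 1 - \<delta>" by (intro h_le) (auto simp: not_less)
      then show False using h1[of "- u"] \<delta> by simp
    qed
    then obtain F where F: "finite F" "F \<subseteq> \<Lambda>" "(\<Sum>l\<in>F. (cmod (f (- u + of_int l)))\<^sup>2) > 1 - \<delta>"
      by blast
    have "cmod (f (- u + of_int l)) = cmod (fourier \<mu> (u - of_int l))" for l
      using fourier_minus[of \<mu> "u - of_int l"] by (simp add: f_def)
    then have "(\<Sum>t\<in>real_of_int ` F. (cmod (fourier \<mu> (u - t)))\<^sup>2) > 1 - \<delta>"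
      using F(3) by (subst sum.reindex) (auto simp: inj_on_def)
    then show "\<exists>F. finite F \<and> F \<subseteq> real_of_int ` \<Lambda> \<and> (\<Sum>t\<in>F. (cmod (fourier \<mu> (u - t)))\<^sup>2) > 1 - \<delta>"
      using F by (intro exI[of _ "real_of_int ` F"]) auto
  qed
  then show ?thesis by (simp add: \<mu>_def \<Lambda>_def)
qed

subsection \<open>Translation tilings\<close>

text \<open>The exponentials with integer frequencies have period 1.  If \<open>A\<close> and \<open>A - n\<close> are disjoint
  subsets of \<open>X\<close>, no such function is close to 1 on \<open>A\<close> and close to 0 on \<open>A - n\<close>.\<close>

lemma spectrum_Ints_packing_aux:
  fixes n :: int
  assumes X: "X \<in> fmeasurable lborel" "measure lborel X > 0"
    and sp: "is_spectrum (uniform_measure lborel X) \<int>"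
    and A: "A \<in> sets borel" "A \<subseteq> X" "(\<lambda>x. x + of_int n) -` A \<subseteq> X"
      "A \<inter> (\<lambda>x. x + of_int n) -` A = {}"
  shows "A \<in> null_sets lborel"
proof (rule ccontr)
  define \<nu> where "\<nu> = uniform_measure lborel X"
  have [measurable]: "A \<in> sets borel" "X \<in> sets borel" using A X by auto
  have eX: "emeasure lborel X = ennreal (measure lborel X)"
    using X(1) by (rule emeasure_eq_measure2)
  have sets_\<nu>[measurable_cong]: "sets \<nu> = sets borel" by (simp add: \<nu>_def)
  interpret \<nu>: finite_measure \<nu> using sp by (simp add: is_spectrum_def \<nu>_def)
  have Afin: "A \<in> fmeasurable lborel" using A X by (intro fmeasurableI2[OF X(1)]) auto
  define a where "a = measure lborel A"
  have eA: "emeasure lborel A = ennreal a"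
    unfolding a_def using Afin by (rule emeasure_eq_measure2)
  assume "A \<notin> null_sets lborel"
  then have a: "a > 0"
    using eA by (auto simp: null_sets_def a_def zero_less_measure_iff)
  define m where "m = measure lborel X"
  \<comment> \<open>Chosen so that the squared error before normalisation stays below
    \<open>m * \<epsilon>\<^sup>2 = a / 2\<close>, the lower bound derived below.\<close>
  define \<epsilon> where "\<epsilon> = sqrt (a / (2 * m))"
  have m: "m > 0" using X by (simp add: m_def)
  have \<epsilon>: "\<epsilon> > 0" "\<epsilon>\<^sup>2 = a / (2 * m)" using a m by (auto simp: \<epsilon>_def)
  have L2A: "L2_fun \<nu> (indicator A)"
    by (rule \<nu>.L2_fun_bounded[where C = 1]) (auto simp: indicator_def)
  then obtain F c where F: "finite F" "F \<subseteq> \<int>"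
    "L2_norm_of \<nu> (\<lambda>x. indicator A x - (\<Sum>t\<in>F. c t * cis (2 * pi * t * x))) < \<epsilon>"
    using sp \<epsilon>(1) unfolding is_spectrum_def orthogonal_basis_L2_def \<nu>_def by meson
  define P where "P x = (\<Sum>t\<in>F. c t * cis (2 * pi * t * x))" for x
  have [measurable]: "P \<in> borel_measurable borel" unfolding P_def by measurable
  have P_per: "P (x + of_int n) = P x" for x
  proof -
    have "cis (2 * pi * t * (x + of_int n)) = cis (2 * pi * t * x)" if t: "t \<in> F" for t
    proof -
      obtain k where k: "t = of_int k" using F(2) t by (auto elim: Ints_cases)
      have "cis (2 * pi * t * (x + of_int n)) = cis (2 * pi * t * x) * cis (2 * pi * of_int (k * n))"
        unfolding cis_mult k by (rule arg_cong[where f = cis]) (simp add: algebra_simps)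
      then show ?thesis by (simp only: cis_multiple_2pi Ints_of_int mult_1_right)
    qed
    then show ?thesis by (simp add: P_def)
  qed
  define q where "q x = (cmod (indicator A x - P x))\<^sup>2" for x
  have [measurable]: "q \<in> borel_measurable borel" unfolding q_def by measurable
  have q0: "0 \<le> q x" for x by (simp add: q_def)
  have L2P: "L2_fun \<nu> (\<lambda>x. indicator A x - P x)"
  proof -
    have "L2_fun \<nu> P"
      unfolding P_def by (intro L2_fun_sum L2_fun_cmult \<nu>.L2_fun_bounded[where C = 1]) auto
    with L2A show ?thesis by (rule L2_fun_diff)
  qed
  then have "(LINT x|\<nu>. q x) < \<epsilon>\<^sup>2"
    using F(3) \<epsilon>(1) real_sqrt_less_iff unfolding L2_norm_of_def P_def[symmetric] q_def[symmetric]
    by (metis abs_of_pos real_sqrt_abs)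
  moreover have "integrable \<nu> q" using L2P by (simp add: L2_fun_def q_def[abs_def])
  ultimately have "(\<integral>\<^sup>+x. ennreal (q x) \<partial>\<nu>) < ennreal (\<epsilon>\<^sup>2)"
    using q0 \<epsilon>(1) by (subst nn_integral_eq_integral) (auto simp: ennreal_less_iff intro!: Bochner_Integration.integral_nonneg)
  moreover have "(\<integral>\<^sup>+x. ennreal (q x) \<partial>\<nu>) = (\<integral>\<^sup>+x. ennreal (q x) * indicator X x \<partial>lborel) / ennreal m"
    unfolding \<nu>_def m_def by (subst nn_integral_uniform_measure) (auto simp: eX)
  moreover have "ennreal (a / 2) \<le> (\<integral>\<^sup>+x. ennreal (q x) * indicator X x \<partial>lborel)"
  proof -
    \<comment> \<open>The error on the translate of \<open>A\<close>, where the target function is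
      0, carried back to \<open>A\<close> by periodicity of \<open>P\<close>.\<close>
    define p where "p x = ennreal ((cmod (P x))\<^sup>2) * indicator A x" for x
    have [measurable]: "p \<in> borel_measurable borel" unfolding p_def by measurable
    have "ennreal (a / 2) = (\<integral>\<^sup>+x. ennreal (1 / 2) * indicator A x \<partial>lborel)"
    proof -
      have "ennreal (a / 2) = ennreal (1 / 2 * a)" by simp
      also have "\<dots> = ennreal (1 / 2) * ennreal a" using a by (intro ennreal_mult) auto
      also have "\<dots> = ennreal (1 / 2) * emeasure lborel A" by (simp only: eA)
      also have "\<dots> = (\<integral>\<^sup>+x. ennreal (1 / 2) * indicator A x \<partial>lborel)"
        by (rule nn_integral_cmult_indicator[symmetric]) simp
      finally show ?thesis .
    qed
    also have "\<dots> \<le> (\<integral>\<^sup>+x. ennreal (q x) * indicator A x + p x \<partial>lborel)"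
    proof (intro nn_integral_mono)
      fix x :: real
      \<comment> \<open>The same value \<open>P x\<close> has to approximate 1 and 0.\<close>
      have half: "1 / 2 \<le> (cmod (1 - P x))\<^sup>2 + (cmod (P x))\<^sup>2"
      proof -
        have "1 \<le> cmod (1 - P x) + cmod (P x)"
          using norm_triangle_ineq[of "1 - P x" "P x"] by simp
        then have "1\<^sup>2 \<le> (cmod (1 - P x) + cmod (P x))\<^sup>2" by (intro power_mono) auto
        then show ?thesis
          using sum_squares_bound[of "cmod (1 - P x)" "cmod (P x)"] by (simp add: power2_sum)
      qed
      show "ennreal (1 / 2) * indicator A x \<le> ennreal (q x) * indicator A x + p x"
      proof (cases "x \<in> A")
        case True
        have "ennreal (1 / 2) \<le> ennreal ((cmod (1 - P x))\<^sup>2 + (cmod (P x))\<^sup>2)"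
          by (rule ennreal_leI[OF half])
        also have "\<dots> = ennreal ((cmod (1 - P x))\<^sup>2) + ennreal ((cmod (P x))\<^sup>2)"
          by (rule ennreal_plus) auto
        finally show ?thesis using True by (simp only: q_def p_def indicator_simps mult_1_right)
      qed simp
    qed
    also have "\<dots> = (\<integral>\<^sup>+x. ennreal (q x) * indicator A x \<partial>lborel) + (\<integral>\<^sup>+x. p x \<partial>lborel)"
      by (intro nn_integral_add) auto
    also have "(\<integral>\<^sup>+x. p x \<partial>lborel) = (\<integral>\<^sup>+x. p (of_int n + 1 * x) \<partial>lborel)"
      by (subst nn_integral_real_affine[where c = 1 and t = "of_int n"]) auto
    also have "(\<integral>\<^sup>+x. ennreal (q x) * indicator A x \<partial>lborel) + (\<integral>\<^sup>+x. p (of_int n + 1 * x) \<partial>lborel)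
      = (\<integral>\<^sup>+x. ennreal (q x) * indicator A x + p (of_int n + 1 * x) \<partial>lborel)"
      by (intro nn_integral_add[symmetric]) auto
    also have "\<dots> \<le> (\<integral>\<^sup>+x. ennreal (q x) * indicator X x \<partial>lborel)"
    proof (intro nn_integral_mono)
      fix x :: real
      show "ennreal (q x) * indicator A x + p (of_int n + 1 * x) \<le> ennreal (q x) * indicator X x"
      proof (cases "x + of_int n \<in> A")
        case True
        then have "x \<notin> A" "x \<in> X" using A by auto
        then show ?thesis using True P_per[of x] by (simp add: p_def q_def add.commute)
      next
        case False
        then show ?thesis using A(2) by (auto simp: p_def add.commute indicator_def)
      qed
    qed
    finally show ?thesis .
  qed
  ultimately have "ennreal (a / 2) / ennreal m < ennreal (\<epsilon>\<^sup>2)"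
    by (metis divide_right_mono_ennreal order_le_less_trans)
  then show False
    using m a by (simp add: \<epsilon> divide_ennreal)
qed

text \<open>The overlap is cut into pieces of length 1/2, each of which is moved off itself by a
  nonzero integer shift.\<close>

lemma spectrum_Ints_packing:
  fixes n :: int
  assumes X: "X \<in> fmeasurable lborel" "measure lborel X > 0"
    and sp: "is_spectrum (uniform_measure lborel X) \<int>" and n: "n \<noteq> 0"
  shows "X \<inter> (\<lambda>x. x - of_int n) -` X \<in> null_sets lborel"
proof -
  define C where "C = X \<inter> (\<lambda>x. x - of_int n) -` X"
  have [measurable]: "X \<in> sets borel" using X by auto
  have C: "C \<in> sets borel"
    unfolding C_def using measurable_sets[of "\<lambda>x. x - of_int n" borel borel X] by simp
  have "C \<inter> {of_int j / 2..<(of_int j + 1) / 2} \<in> null_sets lborel" for j :: int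
  proof (rule spectrum_Ints_packing_aux[OF X sp])
    show "C \<inter> {of_int j / 2..<(of_int j + 1) / 2} \<in> sets borel" using C by simp
    show "C \<inter> {of_int j / 2..<(of_int j + 1) / 2} \<subseteq> X" by (auto simp: C_def)
    show "(\<lambda>x. x + of_int n) -` (C \<inter> {of_int j / 2..<(of_int j + 1) / 2}) \<subseteq> X"
      by (auto simp: C_def)
    have "\<bar>real_of_int n\<bar> \<ge> 1" using n by (simp flip: of_int_abs)
    then show "C \<inter> {of_int j / 2..<(of_int j + 1) / 2}
      \<inter> (\<lambda>x. x + of_int n) -` (C \<inter> {of_int j / 2..<(of_int j + 1) / 2}) = {}"
      by (auto simp: abs_if split: if_splits)
  qed
  then have "(\<Union>j::int. C \<inter> {of_int j / 2..<(of_int j + 1) / 2}) \<in> null_sets lborel"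
    by (rule null_sets_UN)
  moreover have "(\<Union>j::int. C \<inter> {of_int j / 2..<(of_int j + 1) / 2}) = C"
  proof -
    have "x \<in> {of_int \<lfloor>2 * x\<rfloor> / 2..<(of_int \<lfloor>2 * x\<rfloor> + 1) / 2}" for x :: real
      by (auto simp: field_simps) linarith+
    then show ?thesis by blast
  qed
  ultimately show ?thesis by (simp add: C_def)
qed

text \<open>The set \<open>X\<close> is cut along unit cells and the pieces are moved into
  \<open>{0..<1}\<close>. Covering makes them fill this interval, packing makes their overlaps null,
  and comparing the sums of the measures gives total measure 1.\<close>

lemma tiling:
  assumes X: "compact X"
    and pack: "\<And>n::int. n \<noteq> 0 \<Longrightarrow> X \<inter> (\<lambda>x. x - of_int n) -` X \<in> null_sets lborel"
    and cover: "\<And>x. \<exists>n::int. x - of_int n \<in> X"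
  shows "measure lborel X = 1" and "translation_congruent X {0..1}"
proof -
  have Xb[measurable]: "X \<in> sets borel" using X by (rule borel_compact)
  define A where "A n = {x \<in> {0..<1}. x + of_int n \<in> X}" for n :: int
  have A: "A n \<in> sets borel" for n
  proof -
    have "{0..<1} \<inter> (\<lambda>x. x + real_of_int n) -` X \<in> sets borel"
      using measurable_sets[of "\<lambda>x. x + of_int n" borel borel X] by simp
    then show ?thesis by (simp add: A_def Int_def vimage_def)
  qed
  have An: "A m \<inter> A n \<in> null_sets lborel" if "m \<noteq> n" for m n
  proof (rule null_sets_subset)
    show "{x. x - of_int (- m) \<in> X \<inter> (\<lambda>x. x - of_int (m - n)) -` X} \<in> null_sets lborel"
      using that by (intro null_sets_translation pack) auto
    show "A m \<inter> A n \<in> sets lborel" using A by simp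
    show "A m \<inter> A n \<subseteq> {x. x - of_int (- m) \<in> X \<inter> (\<lambda>x. x - of_int (m - n)) -` X}"
      by (auto simp: A_def algebra_simps)
  qed
  have UA: "(\<Union>n. A n) = {0..<1}"
  proof -
    have "\<exists>n::int. x + of_int n \<in> X" for x
    proof -
      obtain n :: int where "x - of_int n \<in> X" using cover by blast
      then show ?thesis by (intro exI[of _ "- n"]) simp
    qed
    then show ?thesis by (auto simp: A_def)
  qed
  have img: "(\<lambda>x. x + of_int n) ` A n = X \<inter> {of_int n..<of_int n + 1}" for n
  proof (intro set_eqI iffI)
    fix x assume "x \<in> X \<inter> {of_int n..<of_int n + 1}"
    then show "x \<in> (\<lambda>x. x + of_int n) ` A n"
      by (intro image_eqI[of _ _ "x - of_int n"]) (auto simp: A_def)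
  qed (auto simp: A_def)
  have imgU: "(\<Union>n::int. X \<inter> {of_int n..<of_int n + 1}) = X"
  proof -
    have "x \<in> {of_int \<lfloor>x\<rfloor>..<of_int \<lfloor>x\<rfloor> + 1}" for x :: real by auto
    then show ?thesis by blast
  qed
  have imgD: "X \<inter> {of_int m..<of_int m + 1} \<inter> (X \<inter> {of_int n..<of_int n + 1}) = {}"
    if "m \<noteq> n" for m n :: int
    using that by (auto; linarith)
  have "ae_partition A {0..1}"
    unfolding ae_partition_def
  proof (intro conjI allI impI)
    show "A n \<in> sets lebesgue" for n using A[of n] by simp
    show "A m \<inter> A n \<in> null_sets lebesgue" if "m \<noteq> n" for m n
      using An[OF that] by (rule null_sets_completionI)
    have "sym_diff {0..<1} {0..1::real} = {1}" by auto
    moreover have "{1::real} \<in> null_sets lebesgue" by (intro null_sets_completionI finite_imp_null_set_lborel) simp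
    ultimately show "sym_diff (\<Union>n. A n) {0..1} \<in> null_sets lebesgue"
      unfolding UA by (simp only:)
  qed
  moreover have "ae_partition (\<lambda>n. (\<lambda>x. x + of_int n) ` A n) X"
    unfolding ae_partition_def img using imgD imgU by auto
  ultimately show "translation_congruent X {0..1}"
    unfolding translation_congruent_def by blast
  obtain N :: nat where N: "X \<subseteq> {- real N..<real N}"
  proof -
    obtain b where b: "\<And>x. x \<in> X \<Longrightarrow> \<bar>x\<bar> \<le> b"
      using compact_imp_bounded[OF X] unfolding bounded_iff by auto
    obtain N :: nat where "b < real N" using reals_Archimedean2 by blast
    then have "X \<subseteq> {- real N..<real N}" using b by (force simp: abs_le_iff)
    then show ?thesis by (rule that)
  qed
  \<comment> \<open>Only finitely many cells meet the bounded set \<open>X\<close>, so finite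
    additivity suffices. The range includes every \<open>n\<close> with \<open>A n\<close>
    nonempty.\<close>
  define I where "I = {- int N - 1..int N}"
  have I: "n \<in> I" if "x \<in> A n" for n x
    using that N unfolding A_def I_def by (auto simp: subset_iff)
  have UI: "(\<Union>n\<in>I. A n) = {0..<1}" using UA I by blast
  have fin: "A n \<in> fmeasurable lborel" for n
  proof (rule fmeasurableI2)
    show "{0..1::real} \<in> fmeasurable lborel" by (rule fmeasurable_compact) simp
    show "A n \<subseteq> {0..1}" by (auto simp: A_def)
    show "A n \<in> sets lborel" using A by simp
  qed
  have "1 = measure lborel (\<Union>n\<in>I. A n)" unfolding UI by simp
  also have "\<dots> = (\<Sum>n\<in>I. measure lborel (A n))"
  proof (rule measure_UNION_AE)
    show "pairwise (\<lambda>i j. AE x in lborel. x \<notin> A i \<or> x \<notin> A j) I"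
      unfolding pairwise_def
    proof (intro ballI impI)
      fix i j :: int assume "i \<noteq> j"
      from AE_not_in[OF An[OF this]] show "AE x in lborel. x \<notin> A i \<or> x \<notin> A j" by simp
    qed
  qed (simp_all add: fin I_def)
  also have "\<dots> = (\<Sum>n\<in>I. measure lborel (X \<inter> {of_int n..<of_int n + 1}))"
  proof (intro sum.cong refl)
    fix n
    have "measure lebesgue ((\<lambda>x. x + of_int n) ` A n) = measure lebesgue (A n)"
      using measure_translation[of "of_int n" "A n"] by (simp add: add.commute)
    then show "measure lborel (A n) = measure lborel (X \<inter> {of_int n..<of_int n + 1})"
      unfolding img using A[of n] by (simp add: measure_completion)
  qed
  also have "\<dots> = measure lborel (\<Union>n\<in>I. X \<inter> {of_int n..<of_int n + 1})"
  proof (rule measure_UNION'[symmetric])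
    show "X \<inter> {of_int n..<of_int n + 1} \<in> fmeasurable lborel" for n :: int
      by (rule fmeasurableI2[OF fmeasurable_compact[OF X]]) auto
    show "pairwise (\<lambda>i j. disjnt (X \<inter> {real_of_int i..<of_int i + 1}) (X \<inter> {of_int j..<of_int j + 1})) I"
      unfolding pairwise_def disjnt_def by (intro ballI impI imgD)
  qed (simp add: I_def)
  also have "(\<Union>n\<in>I. X \<inter> {of_int n..<of_int n + 1}) = X"
  proof -
    have "\<lfloor>x\<rfloor> \<in> I" if "x \<in> X" for x
      using that by (intro I[of "x - of_int \<lfloor>x\<rfloor>"]) (simp add: A_def, linarith)
    moreover have "x \<in> {of_int \<lfloor>x\<rfloor>..<of_int \<lfloor>x\<rfloor> + 1}" for x :: real by simp
    ultimately show ?thesis by blast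
  qed
  finally show "measure lborel X = 1" ..
qed

subsection \<open>Complete residue systems\<close>

lemma complete_residues_dvd_imp_eq:
  assumes "complete_residues R D" "d \<in> D" "d' \<in> D" "R dvd d - d'"
  shows "d = d'"
  using assms unfolding complete_residues_def by (metis cong_iff_dvd_diff cong_refl)

lemma complete_residues_bij:
  assumes R: "R > 0" and D: "complete_residues R D"
  shows "bij_betw (\<lambda>d. d mod R) D {0..<R}"
  unfolding bij_betw_def
proof
  show "inj_on (\<lambda>d. d mod R) D"
    using complete_residues_dvd_imp_eq[OF D] by (auto simp: inj_on_def mod_eq_dvd_iff)
  show "(\<lambda>d. d mod R) ` D = {0..<R}"
  proof
    show "{0..<R} \<subseteq> (\<lambda>d. d mod R) ` D"
    proof
      fix x assume x: "x \<in> {0..<R}"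
      obtain d where "d \<in> D" "[x = d] (mod R)"
        using D unfolding complete_residues_def by blast
      then show "x \<in> (\<lambda>d. d mod R) ` D"
        using x by (auto simp: cong_def intro!: image_eqI[of _ _ d])
    qed
  qed (use R in auto)
qed

lemma complete_residues_card:
  assumes "R > 0" "complete_residues R D"
  shows "finite D" "int (card D) = R"
  using bij_betw_finite[OF complete_residues_bij[OF assms]]
    bij_betw_same_card[OF complete_residues_bij[OF assms]] assms by auto

text \<open>The summand depends only on \<open>d mod R\<close>, so \<open>D\<close> may be replaced
  by \<open>{0..<R}\<close>, where the sum is geometric.\<close>

lemma sum_roots_of_unity:
  assumes R: "R > 0" and D: "complete_residues R D"
  shows "(\<Sum>d\<in>D. cis (2 * pi * ((1 / of_int R) * of_int k) * of_int d))
    = (if R dvd k then of_int R else 0)"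
proof (cases "R dvd k")
  case True
  then obtain j where j: "k = R * j" by (rule dvdE)
  have "cis (2 * pi * ((1 / of_int R) * of_int k) * of_int d) = 1" for d
  proof -
    have "(1 / of_int R) * of_int k = real_of_int j" using R by (simp add: j)
    then have "2 * pi * ((1 / of_int R) * of_int k) * of_int d = 2 * pi * of_int (j * d)"
      by simp
    then show ?thesis by (simp only: cis_multiple_2pi Ints_of_int)
  qed
  then have "(\<Sum>d\<in>D. cis (2 * pi * ((1 / of_int R) * of_int k) * of_int d)) = of_int (int (card D))"
    by simp
  then show ?thesis using True complete_residues_card[OF R D] by simp
next
  case False
  define g where "g d = cis (2 * pi * ((1 / of_int R) * of_int k) * of_int d)" for d
  define w where "w = g 1"
  have g_mod: "g d = g (d mod R)" for d
  proof -
    have "g (a + R * b) = g a" for a b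
    proof -
      have "g (a + R * b) = g a * cis (2 * pi * of_int (k * b))"
        unfolding g_def cis_mult using R
        by (intro arg_cong[where f = cis]) (simp add: ring_distribs)
      then show ?thesis by (simp only: cis_multiple_2pi Ints_of_int mult_1_right)
    qed
    from this[of "d mod R" "d div R"] show ?thesis by simp
  qed
  have g_pow: "g (int n) = w ^ n" for n
    unfolding w_def g_def by (simp add: Complex.DeMoivre mult_ac)
  have "w \<noteq> 1"
  proof
    assume "w = 1"
    then have "cos (2 * pi * ((1 / of_int R) * of_int k)) = 1"
      by (simp add: w_def g_def complex_eq_iff)
    then obtain n :: int where "2 * pi * ((1 / of_int R) * of_int k) = of_int n * 2 * pi"
      unfolding cos_one_2pi_int by blast
    then have "2 * pi * ((1 / of_int R) * of_int k) = 2 * pi * of_int n"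
      by (simp only: mult_ac)
    then have "(1 / of_int R) * of_int k = real_of_int n"
      by (rule mult_left_cancel[THEN iffD1, rotated]) simp
    then have "real_of_int k = of_int (R * n)"
      using R by (simp add: divide_eq_eq mult.commute)
    then have "k = R * n" by linarith
    then show False using False by simp
  qed
  have "w ^ nat R = 1"
    using g_mod[of R] g_pow[of "nat R"] g_pow[of 0] R by simp
  have "(\<Sum>d\<in>D. g d) = (\<Sum>d\<in>D. g (d mod R))" using g_mod by simp
  also have "\<dots> = (\<Sum>d\<in>{0..<R}. g d)"
    by (rule sum.reindex_bij_betw[OF complete_residues_bij[OF R D]])
  also have "\<dots> = (\<Sum>n<nat R. g (int n))"
    by (rule sum.reindex_bij_witness[of _ int nat]) auto
  also have "\<dots> = (\<Sum>n<nat R. w ^ n)" by (simp add: g_pow)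
  also have "\<dots> = 0" using \<open>w \<noteq> 1\<close> \<open>w ^ nat R = 1\<close> by (simp add: geometric_sum)
  finally show ?thesis using False by (simp add: g_def)
qed

text \<open>The matrix is the discrete Fourier matrix of the integers modulo \<open>R\<close>, with
  rows and columns labelled by other representatives.\<close>

lemma hadamard_pair_complete_residues:
  assumes R: "R \<ge> 2" and D: "complete_residues R D" "0 \<in> D" and E: "complete_residues R E" "0 \<in> E"
  shows "hadamard_pair R D E"
proof -
  have R0: "R > 0" using R by simp
  note cD = complete_residues_card[OF R0 D(1)] and cE = complete_residues_card[OF R0 E(1)]
  have N: "of_nat (card D) = (of_int R :: complex)"
    unfolding cD(2)[symmetric] by simp
  have s: "complex_of_real (1 / sqrt (real (card D))) * complex_of_real (1 / sqrt (real (card D)))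
      = 1 / of_int R"
    unfolding of_real_mult[symmetric] N[symmetric] by (simp add: real_sqrt_mult_self)
  define U where "U b l = complex_of_real (1 / sqrt (real (card D)))
       * cis (2 * pi * (1 / of_int R) * of_int b * of_int l)" for b l
  have U1: "U b l * cnj (U b' l')
      = cis (2 * pi * (1 / of_int R) * (of_int (b * l) - of_int (b' * l'))) / of_int R" for b l b' l'
  proof -
    have "U b l * cnj (U b' l')
        = (complex_of_real (1 / sqrt (real (card D))) * complex_of_real (1 / sqrt (real (card D))))
        * (cis (2 * pi * (1 / of_int R) * of_int b * of_int l)
        * cnj (cis (2 * pi * (1 / of_int R) * of_int b' * of_int l')))"
      unfolding U_def complex_cnj_mult complex_cnj_complex_of_real by (simp only: mult_ac)
    also have "cis (2 * pi * (1 / of_int R) * of_int b * of_int l)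
        * cnj (cis (2 * pi * (1 / of_int R) * of_int b' * of_int l'))
        = cis (2 * pi * (1 / of_int R) * (of_int (b * l) - of_int (b' * l')))"
      unfolding cis_cnj cis_mult by (rule arg_cong[where f = cis])
        (simp add: right_diff_distrib mult.assoc)
    finally show ?thesis unfolding s by (simp only: times_divide_eq_left mult_1_left)
  qed
  have row: "(\<Sum>l\<in>E. U b l * cnj (U b' l)) = (if b = b' then 1 else 0)" if "b \<in> D" "b' \<in> D" for b b'
  proof -
    have e: "2 * pi * (1 / of_int R) * (of_int (b * l) - of_int (b' * l))
        = 2 * pi * ((1 / of_int R) * of_int (b - b')) * of_int l" for l
      by (simp add: algebra_simps)
    have "(\<Sum>l\<in>E. U b l * cnj (U b' l))
        = (\<Sum>l\<in>E. cis (2 * pi * ((1 / of_int R) * of_int (b - b')) * of_int l)) / of_int R"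
      unfolding U1 sum_divide_distrib by (simp only: e)
    then show ?thesis
      unfolding sum_roots_of_unity[OF R0 E(1)]
      using complete_residues_dvd_imp_eq[OF D(1) that] R by auto
  qed
  have col: "(\<Sum>b\<in>D. cnj (U b l) * U b l') = (if l = l' then 1 else 0)" if "l \<in> E" "l' \<in> E" for l l'
  proof -
    have e: "2 * pi * (1 / of_int R) * (of_int (b * l') - of_int (b * l))
        = 2 * pi * ((1 / of_int R) * of_int (l' - l)) * of_int b" for b
      by (simp add: algebra_simps)
    have "(\<Sum>b\<in>D. cnj (U b l) * U b l')
        = (\<Sum>b\<in>D. cis (2 * pi * ((1 / of_int R) * of_int (l' - l)) * of_int b)) / of_int R"
      unfolding mult.commute[of "cnj _"] U1 sum_divide_distrib by (simp only: e)
    then show ?thesis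
      unfolding sum_roots_of_unity[OF R0 D(1)]
      using complete_residues_dvd_imp_eq[OF E(1) that(2,1)] R by auto
  qed
  have "card D = card E" using cD cE by linarith
  then show ?thesis
    unfolding hadamard_pair_def unitary_on_def U_def[symmetric]
    using R D E cD cE row col by auto
qed

text \<open>The integers \<open>d\<close> with \<open>d * x\<close> integral are closed under
  integer combinations, so Bezout applies.\<close>

lemma Gcd_mult_Ints:
  assumes "finite D" "\<And>d. d \<in> D \<Longrightarrow> of_int d * x \<in> (\<int> :: real set)"
  shows "of_int (Gcd D) * x \<in> \<int>"
  using assms
proof (induction D rule: finite_induct)
  case (insert d D)
  obtain u v where uv: "u * d + v * Gcd D = gcd d (Gcd D)"
    using bezout_int by blast
  have "of_int d * x \<in> \<int>" "of_int (Gcd D) * x \<in> \<int>"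
    using insert.prems insert.IH by simp_all
  then have "of_int u * (of_int d * x) + of_int v * (of_int (Gcd D) * x) \<in> \<int>"
    using Ints_add Ints_mult Ints_of_int by metis
  also have "of_int u * (of_int d * x) + of_int v * (of_int (Gcd D) * x)
      = of_int (u * d + v * Gcd D) * x"
    by (simp add: algebra_simps)
  finally show ?case by (simp add: uv)
qed simp

text \<open>The equality case of the triangle inequality: all terms of \<open>mask D x\<close> agree with the one
  for \<open>0 \<in> D\<close>, which is 1.\<close>

lemma cmod_mask_eq_1_imp_Ints:
  assumes D: "finite D" "0 \<in> D" "Gcd D = 1" and x: "cmod (mask D x) = 1"
  shows "x \<in> \<int>"
proof -
  define N where "N = card D"
  have N: "N > 0" using D by (auto simp: N_def card_gt_0_iff)
  define u where "u = mask D x"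
  \<comment> \<open>Rotated by \<open>cnj u\<close>, the terms have mean 1. Their real parts are at
    most 1, so all of them equal 1.\<close>
  define v where "v d = cis (2 * pi * of_int d * x) * cnj u" for d
  have uu: "u * cnj u = 1" using x by (simp add: u_def complex_norm_square[symmetric])
  have v1: "cmod (v d) = 1" for d using x by (simp add: v_def norm_mult u_def)
  have "(\<Sum>d\<in>D. v d) = (\<Sum>d\<in>D. cis (2 * pi * of_int d * x)) * cnj u"
    by (simp only: v_def sum_distrib_right)
  also have "(\<Sum>d\<in>D. cis (2 * pi * of_int d * x)) = of_nat N * u"
    using N by (simp add: u_def mask_def N_def)
  finally have "(\<Sum>d\<in>D. v d) = of_nat N * (u * cnj u)" by (simp only: mult.assoc)
  then have "(\<Sum>d\<in>D. Re (v d)) = real N"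
    by (simp add: uu flip: Re_sum)
  then have "(\<Sum>d\<in>D. 1 - Re (v d)) = 0" by (simp add: sum_subtractf N_def)
  moreover have "0 \<le> 1 - Re (v d)" for d using complex_Re_le_cmod[of "v d"] v1 by simp
  ultimately have Re1: "Re (v d) = 1" if "d \<in> D" for d
    using sum_nonneg_eq_0_iff[of D "\<lambda>d. 1 - Re (v d)"] D(1) that by simp
  have veq: "v d = 1" if "d \<in> D" for d
  proof -
    have "(Re (v d))\<^sup>2 + (Im (v d))\<^sup>2 = 1" using v1[of d] by (simp add: cmod_def)
    then show ?thesis using Re1[OF that] by (simp add: complex_eq_iff)
  qed
  have "cnj u = 1" using veq[OF D(2)] by (simp add: v_def)
  then have "cis (2 * pi * of_int d * x) = 1" if "d \<in> D" for d
    using veq[OF that] by (simp add: v_def)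
  then have "of_int d * x \<in> \<int>" if "d \<in> D" for d
  proof -
    have "cos (2 * pi * of_int d * x) = 1"
      using \<open>\<And>d. d \<in> D \<Longrightarrow> cis (2 * pi * of_int d * x) = 1\<close>[OF that] by (simp add: complex_eq_iff)
    then obtain n :: int where "2 * pi * of_int d * x = of_int n * 2 * pi"
      unfolding cos_one_2pi_int by blast
    then have "of_int d * x = of_int n" by simp
    then show ?thesis by simp
  qed
  from Gcd_mult_Ints[OF D(1) this] show ?thesis using D(3) by simp
qed

lemma representable_complete_residues:
  assumes "complete_residues R E"
  shows "representable R E = UNIV"
proof -
  have "\<forall>x. \<exists>l q. l \<in> E \<and> x = R * q + l"
  proof
    fix x
    obtain l where "l \<in> E" "[x = l] (mod R)"
      using assms unfolding complete_residues_def by blast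
    then show "\<exists>l q. l \<in> E \<and> x = R * q + l"
      by (metis add.commute cong_iff_lin cong_sym)
  qed
  then obtain l q where lq: "\<And>x. l x \<in> E \<and> x = R * q x + l x" by metis
  have "x \<in> representable R E" for x
    unfolding representable_def
  proof (rule CollectI, rule exI[of _ "\<lambda>k. (q ^^ k) x"], rule exI[of _ "\<lambda>k. l ((q ^^ k) x)"],
      intro conjI allI)
    fix k
    show "l ((q ^^ k) x) \<in> E" using lq by blast
    show "(q ^^ k) x = R * (q ^^ Suc k) x + l ((q ^^ k) x)"
      using conjunct2[OF lq[of "(q ^^ k) x"]] by simp
  qed simp
  then show ?thesis by auto
qed

section \<open>Uniqueness of sums of representable integers\<close>

lemma direct_sum_residues_inj:
  assumes dd: "disjoint_differences L L'" and cr: "complete_residues R (L + L')"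
    and l: "l \<in> L" "m \<in> L" "l' \<in> L'" "m' \<in> L'" and c: "R dvd (l + l') - (m + m')"
  shows "l = m" "l' = m'"
proof -
  have "l + l' \<in> L + L'" "m + m' \<in> L + L'" using l by auto
  then have "l + l' = m + m'" using complete_residues_dvd_imp_eq[OF cr _ _ c] by blast
  then show "l = m" "l' = m'" using disjoint_differences_inj[OF dd] l by blast+
qed

text \<open>Modulo \<open>R\<close> the two last digits are determined by their sum. After stripping
  them the equation persists, while the difference of the first summands is divided by
  \<open>R\<close>.\<close>

lemma representable_direct_sum_inj:
  assumes R: "R \<ge> 2" and dd: "disjoint_differences L L'" and cr: "complete_residues R (L + L')"
    and x: "x \<in> representable R L" "y \<in> representable R L"
      "x' \<in> representable R L'" "y' \<in> representable R L'" and eq: "x + x' = y + y'"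
  shows "x = y"
  using x eq
proof (induction "nat \<bar>x - y\<bar>" arbitrary: x y x' y' rule: less_induct)
  case less
  obtain l u where u: "l \<in> L" "u \<in> representable R L" "x = R * u + l"
    using less.prems(1) by (rule representable_cases)
  obtain m v where v: "m \<in> L" "v \<in> representable R L" "y = R * v + m"
    using less.prems(2) by (rule representable_cases)
  obtain l' u' where u': "l' \<in> L'" "u' \<in> representable R L'" "x' = R * u' + l'"
    using less.prems(3) by (rule representable_cases)
  obtain m' v' where v': "m' \<in> L'" "v' \<in> representable R L'" "y' = R * v' + m'"
    using less.prems(4) by (rule representable_cases)
  have "(l + l') - (m + m') = R * (v + v' - u - u')"
    using less.prems(5) by (simp add: u v u' v' algebra_simps)
  then have lm: "l = m" "l' = m'"
    using direct_sum_residues_inj[OF dd cr u(1) v(1) u'(1) v'(1)] by simp_all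
  have "R * (u + u') = R * (v + v')"
    using less.prems(5) lm by (simp add: u v u' v' algebra_simps)
  then have uv: "u + u' = v + v'" using R by simp
  have xy: "x - y = R * (u - v)" by (simp add: u v lm algebra_simps)
  show ?case
  proof (rule ccontr)
    assume "x \<noteq> y"
    then have "u \<noteq> v" using xy by auto
    then have "\<bar>u - v\<bar> < \<bar>x - y\<bar>" using R by (simp add: xy abs_mult)
    then have "u = v" using u v u' v' uv by (intro less.hyps[of u v u' v']) auto
    with \<open>u \<noteq> v\<close> show False by simp
  qed
qed

lemma representable_disjoint_differences:
  assumes R: "R \<ge> 2" and dd: "disjoint_differences L L'" and cr: "complete_residues R (L + L')"
    and 0: "0 \<in> L" "0 \<in> L'"
  shows "disjoint_differences (representable R L) (representable R L')"
proof -
  have "z = 0" if z: "z = x - y" "x \<in> representable R L" "y \<in> representable R L"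
    "z = x' - y'" "x' \<in> representable R L'" "y' \<in> representable R L'" for x y z x' y'
  proof -
    have "x + y' = y + x'" using z by simp
    then have "x = y" using representable_direct_sum_inj[OF R dd cr] z by blast
    then show ?thesis using z by simp
  qed
  moreover have "\<exists>x y. (0::int) = x - y \<and> x \<in> representable R D \<and> y \<in> representable R D" if "0 \<in> D" for D
    using zero_representable[OF that] by (intro exI[of _ 0]) simp
  ultimately show ?thesis
    unfolding disjoint_differences_def using 0 by blast
qed

lemma proj_direct_sum:
  assumes "disjoint_differences L L'" "l \<in> L" "l' \<in> L'"
  shows "proj1 L L' (l + l') = l" "proj2 L L' (l + l') = l'"
  unfolding proj1_def proj2_def
  using assms disjoint_differences_inj[OF assms(1)] by (intro the_equality; blast)+

lemma proj_in:
  assumes "disjoint_differences L L'" "a \<in> L + L'"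
  shows "proj1 L L' a \<in> L" "proj2 L L' a \<in> L'" "proj1 L L' a + proj2 L L' a = a"
  using assms proj_direct_sum[OF assms(1)] by (auto elim!: set_plus_elim)

text \<open>At integers the mask is 1, so extremality is automatic.\<close>

lemma integer_cycle_extreme:
  assumes "finite B" "B \<noteq> {}" "is_cycle R L xs ls" "set xs \<subseteq> \<int>"
  shows "is_extreme_cycle R B L xs ls"
  using assms mask_Ints[OF assms(1,2)] by (auto simp: is_extreme_cycle_def subset_iff)

text \<open>A solution of \<open>w\<^sub>k = R w\<^sub>k\<^sub>+\<^sub>1\<close> along a finite cycle vanishes, as one sees at an entry
  of maximal modulus.\<close>

lemma cycle_points_unique:
  fixes w :: "nat \<Rightarrow> real"
  assumes R: "R \<ge> 2" and w: "\<And>k. k < n \<Longrightarrow> w k / of_int R = w (Suc k mod n)" and k: "k < n"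
  shows "w k = 0"
proof -
  have n: "n > 0" using k by simp
  obtain j where j: "j < n" "\<And>i. i < n \<Longrightarrow> \<bar>w i\<bar> \<le> \<bar>w j\<bar>"
  proof -
    have "Max ((\<lambda>i. \<bar>w i\<bar>) ` {..<n}) \<in> (\<lambda>i. \<bar>w i\<bar>) ` {..<n}"
      using n by (intro Max_in) auto
    then obtain j where "j < n" "Max ((\<lambda>i. \<bar>w i\<bar>) ` {..<n}) = \<bar>w j\<bar>" by auto
    then show ?thesis
      using Max_ge[of "(\<lambda>i. \<bar>w i\<bar>) ` {..<n}"] by (intro that[of j]) force+
  qed
  \<comment> \<open>The cyclic predecessor of the maximal entry, whose modulus is \<open>R\<close>
    times as large.\<close>
  define i where "i = (if j = 0 then n - 1 else j - 1)"
  have i: "i < n" "Suc i mod n = j" using j(1) n by (auto simp: i_def)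
  have "w i = of_int R * w j" using w[OF i(1)] R by (simp add: i(2) field_simps)
  then have "of_int R * \<bar>w j\<bar> \<le> \<bar>w j\<bar>" using j(2)[OF i(1)] R by (simp add: abs_mult)
  moreover have "2 * \<bar>w j\<bar> \<le> of_int R * \<bar>w j\<bar>" using R by (intro mult_right_mono) auto
  ultimately have "\<bar>w j\<bar> = 0" by linarith
  then show ?thesis using j(2)[OF k] by simp
qed

subsection \<open>Complementary Hadamard pairs\<close>

lemma representation_tail:
  assumes "\<And>k. l k \<in> D \<and> y k = R * y (Suc k) + l k"
  shows "y k \<in> representable R D"
  unfolding representable_def
proof (rule CollectI, rule exI[of _ "\<lambda>j. y (k + j)"], rule exI[of _ "\<lambda>j. l (k + j)"],
    intro conjI allI)
  fix j
  show "l (k + j) \<in> D" "y (k + j) = R * y (k + Suc j) + l (k + j)"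
    using assms[of "k + j"] unfolding add_Suc_right by blast+
qed simp

text \<open>Converse to \<open>integer_cycle_step\<close>: the negated quotients of a periodic
  expansion form an integral cycle with the same digits.\<close>

lemma periodic_representation_extreme_cycle:
  assumes R: "R \<noteq> 0" and B: "finite B" "B \<noteq> {}" and n: "n > 0"
    and y: "\<And>k. l k \<in> L \<and> y k = R * y (Suc k) + l k" "y n = y 0"
  shows "is_extreme_cycle R B L (map (\<lambda>k. - of_int (y k)) [0..<n]) (map l [0..<n])"
proof (rule integer_cycle_extreme[OF B])
  show "is_cycle R L (map (\<lambda>k. - real_of_int (y k)) [0..<n]) (map l [0..<n])"
    unfolding is_cycle_def
  proof (intro conjI allI impI)
    fix k assume "k < length (map (\<lambda>k. - real_of_int (y k)) [0..<n])"
    then have k: "k < n" by simp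
    have "real_of_int (y k) = of_int R * of_int (y (Suc k)) + of_int (l k)"
      using y(1)[of k] by (metis of_int_add of_int_mult)
    then have "(- real_of_int (y k) + of_int (l k)) / of_int R = - of_int (y (Suc k))"
      using R by simp
    also have "y (Suc k) = y (Suc k mod n)" using k y(2) by (cases "Suc k = n") auto
    finally show "(map (\<lambda>k. - real_of_int (y k)) [0..<n] ! k + of_int (map l [0..<n] ! k)) / of_int R
        = map (\<lambda>k. - real_of_int (y k)) [0..<n] ! (Suc k mod length (map (\<lambda>k. - real_of_int (y k)) [0..<n]))"
      using k n by simp
  next
    show "set (map l [0..<n]) \<subseteq> L"
      using y(1)[THEN conjunct1] by (intro subsetI) (auto simp only: set_map)
  qed (use n in simp_all)
  show "set (map (\<lambda>k. - real_of_int (y k)) [0..<n]) \<subseteq> \<int>" by auto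
qed

lemma complementary_hadamard_pairsD:
  assumes "complementary_hadamard_pairs R B L B' L'"
  shows "hadamard_pair R B L" "hadamard_pair R B' L'" "disjoint_differences B B'"
    "disjoint_differences L L'" "complete_residues R (B + B')" "complete_residues R (L + L')"
    "\<And>xs ls. is_extreme_cycle R B L xs ls \<Longrightarrow> set xs \<subseteq> \<int>"
    "\<And>xs ls. is_extreme_cycle R B' L' xs ls \<Longrightarrow> set xs \<subseteq> \<int>"
    "Gcd (B + B') = 1" "R \<ge> 2" "finite (B + B')" "0 \<in> B + B'" "0 \<in> L + L'"
  using assms hadamard_pair_R[of R B L] hadamard_pair_finite[of R B L] hadamard_pair_finite[of R B' L']
    hadamard_pair_0[of R B L] hadamard_pair_0[of R B' L']
    set_plus_intro[of 0 B 0 B'] set_plus_intro[of 0 L 0 L']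
  unfolding complementary_hadamard_pairs_def by (auto simp: finite_set_plus)

lemma direct_sum_extreme_cycle_integral:
  assumes "complementary_hadamard_pairs R B L B' L'" "is_extreme_cycle R (B + B') E xs a"
  shows "set xs \<subseteq> \<int>"
  using cmod_mask_eq_1_imp_Ints[OF complementary_hadamard_pairsD(11,12,9)[OF assms(1)]] assms(2)
  by (auto simp: is_extreme_cycle_def)

text \<open>The negated cycle is a periodic expansion with digits in \<open>L + L'\<close>.
  Splitting its first term into representable summands splits the whole expansion digit by digit,
  since digits are unique modulo \<open>R\<close>.\<close>

lemma cycle_digits_split:
  assumes c: "complementary_hadamard_pairs R B L B' L'"
    and cov: "representable R L + representable R L' = UNIV"
    and ext: "is_extreme_cycle R (B + B') (L + L') xs a"
  shows "extreme_cycle_digits R B L (map (proj1 L L') a)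
    \<and> extreme_cycle_digits R B' L' (map (proj2 L L') a)"
proof -
  note ch = complementary_hadamard_pairsD[OF c]
  have R: "R \<noteq> 0" using ch(10) by simp
  have int: "set xs \<subseteq> \<int>" by (rule direct_sum_extreme_cycle_integral[OF c ext])
  have cyc: "is_cycle R (L + L') xs a" using ext by (simp add: is_extreme_cycle_def)
  define n where "n = length xs"
  have n: "n > 0" "length a = n" using cyc by (auto simp: n_def is_cycle_def)
  define x where "x k = - \<lfloor>xs ! (k mod n)\<rfloor>" for k
  define d where "d k = a ! (k mod n)" for k
  have x: "x k = R * x (Suc k) + d k" and d: "d k \<in> L + L'" for k
    using integer_cycle_step[OF cyc int R, of k] by (simp_all only: x_def d_def n_def)
  have "x 0 \<in> representable R L + representable R L'" using cov by simp
  then obtain y0 z0 where yz0: "y0 \<in> representable R L" "z0 \<in> representable R L'" "x 0 = y0 + z0"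
    by (rule set_plus_elim)
  obtain y l where y: "y 0 = y0" "\<And>k. l k \<in> L \<and> y k = R * y (Suc k) + l k"
    using yz0(1) unfolding representable_def by blast
  obtain z l' where z: "z 0 = z0" "\<And>k. l' k \<in> L' \<and> z k = R * z (Suc k) + l' k"
    using yz0(2) unfolding representable_def by blast
  have step: "d k = l k + l' k \<and> x (Suc k) = y (Suc k) + z (Suc k)" if "x k = y k + z k" for k
  proof -
    have e: "R * x (Suc k) + d k = R * y (Suc k) + l k + (R * z (Suc k) + l' k)"
      using that x[of k] y(2)[of k] z(2)[of k] by linarith
    then have "d k - (l k + l' k) = R * (y (Suc k) + z (Suc k) - x (Suc k))"
      by (simp add: algebra_simps)
    then have "R dvd d k - (l k + l' k)" by simp
    moreover have "l k + l' k \<in> L + L'" using y(2) z(2) by auto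
    ultimately have dk: "d k = l k + l' k"
      using complete_residues_dvd_imp_eq[OF ch(6) d] by blast
    then have "R * x (Suc k) = R * (y (Suc k) + z (Suc k))"
      using e by (simp add: algebra_simps)
    then show ?thesis using dk R by simp
  qed
  have sum: "x k = y k + z k" for k
    by (induction k) (use step yz0 y(1) z(1) in auto)
  have dk: "d k = l k + l' k" for k using step[OF sum] by blast
  have "x n = x 0" by (simp add: x_def)
  then have per: "y n + z n = y 0 + z 0" by (simp add: sum)
  note yrep = representation_tail[of l L y R, OF y(2)] and zrep = representation_tail[of l' L' z R, OF z(2)]
  \<comment> \<open>The sum of the two expansions returns after \<open>n\<close> steps, and
    uniqueness of the decomposition makes each summand return.\<close>
  have yn: "y n = y 0"
    by (rule representable_direct_sum_inj[OF ch(10,4,6) yrep yrep zrep zrep per])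
  then have zn: "z n = z 0" using per by simp
  note h = hadamard_pair_finite hadamard_pair_nonempty
  have a_nth: "a ! k = l k + l' k" if "k < n" for k
    using dk[of k] that by (simp add: d_def)
  have "map (proj1 L L') a = map l [0..<n]" "map (proj2 L L') a = map l' [0..<n]"
    using n(2) a_nth proj_direct_sum[OF ch(4) y(2)[THEN conjunct1] z(2)[THEN conjunct1]]
    by (auto intro!: nth_equalityI)
  then show ?thesis
    unfolding extreme_cycle_digits_def
    using periodic_representation_extreme_cycle[where l = l and y = y, OF R h(1)[OF ch(1)] h(3)[OF ch(1)] n(1) y(2) yn]
      periodic_representation_extreme_cycle[where l = l' and y = z, OF R h(1)[OF ch(2)] h(3)[OF ch(2)] n(1) z(2) zn]
    by metis
qed

text \<open>Repeated division by \<open>R\<close> leads each integer into a periodic orbit, and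
  membership in \<open>T\<close> passes back along a division step. On the orbit the digits form an
  extreme cycle, and the two projected cycles, being integral, supply the summands.\<close>

lemma representable_direct_sum_UNIV:
  assumes c: "complementary_hadamard_pairs R B L B' L'"
    and dig: "\<And>a. extreme_cycle_digits R (B + B') (L + L') a \<Longrightarrow>
      extreme_cycle_digits R B L (map (proj1 L L') a) \<and> extreme_cycle_digits R B' L' (map (proj2 L L') a)"
  shows "representable R L + representable R L' = UNIV"
proof -
  note ch = complementary_hadamard_pairsD[OF c]
  have R: "R \<ge> 2" "R \<noteq> 0" using ch(10) by auto
  define T where "T = representable R L + representable R L'"
  have "\<forall>x. \<exists>l q. l \<in> L + L' \<and> x = R * q + l"
    using representable_complete_residues[OF ch(6)] representable_cases[of _ R "L + L'"]
    by (metis UNIV_I)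
  then obtain e q where eq: "\<And>x. e x \<in> L + L'" "\<And>x. x = R * q x + e x" by metis
  have T_step: "x \<in> T" if qx: "q x \<in> T" for x
  proof -
    obtain y z where yz: "y \<in> representable R L" "z \<in> representable R L'" "q x = y + z"
      using qx unfolding T_def by (rule set_plus_elim)
    obtain l l' where l: "l \<in> L" "l' \<in> L'" "e x = l + l'"
      using eq(1) by (rule set_plus_elim)
    have "x = (R * y + l) + (R * z + l')"
      using eq(2)[of x] yz l by (simp add: algebra_simps)
    then show ?thesis
      unfolding T_def using representable_step[OF l(1) yz(1)] representable_step[OF l(2) yz(2)]
      by (metis set_plus_intro)
  qed
  have "x \<in> T" for x
  proof -
    \<comment> \<open>With both \<open>z\<close> and its digit bounded by \<open>m\<close>, the
      quotient satisfies \<open>\<bar>R * q z\<bar> \<le> 2 * m\<close>, so orbits stay in a finite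
      set.\<close>
    define m where "m = max \<bar>x\<bar> (\<Sum>l\<in>L + L'. \<bar>l\<bar>)"
    have finE: "finite (L + L')"
      using hadamard_pair_finite[OF ch(1)] hadamard_pair_finite[OF ch(2)] by (simp add: finite_set_plus)
    have qm: "\<bar>q z\<bar> \<le> m" if z: "\<bar>z\<bar> \<le> m" for z
    proof -
      have "\<bar>e z\<bar> \<le> m"
        using member_le_sum[of "e z" "L + L'" "\<lambda>l. \<bar>l\<bar>"] eq(1) finE by (simp add: m_def)
      moreover have "R * q z = z - e z" using eq(2)[of z] by simp
      ultimately have "\<bar>R * q z\<bar> \<le> 2 * m" using z by simp
      moreover have "2 * \<bar>q z\<bar> \<le> \<bar>R * q z\<bar>"
        using R by (simp add: abs_mult mult_right_mono)
      ultimately show ?thesis by simp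
    qed
    have "\<bar>(q ^^ k) x\<bar> \<le> m" for k
      by (induction k) (use qm in \<open>auto simp: m_def\<close>)
    then have "range (\<lambda>k. (q ^^ k) x) \<subseteq> {- m..m}" by (auto simp: abs_le_iff minus_le_iff)
    then have "finite (range (\<lambda>k. (q ^^ k) x))" by (rule finite_subset) simp
    moreover have "x \<in> range (\<lambda>k. (q ^^ k) x)" by (rule range_eqI[of _ _ 0]) simp
    moreover have "q ` range (\<lambda>k. (q ^^ k) x) \<subseteq> range (\<lambda>k. (q ^^ k) x)"
    proof safe
      show "q ((q ^^ k) x) \<in> range (\<lambda>k. (q ^^ k) x)" for k by (rule range_eqI[of _ _ "Suc k"]) simp
    qed
    ultimately obtain y n where y: "y \<in> range (\<lambda>k. (q ^^ k) x)" "n > 0" "(q ^^ n) y = y"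
      by (rule iterate_periodic)
    define Y where "Y k = (q ^^ k) y" for k
    have Y: "e (Y k) \<in> L + L' \<and> Y k = R * Y (Suc k) + e (Y k)" "Y n = Y 0" for k
      using eq(1) eq(2)[of "Y k"] y(3) by (simp_all add: Y_def)
    define a where "a = map (\<lambda>k. e (Y k)) [0..<n]"
    have ne: "B + B' \<noteq> {}" using ch(12) by auto
    have ec: "is_extreme_cycle R (B + B') (L + L') (map (\<lambda>k. - of_int (Y k)) [0..<n]) a"
      unfolding a_def using periodic_representation_extreme_cycle[where l = "\<lambda>k. e (Y k)" and y = Y,
        OF R(2) ch(11) ne y(2) Y] .
    then obtain us vs where us: "is_extreme_cycle R B L us (map (proj1 L L') a)"
      and vs: "is_extreme_cycle R B' L' vs (map (proj2 L L') a)"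
      using dig unfolding extreme_cycle_digits_def by blast
    have usc: "is_cycle R L us (map (proj1 L L') a)" and vsc: "is_cycle R L' vs (map (proj2 L L') a)"
      using us vs by (auto simp: is_extreme_cycle_def)
    have len: "length us = n" "length vs = n"
      using usc vsc by (simp_all add: is_cycle_def a_def)
    have uint: "set us \<subseteq> \<int>" and vint: "set vs \<subseteq> \<int>" using ch(7)[OF us] ch(8)[OF vs] by auto
    \<comment> \<open>The sum of the two projected cycles and the negated orbit are cycles with the
      same digits. Their difference \<open>w\<close> satisfies the relation without digits and hence
      vanishes.\<close>
    define w where "w k = us ! k + vs ! k + of_int (Y k)" for k
    have "w k / of_int R = w (Suc k mod n)" if k: "k < n" for k
    proof -
      have "(us ! k + of_int (proj1 L L' (a ! k))) / of_int R = us ! (Suc k mod n)"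
        "(vs ! k + of_int (proj2 L L' (a ! k))) / of_int R = vs ! (Suc k mod n)"
        using usc vsc k len by (auto simp: is_cycle_def a_def)
      moreover have "(- of_int (Y k) + of_int (a ! k)) / of_int R = - real_of_int (Y (Suc k mod n))"
        using ec k by (auto simp: is_extreme_cycle_def is_cycle_def a_def)
      moreover have pa: "real_of_int (a ! k) = of_int (proj1 L L' (a ! k)) + of_int (proj2 L L' (a ! k))"
        using proj_in(3)[OF ch(4), of "a ! k"] k Y(1) by (simp add: a_def flip: of_int_add)
      moreover have "w k / of_int R = (us ! k + of_int (proj1 L L' (a ! k))) / of_int R
          + (vs ! k + of_int (proj2 L L' (a ! k))) / of_int R - (- of_int (Y k) + of_int (a ! k)) / of_int R"
        unfolding add_divide_distrib[symmetric] diff_divide_distrib[symmetric] pa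
        by (simp add: w_def)
      ultimately show ?thesis by (simp add: w_def)
    qed
    from cycle_points_unique[where w = w, OF R(1) this y(2)] have w0: "us ! 0 + vs ! 0 + of_int (Y 0) = 0"
      by (simp add: w_def)
    have "us ! 0 \<in> \<int>" using uint len y(2) nth_mem[of 0 us] by (metis subsetD)
    then obtain u where u: "us ! 0 = of_int u" by (rule Ints_cases)
    have "vs ! 0 \<in> \<int>" using vint len y(2) nth_mem[of 0 vs] by (metis subsetD)
    then obtain v where v: "vs ! 0 = of_int v" by (rule Ints_cases)
    have "real_of_int y = of_int (- u + - v)" using w0 by (simp add: u v Y_def)
    then have "y = - u + - v" unfolding of_int_eq_iff .
    moreover have "- u \<in> representable R L"
      using usc uint R(2) _ u by (rule integer_cycle_representable) (use y len in simp)
    moreover have "- v \<in> representable R L'"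
      using vsc vint R(2) _ v by (rule integer_cycle_representable) (use y len in simp)
    ultimately have "y \<in> T" unfolding T_def by (simp only: set_plus_intro)
    moreover have "(q ^^ k) x \<in> T \<Longrightarrow> x \<in> T" for k
    proof (induction k)
      case (Suc k)
      have "(q ^^ k) x \<in> T" by (rule T_step) (use Suc.prems in simp)
      then show ?case by (rule Suc.IH)
    qed simp
    ultimately show ?thesis using y(1) by blast
  qed
  then show ?thesis unfolding T_def by auto
qed

theorem theorem1p13:
  fixes R :: int and B L B' L' :: "int set"
  assumes "complementary_hadamard_pairs R B L B' L'"
  shows
    "((\<forall>E\<in>sets borel. emeasure (invariant_measure R (B + B')) E
          = emeasure lborel (E \<inter> attractor R (B + B')))
      \<and> is_spectrum (invariant_measure R (B + B')) \<int>
      \<and> translation_congruent (attractor R (B + B')) {0..1})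
    \<and> invariant_measure R (B + B') = convolution (invariant_measure R B) (invariant_measure R B')
    \<and> (is_spectrum (invariant_measure R B) (real_of_int ` representable R L)
      \<and> is_spectrum (invariant_measure R B') (real_of_int ` representable R L'))
    \<and> disjoint_differences (representable R L) (representable R L')
    \<and> ((disjoint_differences (representable R L) (representable R L')
          \<and> representable R L + representable R L' = UNIV)
        \<longleftrightarrow> (\<forall>a. extreme_cycle_digits R (B + B') (L + L') a \<longrightarrow>
              extreme_cycle_digits R B L (map (proj1 L L') a)
              \<and> extreme_cycle_digits R B' L' (map (proj2 L L') a)))"
proof -
  note ch = complementary_hadamard_pairsD[OF assms]
  have R0: "R > 0" using ch(10) by simp
  define D where "D = B + B'"
  define X where "X = attractor R D"
  have D: "finite D" "D \<noteq> {}" "complete_residues R D" "0 \<in> D" "int (card D) = R"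
    unfolding D_def using ch(5,11,12) complete_residues_card[OF R0 ch(5)] by auto
  note X = attractor_props[OF ch(10) D(1,2), folded X_def]
  have Xf: "X \<in> fmeasurable lborel" by (rule fmeasurable_compact[OF X(2)])
  have Xpos: "measure lborel X > 0"
    unfolding X_def by (rule attractor_measure_pos[OF ch(10) D(1,3)])
  have inv: "invariant_measure R D = uniform_measure lborel X"
    by (rule invariant_measure_eqI[OF ch(10) D(1,2)
        self_similar_uniform_measure[OF R0 D(1,5) X(2,3) Xpos]])
  have "is_spectrum (invariant_measure R D) (real_of_int ` representable R (L + L'))"
  proof (rule representable_is_spectrum)
    show "hadamard_pair R D (L + L')"
      unfolding D_def by (intro hadamard_pair_complete_residues ch)
    show "set xs \<subseteq> \<int>" if "is_extreme_cycle R D (L + L') xs ls" for xs ls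
      using direct_sum_extreme_cycle_integral[OF assms] that unfolding D_def .
  qed
  then have spec: "is_spectrum (invariant_measure R D) \<int>"
    unfolding representable_complete_residues[OF ch(6)] by (simp add: Ints_def)
  have pack: "X \<inter> (\<lambda>x. x - of_int n) -` X \<in> null_sets lborel" if "n \<noteq> 0" for n :: int
    by (rule spectrum_Ints_packing[OF Xf Xpos spec[unfolded inv] that])
  note tile = tiling[OF X(2) pack attractor_plus_Ints[OF ch(10) D(1,3), folded X_def]]
  \<comment> \<open>The tiling gives mass 1 to the attractor, so the normalising factor of the
    uniform measure disappears.\<close>
  have leb: "emeasure (invariant_measure R D) E = emeasure lborel (E \<inter> X)" if "E \<in> sets borel" for E
  proof -
    have "emeasure lborel X = 1" using tile(1) emeasure_eq_measure2[OF Xf] by simp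
    moreover have "emeasure (uniform_measure lborel X) E = emeasure lborel (X \<inter> E) / emeasure lborel X"
      using that Xf by (intro emeasure_uniform_measure) auto
    ultimately show ?thesis
      unfolding inv by (simp add: Int_commute divide_ennreal_def)
  qed
  have conv: "invariant_measure R (B + B')
      = convolution (invariant_measure R B) (invariant_measure R B')"
    using hadamard_pair_finite[OF ch(1)] hadamard_pair_finite[OF ch(2)]
      hadamard_pair_nonempty[OF ch(1)] hadamard_pair_nonempty[OF ch(2)]
    by (intro invariant_measure_direct_sum ch)
  have dd: "disjoint_differences (representable R L) (representable R L')"
    using hadamard_pair_0(2)[OF ch(1)] hadamard_pair_0(2)[OF ch(2)]
    by (intro representable_disjoint_differences[OF ch(10,4,6)])
  have v: "(representable R L + representable R L' = UNIV)
        \<longleftrightarrow> (\<forall>a. extreme_cycle_digits R (B + B') (L + L') a \<longrightarrow>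
              extreme_cycle_digits R B L (map (proj1 L L') a)
              \<and> extreme_cycle_digits R B' L' (map (proj2 L L') a))"
  proof
    assume cov: "representable R L + representable R L' = UNIV"
    show "\<forall>a. extreme_cycle_digits R (B + B') (L + L') a \<longrightarrow>
              extreme_cycle_digits R B L (map (proj1 L L') a)
              \<and> extreme_cycle_digits R B' L' (map (proj2 L L') a)"
    proof (intro allI impI)
      fix a assume "extreme_cycle_digits R (B + B') (L + L') a"
      then obtain xs where "is_extreme_cycle R (B + B') (L + L') xs a"
        unfolding extreme_cycle_digits_def by blast
      then show "extreme_cycle_digits R B L (map (proj1 L L') a)
              \<and> extreme_cycle_digits R B' L' (map (proj2 L L') a)"
        by (rule cycle_digits_split[OF assms cov])
    qed
  next
    assume dig: "\<forall>a. extreme_cycle_digits R (B + B') (L + L') a \<longrightarrow>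
              extreme_cycle_digits R B L (map (proj1 L L') a)
              \<and> extreme_cycle_digits R B' L' (map (proj2 L L') a)"
    show "representable R L + representable R L' = UNIV"
      by (rule representable_direct_sum_UNIV[OF assms dig[rule_format]])
  qed
  show ?thesis
    unfolding D_def[symmetric] X_def[symmetric]
  proof (intro conjI ballI)
    show "is_spectrum (invariant_measure R B) (real_of_int ` representable R L)"
      by (rule representable_is_spectrum[OF ch(1,7)])
    show "is_spectrum (invariant_measure R B') (real_of_int ` representable R L')"
      by (rule representable_is_spectrum[OF ch(2,8)])
  qed (use leb spec tile(2) conv dd v in \<open>simp_all add: D_def\<close>)
qed

end
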